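(* Let $p$ be a prime number. Suppose that a pro-$p$ group $G$ is one of the following: (i) a generalized right-angled Artin pro-$p$ group; (ii) $p=2$ and $G$ is a $\Delta$-right-angled Artin pro-$2$ group. Then $G$ has the $p$-Kijima--Nishi property.
   Context: For a profinite group $G$, $\mathrm{H}^n(G,\mathbb{F}_p)$ is continuous cohomology with trivial coefficients and $$\mathcal{R}_p(G)=\{\alpha\in \mathrm{H}^1(G,\mathbb{F}_p) : \alpha\smile\beta=0 \text{ for all }\beta\in \mathrm{H}^1(G,\mathbb{F}_p)\}.$$ For an open subgroup $U\le G$, corestriction maps $\mathcal{R}_p(U)$ into $\mathcal{R}_p(G)$, inducing $c_{U,G}:\mathcal{R}_p(U)\to\mathcal{R}_p(G)$. $G$ has the $p$-Kijima--Nishi property if $c_{U,G}$ is surjective for every open normal subgroup $U$ of index $p$. Generalized right-angled Artin pro-$p$ groups: let $\Gamma=(V,E)$ be a finite combinatorial directed graph, i.e. $V$ is a finite set and $E\subseteq V\times V$ is such that $(v,w)\in E$ implies $(w,v)\notin E$ (in particular no loops). Let $f:E\to p\mathbb{Z}_p\times p\mathbb{Z}_p$ if $p$ is odd, $f:E\to 4\mathbb{Z}_2\times 4\mathbb{Z}_2$ if $p=2$, be any map. The associated generalized right-angled Artin pro-$p$ group is the pro-$p$ group with pro-$p$ presentation $$G_{\Gamma,f}=\langle v\in V\mid [v,w]=v^{\lambda_1}w^{\lambda_2}\ \text{for } (v,w)\in E,\ (\lambda_1,\lambda_2)=f(v,w)\rangle.$$ For $f=0$ it is the right-angled Artin pro-$p$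 group $G_\Gamma$. $\Delta$-right-angled Artin pro-$2$ groups: let $\Gamma=(V,E)$ be a finite graph with right-angled Artin pro-$2$ group $G_\Gamma$ (generated by $V$ with relations $[v,w]=1$ for adjacent $v,w$), and let $\Delta=\{1,x_0\}$ be the group of order two. Let $\mathbf{z}:V\to G_\Gamma$, $v\mapsto\mathbf{z}_v$, be a function such that $v\mapsto \mathbf{z}_v v^{-1}\mathbf{z}_v^{-1}$ $(v\in V)$ induces an automorphism $a_{\mathbf{z}}$ of $G_\Gamma$ of order two. Let $\Delta$ act on $G_\Gamma$ by $x_0\mapsto a_{\mathbf{z}}$. The associated $\Delta$-right-angled Artin pro-$2$ group is the semidirect product $G_{\Gamma,\mathbf{z}}=G_\Gamma\rtimes\Delta$. *)

theory Defs
  imports "HOL-Analysis.Analysis" "HOL-Algebra.Elementary_Groups" "HOL-Algebra.QuotRing"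
    "HOL-Number_Theory.Residues"
begin

section \<open>Profinite and pro-p groups\<close>

record 'a top_group = "'a monoid" +
  topo :: "'a topology"

definition topological_group :: "'a top_group \<Rightarrow> bool" where
  "topological_group G \<longleftrightarrow>
     group G \<and> topspace (topo G) = carrier G \<and>
     continuous_map (prod_topology (topo G) (topo G)) (topo G) (\<lambda>(x, y). x \<otimes>\<^bsub>G\<^esub> y) \<and>
     continuous_map (topo G) (topo G) (\<lambda>x. inv\<^bsub>G\<^esub> x)"

definition profinite_group :: "'a top_group \<Rightarrow> bool" where
  "profinite_group G \<longleftrightarrow>
     topological_group G \<and> compact_space (topo G) \<and> Hausdorff_space (topo G) \<and>
     (\<forall>x\<in>carrier G. connected_component_of_set (topo G) x = {x})"

definition pro_p_group :: "nat \<Rightarrow> 'a top_group \<Rightarrow> bool" where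
  "pro_p_group p G \<longleftrightarrow>
     profinite_group G \<and>
     (\<forall>N. N \<lhd> G \<longrightarrow> openin (topo G) N \<longrightarrow> (\<exists>k. card (rcosets\<^bsub>G\<^esub> N) = p ^ k))"

definition top_group_iso :: "'a top_group \<Rightarrow> 'b top_group \<Rightarrow> ('a \<Rightarrow> 'b) set" where
  "top_group_iso G H = {h \<in> iso G H. homeomorphic_map (topo G) (topo H) h}"

definition top_isomorphic :: "'a top_group \<Rightarrow> 'b top_group \<Rightarrow> bool" where
  "top_isomorphic G H \<longleftrightarrow> top_group_iso G H \<noteq> {}"

definition top_subgroup :: "'a top_group \<Rightarrow> 'a set \<Rightarrow> 'a top_group" where
  "top_subgroup G U = G\<lparr>carrier := U, topo := subtopology (topo G) U\<rparr>"

text \<open>The quotient group with the quotient topology; a set of cosets is open iff its union is.\<close>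

definition top_quotient :: "'a top_group \<Rightarrow> 'a set \<Rightarrow> 'a set top_group" where
  "top_quotient G N =
     \<lparr>carrier = carrier (G Mod N), monoid.mult = monoid.mult (G Mod N), one = one (G Mod N),
      topo = topology (\<lambda>W. W \<subseteq> carrier (G Mod N) \<and> openin (topo G) (\<Union>W))\<rparr>"

lemma openin_top_quotient:
  assumes "topological_group G" "subgroup N G"
  shows "openin (topo (top_quotient G N)) W \<longleftrightarrow>
           W \<subseteq> carrier (G Mod N) \<and> openin (topo G) (\<Union>W)"
proof -
  interpret group G using assms(1) by (simp add: topological_group_def)
  have disj: "\<Union>(S \<inter> T) = \<Union>S \<inter> \<Union>T"
    if ST: "S \<subseteq> carrier (G Mod N)" "T \<subseteq> carrier (G Mod N)" for S T
  proof
    show "\<Union>S \<inter> \<Union>T \<subseteq> \<Union>(S \<inter> T)"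
    proof
      fix x assume "x \<in> \<Union>S \<inter> \<Union>T"
      then obtain C D where CD: "C \<in> S" "D \<in> T" "x \<in> C" "x \<in> D" by blast
      have "C \<in> rcosets\<^bsub>G\<^esub> N" "D \<in> rcosets\<^bsub>G\<^esub> N"
        using CD(1,2) ST by (auto simp only: FactGroup_def partial_object.simps)
      then have "C = D"
        using rcos_disjoint[OF assms(2)] CD(3,4) unfolding pairwise_def disjnt_def by blast
      then show "x \<in> \<Union>(S \<inter> T)" using CD by blast
    qed
  qed blast
  have "istopology (\<lambda>W. W \<subseteq> carrier (G Mod N) \<and> openin (topo G) (\<Union>W))"
    unfolding istopology_def
  proof (intro conjI allI impI)
    fix S T
    assume "S \<subseteq> carrier (G Mod N) \<and> openin (topo G) (\<Union>S)"
      and "T \<subseteq> carrier (G Mod N) \<and> openin (topo G) (\<Union>T)"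
    then have ST: "S \<subseteq> carrier (G Mod N)" "T \<subseteq> carrier (G Mod N)"
      and op: "openin (topo G) (\<Union>S)" "openin (topo G) (\<Union>T)" by blast+
    show "S \<inter> T \<subseteq> carrier (G Mod N)" using ST(1) by blast
    show "openin (topo G) (\<Union>(S \<inter> T))"
      unfolding disj[OF ST] using op by (rule openin_Int)
  next
    fix K
    assume K: "\<forall>S\<in>K. S \<subseteq> carrier (G Mod N) \<and> openin (topo G) (\<Union>S)"
    then show "\<Union>K \<subseteq> carrier (G Mod N)" by blast
    have "openin (topo G) (\<Union>(Union ` K))"
      by (rule openin_Union) (use K in blast)
    moreover have "\<Union>(Union ` K) = \<Union>(\<Union>K)" by blast
    ultimately show "openin (topo G) (\<Union>(\<Union>K))" by (simp only:)
  qed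
  from topology_inverse'[OF this] show ?thesis
    by (simp only: top_quotient_def top_group.simps)
qed

section \<open>Continuous cohomology with constant coefficients in a discrete ring\<close>

text \<open>
  Homogeneous cochains, as in Neukirch--Schmidt--Wingberg. An \<open>n\<close>-cochain is a continuous map
  \<open>x : G\<^sup>n\<^sup>+\<^sup>1 \<rightarrow> R\<close>, and \<open>inv_cochains G S R n\<close> are those with
  \<open>x (s g\<^sub>0, \<dots>, s g\<^sub>n) = x (g\<^sub>0, \<dots>, g\<^sub>n)\<close> for \<open>s \<in> S\<close>. The cohomology of \<open>G\<close> is that of the complex
  with \<open>S = carrier G\<close>.
\<close>

definition tuples :: "'a top_group \<Rightarrow> nat \<Rightarrow> (nat \<Rightarrow> 'a) set" where
  "tuples G n = {..n} \<rightarrow>\<^sub>E carrier G"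

definition inv_cochains ::
    "'a top_group \<Rightarrow> 'a set \<Rightarrow> 'r ring \<Rightarrow> nat \<Rightarrow> ((nat \<Rightarrow> 'a) \<Rightarrow> 'r) set" where
  "inv_cochains G S R n =
     {x \<in> tuples G n \<rightarrow>\<^sub>E carrier R.
        continuous_map (product_topology (\<lambda>_. topo G) {..n}) (discrete_topology (carrier R)) x \<and>
        (\<forall>s\<in>S. \<forall>g\<in>tuples G n. x (\<lambda>i\<in>{..n}. s \<otimes>\<^bsub>G\<^esub> g i) = x g)}"

definition zero_cochain :: "'a top_group \<Rightarrow> 'r ring \<Rightarrow> nat \<Rightarrow> (nat \<Rightarrow> 'a) \<Rightarrow> 'r" where
  "zero_cochain G R n = (\<lambda>g\<in>tuples G n. \<zero>\<^bsub>R\<^esub>)"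

definition differential ::
    "'a top_group \<Rightarrow> 'r ring \<Rightarrow> nat \<Rightarrow> ((nat \<Rightarrow> 'a) \<Rightarrow> 'r) \<Rightarrow> (nat \<Rightarrow> 'a) \<Rightarrow> 'r" where
  "differential G R n x =
     (\<lambda>g\<in>tuples G (Suc n). \<Oplus>\<^bsub>R\<^esub>i\<in>{..Suc n}.
        (let y = x (\<lambda>j\<in>{..n}. if j < i then g j else g (Suc j))
         in if even i then y else \<ominus>\<^bsub>R\<^esub> y))"

definition inv_cocycles ::
    "'a top_group \<Rightarrow> 'a set \<Rightarrow> 'r ring \<Rightarrow> nat \<Rightarrow> ((nat \<Rightarrow> 'a) \<Rightarrow> 'r) set" where
  "inv_cocycles G S R n =
     {x \<in> inv_cochains G S R n. differential G R n x = zero_cochain G R (Suc n)}"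

definition cocycle_group ::
    "'a top_group \<Rightarrow> 'r ring \<Rightarrow> nat \<Rightarrow> ((nat \<Rightarrow> 'a) \<Rightarrow> 'r) monoid" where
  "cocycle_group G R n =
     \<lparr>carrier = inv_cocycles G (carrier G) R n,
      monoid.mult = (\<lambda>x y. \<lambda>g\<in>tuples G n. x g \<oplus>\<^bsub>R\<^esub> y g),
      one = zero_cochain G R n\<rparr>"

definition coboundaries ::
    "'a top_group \<Rightarrow> 'r ring \<Rightarrow> nat \<Rightarrow> ((nat \<Rightarrow> 'a) \<Rightarrow> 'r) set" where
  "coboundaries G R n =
     (case n of 0 \<Rightarrow> {zero_cochain G R 0}
      | Suc m \<Rightarrow> differential G R m ` inv_cochains G (carrier G) R m)"

definition cohomology ::
    "'a top_group \<Rightarrow> 'r ring \<Rightarrow> nat \<Rightarrow> ((nat \<Rightarrow> 'a) \<Rightarrow> 'r) set monoid" where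
  "cohomology G R n = cocycle_group G R n Mod coboundaries G R n"

definition cohomology_class ::
    "'a top_group \<Rightarrow> 'r ring \<Rightarrow> nat \<Rightarrow> ((nat \<Rightarrow> 'a) \<Rightarrow> 'r) \<Rightarrow> ((nat \<Rightarrow> 'a) \<Rightarrow> 'r) set" where
  "cohomology_class G R n x = coboundaries G R n #>\<^bsub>cocycle_group G R n\<^esub> x"

definition cup_cochain ::
    "'a top_group \<Rightarrow> 'r ring \<Rightarrow> nat \<Rightarrow> nat \<Rightarrow>
     ((nat \<Rightarrow> 'a) \<Rightarrow> 'r) \<Rightarrow> ((nat \<Rightarrow> 'a) \<Rightarrow> 'r) \<Rightarrow> (nat \<Rightarrow> 'a) \<Rightarrow> 'r" where
  "cup_cochain G R m n x y =
     (\<lambda>g\<in>tuples G (m + n). x (\<lambda>i\<in>{..m}. g i) \<otimes>\<^bsub>R\<^esub> y (\<lambda>i\<in>{..n}. g (m + i)))"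

text \<open>
  As for \<^const>\<open>rcoset_mult\<close>, operations on classes are unions over all representatives; since the
  operations are well defined, each of these unions is a single class.
\<close>

definition cup_product ::
    "'a top_group \<Rightarrow> 'r ring \<Rightarrow> nat \<Rightarrow> nat \<Rightarrow>
     ((nat \<Rightarrow> 'a) \<Rightarrow> 'r) set \<Rightarrow> ((nat \<Rightarrow> 'a) \<Rightarrow> 'r) set \<Rightarrow> ((nat \<Rightarrow> 'a) \<Rightarrow> 'r) set" where
  "cup_product G R m n A B =
     (\<Union>x\<in>A. \<Union>y\<in>B. cohomology_class G R (m + n) (cup_cochain G R m n x y))"

text \<open>
  Corestriction for an open subgroup \<open>U\<close>: restricting cochains from \<open>G\<^sup>n\<^sup>+\<^sup>1\<close> to \<open>U\<^sup>n\<^sup>+\<^sup>1\<close> identifies the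
  cohomology of the complex of \<open>U\<close>-invariant cochains on \<open>G\<close> with that of \<open>U\<close>, and corestriction is
  induced by the norm \<open>x \<mapsto> (\<Sum>\<sigma>\<in>G/U. \<sigma> x)\<close>, where \<open>(\<sigma> x) g = x (\<sigma>\<^sup>-\<^sup>1 g)\<close>. As \<open>\<sigma>\<close> runs through
  representatives of the left cosets of \<open>U\<close>, the inverse of \<open>\<sigma>\<close> runs through representatives of the
  right cosets, and by \<open>U\<close>-invariance the choice of representatives does not matter.
\<close>

definition norm_cochain ::
    "'a top_group \<Rightarrow> 'a set \<Rightarrow> 'r ring \<Rightarrow> nat \<Rightarrow> ((nat \<Rightarrow> 'a) \<Rightarrow> 'r) \<Rightarrow> (nat \<Rightarrow> 'a) \<Rightarrow> 'r" where
  "norm_cochain G U R n x =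
     (\<lambda>g\<in>tuples G n. \<Oplus>\<^bsub>R\<^esub>C\<in>rcosets\<^bsub>G\<^esub> U. x (\<lambda>i\<in>{..n}. (SOME t. t \<in> C) \<otimes>\<^bsub>G\<^esub> g i))"

definition corestriction ::
    "'a top_group \<Rightarrow> 'a set \<Rightarrow> 'r ring \<Rightarrow> nat \<Rightarrow>
     ((nat \<Rightarrow> 'a) \<Rightarrow> 'r) set \<Rightarrow> ((nat \<Rightarrow> 'a) \<Rightarrow> 'r) set" where
  "corestriction G U R n A =
     (\<Union>x\<in>{x \<in> inv_cocycles G U R n. restrict x (tuples (top_subgroup G U) n) \<in> A}.
        cohomology_class G R n (norm_cochain G U R n x))"

section \<open>The Kijima--Nishi property\<close>

abbreviation prime_field :: "nat \<Rightarrow> int ring" where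
  "prime_field p \<equiv> residue_ring (int p)"

definition cup_radical :: "nat \<Rightarrow> 'a top_group \<Rightarrow> ((nat \<Rightarrow> 'a) \<Rightarrow> int) set set" where
  "cup_radical p G =
     {\<alpha> \<in> carrier (cohomology G (prime_field p) 1).
        \<forall>\<beta>\<in>carrier (cohomology G (prime_field p) 1).
          cup_product G (prime_field p) 1 1 \<alpha> \<beta> = \<one>\<^bsub>cohomology G (prime_field p) 2\<^esub>}"

text \<open>
  Corestriction always maps the radical of \<open>U\<close> into that of \<open>G\<close> (projection formula), so surjectivity
  of the induced map is the inclusion below.
\<close>

definition kijima_nishi :: "nat \<Rightarrow> 'a top_group \<Rightarrow> bool" where
  "kijima_nishi p G \<longleftrightarrow>
     (\<forall>U. U \<lhd> G \<longrightarrow> openin (topo G) U \<longrightarrow> card (rcosets\<^bsub>G\<^esub> U) = p \<longrightarrow>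
        cup_radical p G \<subseteq>
          corestriction G U (prime_field p) 1 ` cup_radical p (top_subgroup G U))"

section \<open>Pro-p presentations\<close>

text \<open>
  Free pro-\<open>p\<close> group on the finite set \<open>V\<close>. It suffices to ask for the universal property with
  respect to finite \<open>p\<close>-groups, of which all pro-\<open>p\<close> groups are inverse limits; every
  finite group is isomorphic to one with elements in \<^typ>\<open>nat\<close>. Uniqueness of \<open>h\<close>
  follows from topological generation.
\<close>

definition free_pro_p_group :: "nat \<Rightarrow> 'v set \<Rightarrow> ('v \<Rightarrow> 'f) \<Rightarrow> 'f top_group \<Rightarrow> bool" where
  "free_pro_p_group p V \<iota> F \<longleftrightarrow>
     finite V \<and> pro_p_group p F \<and> \<iota> \<in> V \<rightarrow> carrier F \<and>
     topo F closure_of generate F (\<iota> ` V) = carrier F \<and>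
     (\<forall>(H :: nat monoid) \<phi>. group H \<and> finite (carrier H) \<and> (\<exists>k. order H = p ^ k) \<and>
        \<phi> \<in> V \<rightarrow> carrier H \<longrightarrow>
        (\<exists>h\<in>hom F H. continuous_map (topo F) (discrete_topology (carrier H)) h \<and>
           (\<forall>v\<in>V. h (\<iota> v) = \<phi> v)))"

definition closed_normal_closure :: "'a top_group \<Rightarrow> 'a set \<Rightarrow> 'a set" where
  "closed_normal_closure G S = \<Inter>{N. N \<lhd> G \<and> closedin (topo G) N \<and> S \<subseteq> N}"

text \<open>The pro-\<open>p\<close> group \<open>\<langle>V | S\<rangle>\<close>, where \<open>S\<close> is a set of relators in a free pro-\<open>p\<close> group \<open>F\<close> on \<open>V\<close>.\<close>

definition presented_group :: "'f top_group \<Rightarrow> 'f set \<Rightarrow> 'f set top_group" where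
  "presented_group F S = top_quotient F (closed_normal_closure F S)"

definition presented_generator :: "'f top_group \<Rightarrow> 'f set \<Rightarrow> ('v \<Rightarrow> 'f) \<Rightarrow> 'v \<Rightarrow> 'f set" where
  "presented_generator F S \<iota> v = closed_normal_closure F S #>\<^bsub>F\<^esub> \<iota> v"

section \<open>p-adic exponents\<close>

text \<open>A \<open>p\<close>-adic integer is the sequence of its residues modulo \<open>p\<^sup>n\<close>.\<close>

definition padic_int :: "nat \<Rightarrow> (nat \<Rightarrow> int) set" where
  "padic_int p =
     {a. \<forall>n. a n \<in> {0..<int p ^ n} \<and> a (Suc n) mod int p ^ n = a n}"

definition padic_ideal :: "nat \<Rightarrow> nat \<Rightarrow> (nat \<Rightarrow> int) set" where
  "padic_ideal p k = {\<lambda>n. (int p ^ k * b n) mod int p ^ n | b. b \<in> padic_int p}"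

definition padic_pow :: "'a top_group \<Rightarrow> 'a \<Rightarrow> (nat \<Rightarrow> int) \<Rightarrow> 'a" where
  "padic_pow G x a = (THE y. limitin (topo G) (\<lambda>n. x [^]\<^bsub>G\<^esub> a n) y sequentially)"

section \<open>Generalized right-angled Artin pro-p groups\<close>

definition commutator :: "('a, 'm) monoid_scheme \<Rightarrow> 'a \<Rightarrow> 'a \<Rightarrow> 'a" where
  "commutator G x y = x \<otimes>\<^bsub>G\<^esub> y \<otimes>\<^bsub>G\<^esub> inv\<^bsub>G\<^esub> x \<otimes>\<^bsub>G\<^esub> inv\<^bsub>G\<^esub> y"

text \<open>
  With the other convention \<open>x\<^sup>-\<^sup>1 y\<^sup>-\<^sup>1 x y\<close> for commutators one gets the same class of groups:
  substituting \<open>v\<^sup>-\<^sup>1\<close> for each generator \<open>v\<close> replaces one convention by the other and \<open>f\<close> by \<open>-f\<close>.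
\<close>

definition combinatorial_digraph :: "'v set \<Rightarrow> ('v \<times> 'v) set \<Rightarrow> bool" where
  "combinatorial_digraph V E \<longleftrightarrow>
     finite V \<and> E \<subseteq> V \<times> V \<and> (\<forall>v w. (v, w) \<in> E \<longrightarrow> (w, v) \<notin> E)"

definition generalized_raag_relators ::
    "'f top_group \<Rightarrow> ('v \<Rightarrow> 'f) \<Rightarrow> ('v \<times> 'v) set \<Rightarrow>
     ('v \<times> 'v \<Rightarrow> (nat \<Rightarrow> int) \<times> (nat \<Rightarrow> int)) \<Rightarrow> 'f set" where
  "generalized_raag_relators F \<iota> E f =
     {commutator F (\<iota> v) (\<iota> w) \<otimes>\<^bsub>F\<^esub>
        inv\<^bsub>F\<^esub> (padic_pow F (\<iota> v) (fst (f (v, w))) \<otimes>\<^bsub>F\<^esub> padic_pow F (\<iota> w) (snd (f (v, w))))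
      | v w. (v, w) \<in> E}"

definition generalized_raag :: "nat \<Rightarrow> 'v set \<Rightarrow> ('v \<Rightarrow> 'f) \<Rightarrow> 'f top_group \<Rightarrow> 'a top_group \<Rightarrow> bool"
  where
  "generalized_raag p V \<iota> F G \<longleftrightarrow>
     (\<exists>E f. combinatorial_digraph V E \<and>
        (let I = padic_ideal p (if p = 2 then 2 else 1) in f \<in> E \<rightarrow> I \<times> I) \<and>
        top_isomorphic G (presented_group F (generalized_raag_relators F \<iota> E f)))"

section \<open>Delta-right-angled Artin pro-2 groups\<close>

definition simple_graph :: "'v set \<Rightarrow> ('v \<times> 'v) set \<Rightarrow> bool" where
  "simple_graph V E \<longleftrightarrow> finite V \<and> E \<subseteq> V \<times> V \<and> sym E \<and> irrefl E"

definition raag_relators :: "'f top_group \<Rightarrow> ('v \<Rightarrow> 'f) \<Rightarrow> ('v \<times> 'v) set \<Rightarrow> 'f set" where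
  "raag_relators F \<iota> E = {commutator F (\<iota> v) (\<iota> w) | v w. (v, w) \<in> E}"

definition top_semidirect ::
    "'a top_group \<Rightarrow> 'd top_group \<Rightarrow> ('d \<Rightarrow> 'a \<Rightarrow> 'a) \<Rightarrow> ('a \<times> 'd) top_group" where
  "top_semidirect N D act =
     \<lparr>carrier = carrier N \<times> carrier D,
      monoid.mult = (\<lambda>(x, c) (y, d). (x \<otimes>\<^bsub>N\<^esub> act c y, c \<otimes>\<^bsub>D\<^esub> d)),
      one = (\<one>\<^bsub>N\<^esub>, \<one>\<^bsub>D\<^esub>),
      topo = prod_topology (topo N) (topo D)\<rparr>"

text \<open>The group \<open>{1, x\<^sub>0}\<close> of order two as \<open>\<int>/2\<close>: the identity is \<open>0\<close> and \<open>x\<^sub>0\<close> is \<open>1\<close>.\<close>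

definition order_two_group :: "int top_group" where
  "order_two_group =
     \<lparr>carrier = carrier (integer_mod_group 2), monoid.mult = monoid.mult (integer_mod_group 2),
      one = one (integer_mod_group 2), topo = discrete_topology (carrier (integer_mod_group 2))\<rparr>"

definition delta_raag :: "'v set \<Rightarrow> ('v \<Rightarrow> 'f) \<Rightarrow> 'f top_group \<Rightarrow> 'a top_group \<Rightarrow> bool" where
  "delta_raag V \<iota> F G \<longleftrightarrow>
     (\<exists>E z a.
        let S = raag_relators F \<iota> E;
            A = presented_group F S;
            gen = presented_generator F S \<iota>
        in simple_graph V E \<and>
           z \<in> V \<rightarrow> carrier A \<and>
           a \<in> top_group_iso A A \<and>
           (\<forall>v\<in>V. a (gen v) = z v \<otimes>\<^bsub>A\<^esub> inv\<^bsub>A\<^esub> gen v \<otimes>\<^bsub>A\<^esub> inv\<^bsub>A\<^esub> z v) \<and>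
           (\<forall>x\<in>carrier A. a (a x) = x) \<and> (\<exists>x\<in>carrier A. a x \<noteq> x) \<and>
           top_isomorphic G
             (top_semidirect A order_two_group (\<lambda>d. if d = 1 then a else (\<lambda>x. x))))"

end

theory Submission
  imports Defs "HOL-Algebra.Weak_Morphisms"
begin

text \<open>
  A cup product \<open>\<alpha> \<smile> \<beta>\<close> of characters vanishes iff \<open>(\<alpha>, \<beta>)\<close> lifts to the Heisenberg group over
  \<open>\<int>/p\<close>.

  Let \<open>G\<close> be a generalized right-angled Artin group and \<open>\<alpha>\<close> in the radical. Lifting \<open>(\<alpha>, \<beta>)\<close> for the dual
  characters \<open>\<beta>\<close> of the generators shows that \<open>\<alpha>\<close> vanishes on the end points of all edges. For \<open>U\<close> of
  index \<open>p\<close> and \<open>Q = G/U\<close>, homomorphisms from \<open>U\<close> to \<open>A\<close> correspond to homomorphisms from \<open>G\<close> to the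
  wreath product of \<open>A\<close> and \<open>Q\<close> over \<open>Q\<close>. Sending a generator \<open>v\<close> to \<open>(\<delta>\<^sub>U \<alpha>(v), U v)\<close> respects the
  relators, since on end points of edges it agrees with \<open>g \<mapsto> (0, U g)\<close>; this gives a character \<open>\<alpha>'\<close>
  of \<open>U\<close> with corestriction \<open>\<alpha>\<close>. For a character \<open>\<beta>\<close> of \<open>U\<close>, a lift of \<open>(\<alpha>', \<beta>)\<close> can be prescribed on
  generators: on end points of edges only the \<open>\<beta>\<close>-coordinate is nonzero, where the Heisenberg group has
  a section, and the other generators are free. So \<open>\<alpha>'\<close> is in the radical of \<open>U\<close>.

  For a \<open>\<Delta>\<close>-right-angled Artin group the radical is zero. Let \<open>\<epsilon>\<close> be the projection to \<open>\<Delta>\<close> and let \<open>r\<close> lift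
  \<open>(\<alpha>, \<epsilon>)\<close> to the Heisenberg group, which is dihedral of order eight. Then \<open>r(x\<^sub>0)\<^sup>2 = 1\<close> forces
  \<open>\<alpha>(x\<^sub>0) = 0\<close>. The image of the Artin subgroup lies in an elementary abelian subgroup, so
  \<open>x\<^sub>0 v x\<^sub>0\<^sup>-\<^sup>1 = z\<^sub>v v\<^sup>-\<^sup>1 z\<^sub>v\<^sup>-\<^sup>1\<close> implies that \<open>r(v)\<close> commutes with \<open>r(x\<^sub>0)\<close>, hence \<open>\<alpha>(v) = 0\<close>.
\<close>

section \<open>Heisenberg groups and wreath products\<close>

text \<open>The obstacle is the p-adic powers in the relators. In the Heisenberg group they die: it
  has exponent p for odd p and 4 for p = 2, which is what the condition on the exponents is matched
  to, and a relator then only asks two images to commute. In a wreath product orders can be larger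
  and the powers may survive, so no relator is computed there. Instead a prescribed map is compared,
  edge by edge, with a homomorphism already known to exist on \<open>G\<close>: homomorphisms of the
  free group that agree at both end points agree on the p-adic powers, hence on the relator. This is
  why \<alpha> has to vanish at end points before anything is lifted.

  No presentation of \<open>U\<close> is at hand. Hence every homomorphism of \<open>U\<close> is
  produced as a homomorphism of \<open>G\<close> into a wreath product, followed by evaluation at
  the coset \<open>U\<close>; corestriction then becomes the sum of all coordinates. The free group
  maps to these wreath products as prescribed because a finite p-group wreathed with a group of
  order p is again a finite p-group.\<close>

definition cont_hom :: "'a top_group \<Rightarrow> ('b, 'n) monoid_scheme \<Rightarrow> ('a \<Rightarrow> 'b) set" where
  "cont_hom K H = {h \<in> hom K H. continuous_map (topo K) (discrete_topology (carrier H)) h}"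

text \<open>\<open>(a, b, c)\<close> stands for the unitriangular 3x3 matrix with \<open>a\<close>
  and \<open>b\<close> next to the diagonal and \<open>c\<close> in the corner.\<close>

definition heis :: "nat \<Rightarrow> (int \<times> int \<times> int) monoid" where
  "heis n = \<lparr>carrier = {0..<int n} \<times> {0..<int n} \<times> {0..<int n},
     monoid.mult = (\<lambda>(a, b, c) (a', b', c').
       ((a + a') mod int n, (b + b') mod int n, (c + c' + a * b') mod int n)),
     one = (0, 0, 0)\<rparr>"

lemma heis_simps [simp]:
  "(a, b, c) \<in> carrier (heis n) \<longleftrightarrow> a \<in> {0..<int n} \<and> b \<in> {0..<int n} \<and> c \<in> {0..<int n}"
  "(a, b, c) \<otimes>\<^bsub>heis n\<^esub> (a', b', c') =
     ((a + a') mod int n, (b + b') mod int n, (c + c' + a * b') mod int n)"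
  "\<one>\<^bsub>heis n\<^esub> = (0, 0, 0)"
  by (simp_all add: heis_def)

lemma heis_assoc:
  fixes a b c n :: int
  shows "((c + c' + a * b') mod n + c'' + ((a + a') mod n) * b'') mod n =
    (c + (c' + c'' + a' * b'') mod n + a * ((b' + b'') mod n)) mod n"
proof -
  have "((c + c' + a * b') mod n + c'' + ((a + a') mod n) * b'') mod n =
      (c + c' + a * b' + c'' + (a + a') * b'') mod n"
    by (intro mod_add_cong mod_mult_cong) simp_all
  also have "\<dots> = (c + (c' + c'' + a' * b'') + a * (b' + b'')) mod n"
    by (simp add: algebra_simps)
  also have "\<dots> = (c + (c' + c'' + a' * b'') mod n + a * ((b' + b'') mod n)) mod n"
    by (intro mod_add_cong mod_mult_cong) simp_all
  finally show ?thesis .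
qed

lemma group_heis:
  assumes "n > 0"
  shows "group (heis n)"
proof (rule groupI)
  fix x y z assume "x \<in> carrier (heis n)" "y \<in> carrier (heis n)" "z \<in> carrier (heis n)"
  then show "x \<otimes>\<^bsub>heis n\<^esub> y \<otimes>\<^bsub>heis n\<^esub> z = x \<otimes>\<^bsub>heis n\<^esub> (y \<otimes>\<^bsub>heis n\<^esub> z)"
    by (cases x; cases y; cases z)
       (simp only: heis_simps heis_assoc, simp add: mod_simps add.assoc)
next
  \<comment> \<open>The inverse of the matrix \<open>(a, b, c)\<close> is
    \<open>(- a, - b, a * b - c)\<close>.\<close>
  have inverse: "((a * b - c) mod int n + c + (- a) mod int n * b) mod int n = 0" for a b c
  proof -
    have "((a * b - c) mod int n + c + (- a) mod int n * b) mod int n = (a * b - c + c + - a * b) mod int n"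
      by (intro mod_add_cong mod_mult_cong) simp_all
    then show ?thesis by simp
  qed
  fix x assume x: "x \<in> carrier (heis n)"
  obtain a b c where abc: "x = (a, b, c)" by (cases x)
  show "\<exists>y\<in>carrier (heis n). y \<otimes>\<^bsub>heis n\<^esub> x = \<one>\<^bsub>heis n\<^esub>"
    using assms abc inverse[of a b c]
    by (intro bexI[of _ "((- a) mod int n, (- b) mod int n, (a * b - c) mod int n)"])
       (simp_all add: mod_simps)
qed (use assms in \<open>auto simp: heis_def\<close>)

lemma order_heis: "order (heis n) = n ^ 3"
  by (simp add: order_def heis_def card_cartesian_product power3_eq_cube)

text \<open>Passing from the k-th power to the next adds \<open>k * a * b\<close> to the corner
  besides \<open>c\<close>, and 0 + 1 + ... + (k - 1) is \<open>k choose 2\<close>.\<close>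

lemma heis_pow:
  assumes "n > 0" "(a, b, c) \<in> carrier (heis n)"
  shows "(a, b, c) [^]\<^bsub>heis n\<^esub> k =
    ((int k * a) mod int n, (int k * b) mod int n,
     (int k * c + int (k choose 2) * (a * b)) mod int n)"
proof -
  interpret group "heis n" using assms(1) by (rule group_heis)
  show ?thesis
  proof (induction k)
    case (Suc k)
    have "((int k * c + int (k choose 2) * (a * b)) mod int n + c + (int k * a) mod int n * b) mod int n
        = (int k * c + int (k choose 2) * (a * b) + c + int k * a * b) mod int n"
      by (intro mod_add_cong mod_mult_cong) simp_all
    also have "int k * c + int (k choose 2) * (a * b) + c + int k * a * b =
        int (Suc k) * c + int (Suc k choose 2) * (a * b)"
      by (simp add: numeral_2_eq_2 algebra_simps)
    finally show ?case
      by (simp add: Suc.IH mod_simps) (simp add: algebra_simps)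
  qed (simp add: numeral_2_eq_2)
qed

text \<open>By \<open>heis_pow\<close> both the exponent \<open>q\<close> and
  \<open>q choose 2\<close> must be divisible by p. For odd p this holds for \<open>q = p\<close>;
  but 2 choose 2 is odd, while 4 choose 2 is 6, hence the exponent 4 for p = 2.\<close>

lemma heis_exponent:
  assumes "prime p" "x \<in> carrier (heis p)"
  shows "x [^]\<^bsub>heis p\<^esub> (p ^ (if p = 2 then 2 else 1)) = \<one>\<^bsub>heis p\<^esub>"
proof -
  obtain a b c where abc: "x = (a, b, c)" by (cases x)
  let ?q = "p ^ (if p = 2 then 2 else 1)"
  have "p dvd (?q choose 2)"
  proof (cases "p = 2")
    case False
    then have "odd p" using assms(1) primes_dvd_imp_eq two_is_prime_nat by blast
    then have "p choose 2 = p * ((p - 1) div 2)"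
      by (simp add: choose_two div_mult_swap)
    then show ?thesis using False by simp
  qed (simp add: choose_two)
  moreover have "p dvd ?q" by simp
  ultimately have "int p dvd int ?q" "int p dvd int (?q choose 2)"
    by (simp_all only: of_nat_dvd_iff)
  then have "(int ?q * y) mod int p = 0" "(int ?q * y + int (?q choose 2) * z) mod int p = 0" for y z
    by auto
  moreover have "p > 0" using assms(1) prime_gt_0_nat by blast
  ultimately show ?thesis
    using heis_pow[of p a b c ?q] assms(2) abc by (simp only: heis_simps)
qed

text \<open>With first entry 0 the term \<open>a * b'\<close> vanishes, so the second coordinate has
  a section. It lifts the pair \<open>(0, \<beta>)\<close> for every character \<beta>.\<close>

lemma heis_coord_homs:
  assumes "n > 0"
  shows "fst \<in> hom (heis n) (integer_mod_group n)"
    and "(\<lambda>x. fst (snd x)) \<in> hom (heis n) (integer_mod_group n)"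
    and "(\<lambda>b. (0, b, 0)) \<in> hom (integer_mod_group n) (heis n)"
  using assms by (auto simp: hom_def heis_def carrier_integer_mod_group)

text \<open>The regular wreath product. \<open>Q\<close> will be the group of right cosets of
  \<open>U\<close>, permuted by right multiplication; hence the shift by \<open>q\<close> in the
  argument of \<open>f'\<close>. Functions are extensional, so that equal values on \<open>Q\<close>
  mean equal elements.\<close>

definition wreath :: "('b, 'm) monoid_scheme \<Rightarrow> ('q, 'n) monoid_scheme \<Rightarrow> (('q \<Rightarrow> 'b) \<times> 'q) monoid" where
  "wreath A Q = \<lparr>carrier = (carrier Q \<rightarrow>\<^sub>E carrier A) \<times> carrier Q,
     monoid.mult = (\<lambda>(f, q) (f', q'). (\<lambda>x\<in>carrier Q. f x \<otimes>\<^bsub>A\<^esub> f' (x \<otimes>\<^bsub>Q\<^esub> q), q \<otimes>\<^bsub>Q\<^esub> q')),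
     one = (\<lambda>x\<in>carrier Q. \<one>\<^bsub>A\<^esub>, \<one>\<^bsub>Q\<^esub>)\<rparr>"

lemma wreath_simps [simp]:
  "(f, q) \<in> carrier (wreath A Q) \<longleftrightarrow> f \<in> carrier Q \<rightarrow>\<^sub>E carrier A \<and> q \<in> carrier Q"
  "(f, q) \<otimes>\<^bsub>wreath A Q\<^esub> (f', q') =
     (\<lambda>x\<in>carrier Q. f x \<otimes>\<^bsub>A\<^esub> f' (x \<otimes>\<^bsub>Q\<^esub> q), q \<otimes>\<^bsub>Q\<^esub> q')"
  "\<one>\<^bsub>wreath A Q\<^esub> = (\<lambda>x\<in>carrier Q. \<one>\<^bsub>A\<^esub>, \<one>\<^bsub>Q\<^esub>)"
  by (simp_all add: wreath_def)

lemma group_wreath: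
  assumes "group A" "group Q"
  shows "group (wreath A Q)"
proof -
  interpret A: group A by fact
  interpret Q: group Q by fact
  show ?thesis
  proof (rule groupI)
    fix x y z assume "x \<in> carrier (wreath A Q)" "y \<in> carrier (wreath A Q)" "z \<in> carrier (wreath A Q)"
    then show "x \<otimes>\<^bsub>wreath A Q\<^esub> y \<otimes>\<^bsub>wreath A Q\<^esub> z = x \<otimes>\<^bsub>wreath A Q\<^esub> (y \<otimes>\<^bsub>wreath A Q\<^esub> z)"
      by (cases x; cases y; cases z)
         (auto simp: Q.m_assoc PiE_iff intro!: restrict_ext A.m_assoc)
  next
    fix x assume x: "x \<in> carrier (wreath A Q)"
    obtain f q where fq: "x = (f, q)" by (cases x)
    have q: "q \<in> carrier Q" and f: "f \<in> carrier Q \<rightarrow>\<^sub>E carrier A" using x fq by auto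
    let ?y = "(\<lambda>t\<in>carrier Q. inv\<^bsub>A\<^esub> (f (t \<otimes>\<^bsub>Q\<^esub> inv\<^bsub>Q\<^esub> q)), inv\<^bsub>Q\<^esub> q)"
    have fc: "f t \<in> carrier A" if "t \<in> carrier Q" for t using f that by auto
    have "?y \<in> carrier (wreath A Q)" using q fc by auto
    moreover have "?y \<otimes>\<^bsub>wreath A Q\<^esub> x = \<one>\<^bsub>wreath A Q\<^esub>"
      using fq q fc by (auto intro!: restrict_ext)
    ultimately show "\<exists>y\<in>carrier (wreath A Q). y \<otimes>\<^bsub>wreath A Q\<^esub> x = \<one>\<^bsub>wreath A Q\<^esub>" by blast
  next
    fix x y assume "x \<in> carrier (wreath A Q)" "y \<in> carrier (wreath A Q)"
    then show "x \<otimes>\<^bsub>wreath A Q\<^esub> y \<in> carrier (wreath A Q)"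
      by (cases x; cases y) auto
  next
    fix x assume x: "x \<in> carrier (wreath A Q)"
    obtain f q where fq: "x = (f, q)" by (cases x)
    have f: "f \<in> carrier Q \<rightarrow>\<^sub>E carrier A" and "q \<in> carrier Q" using x fq by auto
    moreover have "(\<lambda>t\<in>carrier Q. (\<lambda>t\<in>carrier Q. \<one>\<^bsub>A\<^esub>) t \<otimes>\<^bsub>A\<^esub> f (t \<otimes>\<^bsub>Q\<^esub> \<one>\<^bsub>Q\<^esub>)) = f"
    proof
      fix t show "(\<lambda>t\<in>carrier Q. (\<lambda>t\<in>carrier Q. \<one>\<^bsub>A\<^esub>) t \<otimes>\<^bsub>A\<^esub> f (t \<otimes>\<^bsub>Q\<^esub> \<one>\<^bsub>Q\<^esub>)) t = f t"
        using PiE_mem[OF f] PiE_arb[OF f] by (cases "t \<in> carrier Q") simp_all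
    qed
    ultimately show "\<one>\<^bsub>wreath A Q\<^esub> \<otimes>\<^bsub>wreath A Q\<^esub> x = x"
      by (simp add: fq)
  qed auto
qed

lemma finite_wreath:
  assumes "finite (carrier A)" "finite (carrier Q)"
  shows "finite (carrier (wreath A Q))"
  using assms by (simp add: wreath_def finite_PiE)

lemma order_wreath:
  assumes "finite (carrier Q)"
  shows "order (wreath A Q) = order A ^ order Q * order Q"
  using assms by (simp add: order_def wreath_def card_cartesian_product card_PiE)

definition wreath_map :: "('q, 'n) monoid_scheme \<Rightarrow> ('b \<Rightarrow> 'c) \<Rightarrow> ('q \<Rightarrow> 'b) \<times> 'q \<Rightarrow> ('q \<Rightarrow> 'c) \<times> 'q" where
  "wreath_map Q k = (\<lambda>(f, q). (\<lambda>x\<in>carrier Q. k (f x), q))"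

lemma wreath_map_hom:
  assumes "k \<in> hom A B" "group Q"
  shows "wreath_map Q k \<in> hom (wreath A Q) (wreath B Q)"
proof -
  interpret Q: group Q by fact
  have "k (x \<otimes>\<^bsub>A\<^esub> y) = k x \<otimes>\<^bsub>B\<^esub> k y" if "x \<in> carrier A" "y \<in> carrier A" for x y
    using assms(1) that by (auto simp: hom_def)
  moreover have "k x \<in> carrier B" if "x \<in> carrier A" for x
    using assms(1) that by (auto simp: hom_def)
  ultimately show ?thesis
    unfolding hom_def wreath_map_def
    by (auto simp: PiE_iff intro!: restrict_ext)
qed

section \<open>Continuous maps and homomorphisms to discrete targets\<close>

lemma discrete_continuous_map [simp]:
  "continuous_map (discrete_topology A) (discrete_topology B) f \<longleftrightarrow> f \<in> A \<rightarrow> B"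
  by (auto simp: continuous_map_def)

lemma cont_hom_compose:
  assumes "h \<in> cont_hom K H" "k \<in> hom H H'"
  shows "(\<lambda>x. k (h x)) \<in> cont_hom K H'"
proof -
  have "continuous_map (discrete_topology (carrier H)) (discrete_topology (carrier H')) k"
    using assms(2) by (auto simp: hom_def)
  then have "continuous_map (topo K) (discrete_topology (carrier H')) (k \<circ> h)"
    by (rule continuous_map_compose[rotated]) (use assms(1) in \<open>simp add: cont_hom_def\<close>)
  then show ?thesis
    using assms by (auto simp: cont_hom_def hom_def comp_def Pi_iff)
qed

text \<open>Maps to discrete spaces are locally constant, hence so is anything computed from two of
  them. Taking \<open>f = g\<close> covers functions of a single map.\<close>

lemma continuous_map_discrete_pair:
  assumes "continuous_map X (discrete_topology A) f" "continuous_map X (discrete_topology B) g"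
    and "\<And>x. x \<in> topspace X \<Longrightarrow> k (f x) (g x) \<in> C"
  shows "continuous_map X (discrete_topology C) (\<lambda>x. k (f x) (g x))"
proof -
  have "openin X {x \<in> topspace X. k (f x) (g x) \<in> W}" for W
  proof (subst openin_subopen, intro ballI)
    fix x assume x: "x \<in> {x \<in> topspace X. k (f x) (g x) \<in> W}"
    have "openin X {y \<in> topspace X. f y \<in> {f x} \<inter> A}" "openin X {y \<in> topspace X. g y \<in> {g x} \<inter> B}"
      by (rule openin_continuous_map_preimage[OF assms(1)], simp,
          rule openin_continuous_map_preimage[OF assms(2)], simp)
    then have "openin X ({y \<in> topspace X. f y \<in> {f x} \<inter> A} \<inter> {y \<in> topspace X. g y \<in> {g x} \<inter> B})"
      by (rule openin_Int)
    moreover have "f x \<in> A" "g x \<in> B" using assms(1,2) x by (auto simp: continuous_map_def)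
    ultimately show "\<exists>T. openin X T \<and> x \<in> T \<and> T \<subseteq> {x \<in> topspace X. k (f x) (g x) \<in> W}"
      using x by (intro exI conjI) (assumption, auto)
  qed
  then show ?thesis using assms(3) by (auto simp: continuous_map_def)
qed

section \<open>Topological groups and p-adic powers\<close>

lemma (in group) inv_mult_telescope:
  assumes "x \<in> carrier G" "y \<in> carrier G" "z \<in> carrier G"
  shows "(inv x \<otimes> y) \<otimes> (inv y \<otimes> z) = inv x \<otimes> z"
proof -
  have "y \<otimes> (inv y \<otimes> z) = z" using assms by (simp flip: m_assoc)
  then show ?thesis using assms by (simp add: m_assoc)
qed

lemma topological_groupD:
  assumes "topological_group G"
  shows "group G" "topspace (topo G) = carrier G"
  using assms by (auto simp: topological_group_def)

lemma continuous_map_group_mult: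
  assumes "topological_group G" "continuous_map X (topo G) f" "continuous_map X (topo G) g"
  shows "continuous_map X (topo G) (\<lambda>x. f x \<otimes>\<^bsub>G\<^esub> g x)"
proof -
  have "continuous_map (prod_topology (topo G) (topo G)) (topo G) (\<lambda>(x, y). x \<otimes>\<^bsub>G\<^esub> y)"
    using assms(1) by (simp add: topological_group_def)
  from continuous_map_compose[OF continuous_map_pairedI[OF assms(2,3)] this]
  show ?thesis by (simp add: comp_def)
qed

lemma continuous_map_group_inv:
  assumes "topological_group G" "continuous_map X (topo G) f"
  shows "continuous_map X (topo G) (\<lambda>x. inv\<^bsub>G\<^esub> f x)"
proof -
  have "continuous_map (topo G) (topo G) (\<lambda>x. inv\<^bsub>G\<^esub> x)"
    using assms(1) by (simp add: topological_group_def)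
  from continuous_map_compose[OF assms(2) this] show ?thesis by (simp add: comp_def)
qed

lemma openin_translate:
  assumes G: "topological_group G" and "g \<in> carrier G" "openin (topo G) W"
  shows "openin (topo G) {x \<in> carrier G. inv\<^bsub>G\<^esub> g \<otimes>\<^bsub>G\<^esub> x \<in> W}"
proof -
  interpret group G by (rule topological_groupD[OF G])
  have "continuous_map (topo G) (topo G) (\<lambda>x. inv\<^bsub>G\<^esub> g \<otimes>\<^bsub>G\<^esub> x)"
    by (intro continuous_map_group_mult[OF G]) (use assms in \<open>auto simp: topological_groupD\<close>)
  from openin_continuous_map_preimage[OF this assms(3)] show ?thesis
    by (simp add: topological_groupD[OF G])
qed

text \<open>\<open>N\<close> is the union of the translates of \<open>W\<close> by its own
  elements.\<close>

lemma openin_subgroup: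
  assumes G: "topological_group G" and N: "subgroup N G"
    and W: "openin (topo G) W" "\<one>\<^bsub>G\<^esub> \<in> W" "W \<subseteq> N"
  shows "openin (topo G) N"
proof (subst openin_subopen, intro ballI)
  interpret group G by (rule topological_groupD[OF G])
  interpret N: subgroup N G by fact
  fix g assume g: "g \<in> N"
  have "x \<in> N" if x: "x \<in> carrier G" "inv\<^bsub>G\<^esub> g \<otimes>\<^bsub>G\<^esub> x \<in> W" for x
  proof -
    have "g \<otimes>\<^bsub>G\<^esub> (inv\<^bsub>G\<^esub> g \<otimes>\<^bsub>G\<^esub> x) \<in> N" using g x W(3) by blast
    then show ?thesis using x g by (simp flip: m_assoc)
  qed
  then show "\<exists>T. openin (topo G) T \<and> g \<in> T \<and> T \<subseteq> N"
    using openin_translate[OF G _ W(1), of g] g W(2)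
    by (intro exI[of _ "{x \<in> carrier G. inv\<^bsub>G\<^esub> g \<otimes>\<^bsub>G\<^esub> x \<in> W}"]) (auto simp: N.mem_carrier)
qed

text \<open>In a compact Hausdorff space a one-point component has arbitrarily small neighbourhoods
  \<open>K\<close> that are open and closed. The stabiliser of \<open>K\<close> under translation
  from both sides is the required subgroup, and compactness makes it open.\<close>

lemma open_normal_subgroup_in_nbhd:
  assumes prof: "profinite_group G" and W: "openin (topo G) W" "\<one>\<^bsub>G\<^esub> \<in> W"
  obtains N where "N \<lhd> G" "openin (topo G) N" "N \<subseteq> W"
proof -
  have G: "topological_group G" and comp: "compact_space (topo G)" and haus: "Hausdorff_space (topo G)"
    and conn: "connected_component_of_set (topo G) \<one>\<^bsub>G\<^esub> = {\<one>\<^bsub>G\<^esub>}"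
    using prof by (auto simp: profinite_group_def topological_group_def group.is_monoid monoid.one_closed)
  interpret group G by (rule topological_groupD[OF G])
  note [simp] = topological_groupD(2)[OF G]
  have one: "{\<one>\<^bsub>G\<^esub>} \<in> connected_components_of (topo G)"
    using conn by (force simp: connected_components_of_def)
  obtain K V where KV: "openin (topo G) K" "openin (topo G) V" "disjnt K V" "K \<union> V = carrier G"
    "\<one>\<^bsub>G\<^esub> \<in> K" "K \<subseteq> W"
    using wilder_locally_compact_component_thm
      [OF compact_imp_locally_compact_space[OF comp] haus one _ W(1)] W(2) by auto
  \<comment> \<open>The elements \<open>g\<close> whose insertion between \<open>x\<close> and
    \<open>y\<close> never changes membership in \<open>K\<close>. Letting \<open>x\<close> and
    \<open>y\<close> vary makes \<open>N\<close> normal, and \<open>x = y = 1\<close> puts it inside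
    \<open>K\<close>.\<close>
  define N where "N = {g \<in> carrier G. \<forall>x\<in>carrier G. \<forall>y\<in>carrier G. x \<otimes>\<^bsub>G\<^esub> g \<otimes>\<^bsub>G\<^esub> y \<in> K \<longleftrightarrow> x \<otimes>\<^bsub>G\<^esub> y \<in> K}"
  have N: "subgroup N G"
  proof
    fix g h assume g: "g \<in> N" and h: "h \<in> N"
    then have gh: "g \<in> carrier G" "h \<in> carrier G" by (auto simp: N_def)
    have "x \<otimes>\<^bsub>G\<^esub> (g \<otimes>\<^bsub>G\<^esub> h) \<otimes>\<^bsub>G\<^esub> y \<in> K \<longleftrightarrow> x \<otimes>\<^bsub>G\<^esub> y \<in> K" if "x \<in> carrier G" "y \<in> carrier G" for x y
    proof -
      have "x \<otimes>\<^bsub>G\<^esub> (g \<otimes>\<^bsub>G\<^esub> h) \<otimes>\<^bsub>G\<^esub> y = x \<otimes>\<^bsub>G\<^esub> g \<otimes>\<^bsub>G\<^esub> (h \<otimes>\<^bsub>G\<^esub> y)" using gh that by (simp add: m_assoc)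
      also have "\<dots> \<in> K \<longleftrightarrow> x \<otimes>\<^bsub>G\<^esub> h \<otimes>\<^bsub>G\<^esub> y \<in> K" using g gh that by (simp add: N_def m_assoc)
      finally show ?thesis using h that by (simp add: N_def)
    qed
    then show "g \<otimes>\<^bsub>G\<^esub> h \<in> N" using gh by (simp add: N_def)
  next
    fix g assume g: "g \<in> N"
    then have gc: "g \<in> carrier G" by (simp add: N_def)
    have "x \<otimes>\<^bsub>G\<^esub> inv\<^bsub>G\<^esub> g \<otimes>\<^bsub>G\<^esub> y \<in> K \<longleftrightarrow> x \<otimes>\<^bsub>G\<^esub> y \<in> K" if xy: "x \<in> carrier G" "y \<in> carrier G" for x y
    proof -
      have "(x \<otimes>\<^bsub>G\<^esub> inv\<^bsub>G\<^esub> g) \<otimes>\<^bsub>G\<^esub> g \<otimes>\<^bsub>G\<^esub> y \<in> K \<longleftrightarrow> (x \<otimes>\<^bsub>G\<^esub> inv\<^bsub>G\<^esub> g) \<otimes>\<^bsub>G\<^esub> y \<in> K"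
        using g gc xy by (auto simp: N_def)
      then show ?thesis using gc xy by (simp add: m_assoc)
    qed
    then show "inv\<^bsub>G\<^esub> g \<in> N" using gc by (simp add: N_def)
  qed (auto simp: N_def)
  have "N \<lhd> G"
  proof (subst normal_inv_iff, intro conjI ballI N)
    fix t g assume t: "t \<in> carrier G" and g: "g \<in> N"
    have gc: "g \<in> carrier G" using g by (simp add: N_def)
    have "x \<otimes>\<^bsub>G\<^esub> (t \<otimes>\<^bsub>G\<^esub> g \<otimes>\<^bsub>G\<^esub> inv\<^bsub>G\<^esub> t) \<otimes>\<^bsub>G\<^esub> y \<in> K \<longleftrightarrow> x \<otimes>\<^bsub>G\<^esub> y \<in> K"
      if xy: "x \<in> carrier G" "y \<in> carrier G" for x y
    proof -
      have "(x \<otimes>\<^bsub>G\<^esub> t) \<otimes>\<^bsub>G\<^esub> g \<otimes>\<^bsub>G\<^esub> (inv\<^bsub>G\<^esub> t \<otimes>\<^bsub>G\<^esub> y) \<in> K \<longleftrightarrow> (x \<otimes>\<^bsub>G\<^esub> t) \<otimes>\<^bsub>G\<^esub> (inv\<^bsub>G\<^esub> t \<otimes>\<^bsub>G\<^esub> y) \<in> K"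
        using g t xy unfolding N_def by blast
      moreover have "t \<otimes>\<^bsub>G\<^esub> (inv\<^bsub>G\<^esub> t \<otimes>\<^bsub>G\<^esub> y) = y" using t xy by (simp flip: m_assoc)
      ultimately show ?thesis using t gc xy by (simp add: m_assoc)
    qed
    then show "t \<otimes>\<^bsub>G\<^esub> g \<otimes>\<^bsub>G\<^esub> inv\<^bsub>G\<^esub> t \<in> N" using t gc by (simp add: N_def)
  qed
  moreover have "N \<subseteq> W"
  proof
    fix g assume "g \<in> N"
    then have "g \<in> carrier G" "\<one>\<^bsub>G\<^esub> \<otimes>\<^bsub>G\<^esub> g \<otimes>\<^bsub>G\<^esub> \<one>\<^bsub>G\<^esub> \<in> K \<longleftrightarrow> \<one>\<^bsub>G\<^esub> \<otimes>\<^bsub>G\<^esub> \<one>\<^bsub>G\<^esub> \<in> K" unfolding N_def by blast+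
    then show "g \<in> W" using KV by auto
  qed
  moreover have "openin (topo G) N"
  proof -
    let ?P = "prod_topology (topo G) (prod_topology (topo G) (topo G))"
    let ?f = "\<lambda>(g, x, y). x \<otimes>\<^bsub>G\<^esub> g \<otimes>\<^bsub>G\<^esub> y" and ?h = "\<lambda>(g, x, y). x \<otimes>\<^bsub>G\<^esub> y"
    have fst: "continuous_map ?P (topo G) (\<lambda>t. fst t)"
      and snd: "continuous_map ?P (topo G) (\<lambda>t. fst (snd t))" "continuous_map ?P (topo G) (\<lambda>t. snd (snd t))"
      using continuous_map_compose[OF continuous_map_snd continuous_map_fst]
        continuous_map_compose[OF continuous_map_snd continuous_map_snd]
      by (auto simp: continuous_map_fst comp_def)
    have "continuous_map ?P (topo G) ?f" "continuous_map ?P (topo G) ?h"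
      using continuous_map_group_mult[OF G continuous_map_group_mult[OF G snd(1) fst] snd(2)]
        continuous_map_group_mult[OF G snd] by (simp_all add: case_prod_unfold)
    note cont = openin_continuous_map_preimage[OF this(1)] openin_continuous_map_preimage[OF this(2)]
    \<comment> \<open>The triples for which \<open>x g y\<close> and \<open>x y\<close> lie on the
      same side of the partition into \<open>K\<close> and \<open>V\<close>. \<open>T\<close>
      contains the slice over \<open>g = 1\<close>, so the tube lemma gives a neighbourhood
      \<open>A\<close> of 1 that works for all \<open>x\<close> and \<open>y\<close> at
      once.\<close>
    define T where "T = ({t \<in> topspace ?P. ?f t \<in> K} \<inter> {t \<in> topspace ?P. ?h t \<in> K}) \<union>
      ({t \<in> topspace ?P. ?f t \<in> V} \<inter> {t \<in> topspace ?P. ?h t \<in> V})"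
    have "openin ?P T" unfolding T_def by (intro openin_Un openin_Int cont KV)
    moreover have "compactin (prod_topology (topo G) (topo G)) (carrier G \<times> carrier G)"
      using comp compactin_Times[of "topo G" "topo G" "carrier G" "carrier G"] by (simp add: compact_space_def)
    moreover have "{\<one>\<^bsub>G\<^esub>} \<times> (carrier G \<times> carrier G) \<subseteq> T"
      using KV(4) by (auto simp: T_def)
    ultimately obtain A B where AB: "openin (topo G) A" "\<one>\<^bsub>G\<^esub> \<in> A" "carrier G \<times> carrier G \<subseteq> B" "A \<times> B \<subseteq> T"
      using tube_lemma_right[of "topo G" "prod_topology (topo G) (topo G)" T "carrier G \<times> carrier G" "\<one>\<^bsub>G\<^esub>"]
      by auto
    have "A \<subseteq> N"
    proof
      fix g assume g: "g \<in> A"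
      then have "g \<in> carrier G" using AB(1) openin_subset by fastforce
      moreover have "x \<otimes>\<^bsub>G\<^esub> g \<otimes>\<^bsub>G\<^esub> y \<in> K \<longleftrightarrow> x \<otimes>\<^bsub>G\<^esub> y \<in> K" if "x \<in> carrier G" "y \<in> carrier G" for x y
      proof -
        have "(g, x, y) \<in> T" using AB g that by blast
        then show ?thesis using KV(3) unfolding T_def disjnt_def by auto
      qed
      ultimately show "g \<in> N" by (simp add: N_def)
    qed
    then show ?thesis using openin_subgroup[OF G N AB(1,2)] by blast
  qed
  ultimately show ?thesis using that by blast
qed

section \<open>Powers with p-adic exponents\<close>

lemma pro_p_pow_in_open_normal:
  assumes "pro_p_group p G" "N \<lhd> G" "openin (topo G) N" "x \<in> carrier G"
  obtains k where "x [^]\<^bsub>G\<^esub> (p ^ k) \<in> N"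
proof -
  interpret normal N G by fact
  interpret Q: group "G Mod N" by (rule factorgroup_is_group)
  obtain k where "card (rcosets\<^bsub>G\<^esub> N) = p ^ k" using assms unfolding pro_p_group_def by blast
  then have k: "order (G Mod N) = p ^ k" by (simp add: order_def FactGroup_def)
  have "N #>\<^bsub>G\<^esub> x \<in> carrier (G Mod N)" using assms(4) by (auto simp: FactGroup_def RCOSETS_def)
  from Q.pow_order_eq_1[OF this] have "N #>\<^bsub>G\<^esub> x [^]\<^bsub>G\<^esub> (p ^ k) = N"
    by (simp add: k FactGroup_pow[OF assms(4)])
  then have "x [^]\<^bsub>G\<^esub> (p ^ k) \<in> N"
    using rcos_self[OF nat_pow_closed[OF assms(4)]] subgroup_axioms by auto
  then show ?thesis using that by blast
qed

lemma padic_int_mod: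
  assumes "a \<in> padic_int p" "k \<le> n"
  shows "a n mod int p ^ k = a k"
  using assms(2)
proof (induction n rule: dec_induct)
  case base
  then show ?case using assms(1) by (auto simp: padic_int_def)
next
  case (step n)
  have "a (Suc n) mod int p ^ k = (a (Suc n) mod int p ^ n) mod int p ^ k"
    using step(1) by (simp add: mod_mod_cancel le_imp_power_dvd)
  then show ?case using step assms(1) by (auto simp: padic_int_def)
qed

text \<open>Late residues of \<open>a\<close> differ by multiples of \<open>p ^ k\<close>, and the
  \<open>p ^ k\<close>-th power of \<open>x\<close> lies in \<open>N\<close> because the quotient is
  a finite p-group.\<close>

lemma padic_pow_Cauchy:
  assumes "pro_p_group p G" "N \<lhd> G" "openin (topo G) N" "x \<in> carrier G" "a \<in> padic_int p"
  obtains k where "\<And>m n. k \<le> m \<Longrightarrow> k \<le> n \<Longrightarrow> inv\<^bsub>G\<^esub> (x [^]\<^bsub>G\<^esub> a m) \<otimes>\<^bsub>G\<^esub> (x [^]\<^bsub>G\<^esub> a n) \<in> N"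
proof -
  interpret normal N G by fact
  obtain k where k: "x [^]\<^bsub>G\<^esub> (p ^ k) \<in> N" using pro_p_pow_in_open_normal[OF assms(1-4)] .
  have "inv\<^bsub>G\<^esub> (x [^]\<^bsub>G\<^esub> a m) \<otimes>\<^bsub>G\<^esub> (x [^]\<^bsub>G\<^esub> a n) \<in> N" if "k \<le> m" "k \<le> n" for m n
  proof -
    have "a m mod int p ^ k = a n mod int p ^ k" using padic_int_mod[OF assms(5)] that by simp
    then obtain c where c: "- a m + a n = int (p ^ k) * c"
      by (metis add.commute mod_eq_dvd_iff dvdE of_nat_power uminus_add_conv_diff)
    have "inv\<^bsub>G\<^esub> (x [^]\<^bsub>G\<^esub> a m) \<otimes>\<^bsub>G\<^esub> (x [^]\<^bsub>G\<^esub> a n) = x [^]\<^bsub>G\<^esub> (- a m + a n)"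
      using assms(4) by (simp add: int_pow_mult int_pow_neg del: add_uminus_conv_diff uminus_add_conv_diff)
    also have "\<dots> = (x [^]\<^bsub>G\<^esub> (p ^ k)) [^]\<^bsub>G\<^esub> c"
      unfolding c using assms(4) by (simp add: int_pow_pow flip: int_pow_int)
    also have "\<dots> \<in> N" using k subgroup_axioms by (simp add: subgroup_int_pow_closed)
    finally show ?thesis .
  qed
  then show ?thesis using that by blast
qed

text \<open>This justifies the definite description in \<open>padic_pow\<close>: compactness yields
  a cluster point, the Cauchy property turns it into a limit, and the Hausdorff property makes the
  limit unique.\<close>

lemma limitin_padic_pow:
  assumes G: "pro_p_group p G" and x: "x \<in> carrier G" and a: "a \<in> padic_int p"
  shows "limitin (topo G) (\<lambda>n. x [^]\<^bsub>G\<^esub> a n) (padic_pow G x a) sequentially"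
proof -
  have prof: "profinite_group G" using G by (simp add: pro_p_group_def)
  then have tg: "topological_group G" and comp: "compact_space (topo G)" and haus: "Hausdorff_space (topo G)"
    by (auto simp: profinite_group_def)
  interpret group G by (rule topological_groupD[OF tg])
  note [simp] = topological_groupD(2)[OF tg]
  let ?s = "\<lambda>n. x [^]\<^bsub>G\<^esub> a n"
  \<comment> \<open>Closures of the tails; a point common to all of them is a cluster point.\<close>
  define C where "C m = topo G closure_of (?s ` {m..})" for m :: nat
  have "(\<Inter>m. C m) \<noteq> {}"
  proof (rule compact_space_imp_nest[OF comp])
    show "closedin (topo G) (C m)" for m by (simp add: C_def)
    have "?s ` {m..} \<subseteq> C m" for m
      unfolding C_def by (rule closure_of_subset) (use x in auto)
    then show "C m \<noteq> {}" for m by blast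
    show "decseq C" unfolding C_def decseq_def by (auto intro!: closure_of_mono image_mono)
  qed
  then obtain y where y: "\<And>m. y \<in> C m" by blast
  have yc: "y \<in> carrier G" using y[of 0] closure_of_subset_topspace[of "topo G"] by (auto simp: C_def)
  have "limitin (topo G) ?s y sequentially"
    unfolding limitin_def
  proof (intro conjI allI impI)
    fix W assume W: "openin (topo G) W \<and> y \<in> W"
    \<comment> \<open>The translate of \<open>W\<close> by the inverse of \<open>y\<close>, a
      neighbourhood of the identity; the double inverse fits
      \<open>openin_translate\<close>.\<close>
    let ?W = "{g \<in> carrier G. inv\<^bsub>G\<^esub> (inv\<^bsub>G\<^esub> y) \<otimes>\<^bsub>G\<^esub> g \<in> W}"
    have "openin (topo G) ?W" using openin_translate[OF tg _ conjunct1[OF W]] yc by blast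
    moreover have "\<one>\<^bsub>G\<^esub> \<in> ?W" using W yc by simp
    ultimately obtain N where N: "N \<lhd> G" "openin (topo G) N" "N \<subseteq> ?W"
      using open_normal_subgroup_in_nbhd[OF prof] by blast
    interpret N: normal N G by (rule N(1))
    obtain k where k: "\<And>m n. k \<le> m \<Longrightarrow> k \<le> n \<Longrightarrow> inv\<^bsub>G\<^esub> (?s m) \<otimes>\<^bsub>G\<^esub> ?s n \<in> N"
      using padic_pow_Cauchy[OF G N(1,2) x a] by blast
    have "openin (topo G) {g \<in> carrier G. inv\<^bsub>G\<^esub> y \<otimes>\<^bsub>G\<^esub> g \<in> N}"
      by (rule openin_translate[OF tg yc N(2)])
    moreover have "y \<in> {g \<in> carrier G. inv\<^bsub>G\<^esub> y \<otimes>\<^bsub>G\<^esub> g \<in> N}" using yc by simp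
    moreover have "\<forall>T. y \<in> T \<and> openin (topo G) T \<longrightarrow> (\<exists>g. g \<in> ?s ` {k..} \<and> g \<in> T)"
      using y[of k] unfolding C_def in_closure_of by (rule conjunct2)
    ultimately have "\<exists>g. g \<in> ?s ` {k..} \<and> g \<in> {g \<in> carrier G. inv\<^bsub>G\<^esub> y \<otimes>\<^bsub>G\<^esub> g \<in> N}"
      by (elim allE impE) (rule conjI)
    \<comment> \<open>One term beyond \<open>k\<close> is close to the cluster point, and all terms
      beyond \<open>k\<close> are close to that one.\<close>
    then obtain m where m: "m \<ge> k" "inv\<^bsub>G\<^esub> y \<otimes>\<^bsub>G\<^esub> ?s m \<in> N" by auto
    have "?s n \<in> W" if n: "n \<ge> k" for n
    proof -
      have "(inv\<^bsub>G\<^esub> y \<otimes>\<^bsub>G\<^esub> ?s m) \<otimes>\<^bsub>G\<^esub> (inv\<^bsub>G\<^esub> (?s m) \<otimes>\<^bsub>G\<^esub> ?s n) \<in> N"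
        using m k n by blast
      also have "(inv\<^bsub>G\<^esub> y \<otimes>\<^bsub>G\<^esub> ?s m) \<otimes>\<^bsub>G\<^esub> (inv\<^bsub>G\<^esub> (?s m) \<otimes>\<^bsub>G\<^esub> ?s n) = inv\<^bsub>G\<^esub> y \<otimes>\<^bsub>G\<^esub> ?s n"
        using yc x by (intro inv_mult_telescope) auto
      finally have "inv\<^bsub>G\<^esub> (inv\<^bsub>G\<^esub> y) \<otimes>\<^bsub>G\<^esub> (inv\<^bsub>G\<^esub> y \<otimes>\<^bsub>G\<^esub> ?s n) \<in> W" using N(3) by blast
      moreover have "inv\<^bsub>G\<^esub> (inv\<^bsub>G\<^esub> y) \<otimes>\<^bsub>G\<^esub> (inv\<^bsub>G\<^esub> y \<otimes>\<^bsub>G\<^esub> ?s n) = ?s n"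
        using inv_mult_telescope[of "inv\<^bsub>G\<^esub> y" "\<one>\<^bsub>G\<^esub>" "?s n"] yc x
        by (simp del: inv_inv flip: m_assoc)
      ultimately show ?thesis by simp
    qed
    then show "\<forall>\<^sub>F n in sequentially. ?s n \<in> W" unfolding eventually_sequentially by blast
  qed (use yc in simp)
  note lim = this
  show ?thesis
    unfolding padic_pow_def
    by (rule theI, rule lim) (rule limitin_Hausdorff_unique[OF _ lim trivial_limit_sequentially haus])
qed

text \<open>The fibre of \<open>h\<close> through the p-adic power is open, so almost all
  approximating powers lie in it. This describes the value without a topology on
  \<open>H\<close>.\<close>

lemma cont_hom_padic_pow:
  assumes F: "pro_p_group p F" and h: "h \<in> cont_hom F H" and H: "group H"
    and x: "x \<in> carrier F" and a: "a \<in> padic_int p"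
  shows "\<forall>\<^sub>F n in sequentially. h (padic_pow F x a) = h x [^]\<^bsub>H\<^esub> a n"
proof -
  have F': "group F" using F by (simp add: pro_p_group_def profinite_group_def topological_group_def)
  have hom: "h \<in> hom F H" and cont: "continuous_map (topo F) (discrete_topology (carrier H)) h"
    using h by (auto simp: cont_hom_def)
  have lim: "limitin (topo F) (\<lambda>n. x [^]\<^bsub>F\<^esub> a n) (padic_pow F x a) sequentially"
    by (rule limitin_padic_pow[OF F x a])
  let ?W = "{g \<in> topspace (topo F). h g \<in> {h (padic_pow F x a)} \<inter> carrier H}"
  have "openin (topo F) ?W" by (rule openin_continuous_map_preimage[OF cont]) simp
  moreover have "padic_pow F x a \<in> ?W"
    using lim continuous_map_funspace[OF cont] by (auto simp: limitin_def)
  ultimately have "\<forall>\<^sub>F n in sequentially. x [^]\<^bsub>F\<^esub> a n \<in> ?W"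
    using lim unfolding limitin_def by blast
  then show ?thesis
    by (rule eventually_mono) (simp flip: hom_int_pow[OF hom x F' H])
qed

lemma padic_pow_closed:
  assumes F: "pro_p_group p F" and x: "x \<in> carrier F" and a: "a \<in> padic_int p"
  shows "padic_pow F x a \<in> carrier F"
  using limitin_padic_pow[OF assms] F
  by (simp add: limitin_def pro_p_group_def profinite_group_def topological_group_def)

text \<open>Both sides are the eventual value of the same sequence of powers. The argument works for
  images of any order, which is what wreath products require.\<close>

lemma cont_hom_padic_pow_eq:
  assumes "pro_p_group p F" "h \<in> cont_hom F H" "h' \<in> cont_hom F H" "group H"
    and "x \<in> carrier F" "a \<in> padic_int p" "h x = h' x"
  shows "h (padic_pow F x a) = h' (padic_pow F x a)"
proof -
  have "\<forall>\<^sub>F n in sequentially. h (padic_pow F x a) = h' (padic_pow F x a)"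
    using eventually_conj[OF cont_hom_padic_pow[OF assms(1,2,4-6)] cont_hom_padic_pow[OF assms(1,3-6)]]
    by (rule eventually_mono) (simp add: assms(7))
  then show ?thesis by (simp only: eventually_const[OF sequentially_bot])
qed

lemma padic_ideal_subset: "prime p \<Longrightarrow> padic_ideal p k \<subseteq> padic_int p"
proof
  fix a assume p: "prime p" and "a \<in> padic_ideal p k"
  then obtain b where b: "b \<in> padic_int p" "a = (\<lambda>n. (int p ^ k * b n) mod int p ^ n)"
    by (auto simp: padic_ideal_def)
  have "(int p ^ k * b (Suc n) mod int p ^ Suc n) mod int p ^ n = int p ^ k * b n mod int p ^ n" for n
  proof -
    have "(int p ^ k * b (Suc n) mod int p ^ Suc n) mod int p ^ n = int p ^ k * b (Suc n) mod int p ^ n"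
      by (simp add: mod_mod_cancel)
    also have "\<dots> = int p ^ k * (b (Suc n) mod int p ^ n) mod int p ^ n" by (simp add: mod_simps)
    finally show ?thesis using b(1) by (simp add: padic_int_def)
  qed
  then show "a \<in> padic_int p" using b(2) prime_gt_0_nat[OF p] by (simp add: padic_int_def)
qed

lemma cont_hom_padic_pow_eq_one:
  assumes p: "prime p" and F: "pro_p_group p F" and h: "h \<in> cont_hom F H" and H: "group H"
    and x: "x \<in> carrier F" and a: "a \<in> padic_ideal p k" and hx: "h x [^]\<^bsub>H\<^esub> (p ^ k) = \<one>\<^bsub>H\<^esub>"
  shows "h (padic_pow F x a) = \<one>\<^bsub>H\<^esub>"
proof -
  interpret H: group H by fact
  have hc: "h x \<in> carrier H" using h x by (auto simp: cont_hom_def hom_def)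
  obtain b where b: "b \<in> padic_int p" "a = (\<lambda>n. (int p ^ k * b n) mod int p ^ n)"
    using a by (auto simp: padic_ideal_def)
  have "a \<in> padic_int p" using a padic_ideal_subset[OF p] by blast
  from cont_hom_padic_pow[OF F h H x this]
  obtain M where "\<And>n. n \<ge> M \<Longrightarrow> h (padic_pow F x a) = h x [^]\<^bsub>H\<^esub> a n"
    unfolding eventually_sequentially by blast
  \<comment> \<open>The index must be at least \<open>M\<close> for the formula to hold and at least
    \<open>k\<close> for \<open>p ^ k\<close> to divide the residue.\<close>
  then have 1: "h (padic_pow F x a) = h x [^]\<^bsub>H\<^esub> a (max M k)" by simp
  have "int p ^ k dvd a (max M k)" by (simp add: b(2) dvd_mod le_imp_power_dvd)
  then obtain c where "a (max M k) = int (p ^ k) * c" by auto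
  then have "h x [^]\<^bsub>H\<^esub> a (max M k) = (h x [^]\<^bsub>H\<^esub> (p ^ k)) [^]\<^bsub>H\<^esub> c"
    using hc by (simp add: H.int_pow_pow flip: int_pow_int)
  then show ?thesis using 1 hx by simp
qed

section \<open>Induced homomorphisms\<close>

lemma top_subgroup_simps [simp]:
  "carrier (top_subgroup G U) = U"
  "x \<otimes>\<^bsub>top_subgroup G U\<^esub> y = x \<otimes>\<^bsub>G\<^esub> y"
  "\<one>\<^bsub>top_subgroup G U\<^esub> = \<one>\<^bsub>G\<^esub>"
  "topo (top_subgroup G U) = subtopology (topo G) U"
  by (simp_all add: top_subgroup_def)

lemma group_top_subgroup:
  assumes "group G" "subgroup U G"
  shows "group (top_subgroup G U)"
proof -
  interpret group G by fact
  interpret U: subgroup U G by fact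
  show ?thesis by (rule groupI) (auto simp: m_assoc U.mem_carrier intro!: bexI[of _ "inv\<^bsub>G\<^esub> _"])
qed

lemma inv_top_subgroup [simp]:
  assumes "group G" "subgroup U G" "x \<in> U"
  shows "inv\<^bsub>top_subgroup G U\<^esub> x = inv\<^bsub>G\<^esub> x"
proof -
  interpret group G by fact
  interpret U: subgroup U G by fact
  show ?thesis
    by (rule group.inv_equality[OF group_top_subgroup[OF assms(1,2)]]) (use assms(3) U.mem_carrier in auto)
qed

lemma topological_group_top_subgroup:
  assumes "topological_group G" "subgroup U G"
  shows "topological_group (top_subgroup G U)"
proof -
  interpret group G by (rule topological_groupD[OF assms(1)])
  interpret U: subgroup U G by fact
  let ?X = "subtopology (topo G) U"
  have top: "topspace ?X = U" using U.subset by (auto simp: topological_groupD[OF assms(1)])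
  have fst: "continuous_map (prod_topology ?X ?X) (topo G) (\<lambda>z. fst z)"
    and snd: "continuous_map (prod_topology ?X ?X) (topo G) (\<lambda>z. snd z)"
    by (auto intro: continuous_map_fst continuous_map_snd continuous_map_into_fulltopology)
  have "continuous_map (prod_topology ?X ?X) ?X (\<lambda>z. fst z \<otimes>\<^bsub>G\<^esub> snd z)"
    by (rule continuous_map_into_subtopology[OF continuous_map_group_mult[OF assms(1) fst snd]])
       (auto simp: U.subset)
  moreover have "continuous_map ?X ?X (\<lambda>x. inv\<^bsub>top_subgroup G U\<^esub> x)"
  proof (rule continuous_map_eq)
    show "continuous_map ?X ?X (\<lambda>x. inv\<^bsub>G\<^esub> x)"
      by (rule continuous_map_into_subtopology[OF continuous_map_group_inv[OF assms(1)]])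
         (auto intro: continuous_map_from_subtopology)
  qed (simp add: top is_group assms(2))
  ultimately show ?thesis
    using group_top_subgroup[OF is_group assms(2)] top
    by (simp add: topological_group_def case_prod_unfold)
qed

text \<open>A homomorphism trivial on \<open>W\<close> is constant on the translates of
  \<open>W\<close>, and these cover the group, so all its fibres are open.\<close>

lemma cont_homI:
  assumes K: "topological_group K" and H: "group H" and h: "h \<in> hom K H"
    and W: "openin (topo K) W" "\<one>\<^bsub>K\<^esub> \<in> W" "\<And>x. x \<in> W \<Longrightarrow> h x = \<one>\<^bsub>H\<^esub>"
  shows "h \<in> cont_hom K H"
proof -
  interpret K: group K by (rule topological_groupD[OF K])
  interpret H: group H by fact
  interpret h: group_hom K H h by (unfold_locales) (rule h)
  have "openin (topo K) {x \<in> carrier K. h x \<in> A}" for A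
  proof (subst openin_subopen, intro ballI)
    fix g assume g: "g \<in> {x \<in> carrier K. h x \<in> A}"
    let ?T = "{x \<in> carrier K. inv\<^bsub>K\<^esub> g \<otimes>\<^bsub>K\<^esub> x \<in> W}"
    have "h x = h g" if "x \<in> ?T" for x
    proof -
      have "x = g \<otimes>\<^bsub>K\<^esub> (inv\<^bsub>K\<^esub> g \<otimes>\<^bsub>K\<^esub> x)" using g that by (simp flip: K.m_assoc)
      then have "h x = h (g \<otimes>\<^bsub>K\<^esub> (inv\<^bsub>K\<^esub> g \<otimes>\<^bsub>K\<^esub> x))" by (rule arg_cong)
      also have "\<dots> = h g \<otimes>\<^bsub>H\<^esub> h (inv\<^bsub>K\<^esub> g \<otimes>\<^bsub>K\<^esub> x)"
        using g that by (intro h.hom_mult) auto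
      also have "h (inv\<^bsub>K\<^esub> g \<otimes>\<^bsub>K\<^esub> x) = \<one>\<^bsub>H\<^esub>" using W(3) that by blast
      finally show ?thesis using g by simp
    qed
    then have "?T \<subseteq> {x \<in> carrier K. h x \<in> A}" using g by auto
    moreover have "openin (topo K) ?T" using openin_translate[OF K _ W(1), of g] g by blast
    moreover have "g \<in> ?T" using g W(2) by simp
    ultimately show "\<exists>T. openin (topo K) T \<and> g \<in> T \<and> T \<subseteq> {x \<in> carrier K. h x \<in> A}" by blast
  qed
  then show ?thesis
    using h by (auto simp: cont_hom_def continuous_map_def topological_groupD[OF K] hom_def)
qed

lemma quotient_cont_hom:
  assumes "topological_group G" "U \<lhd> G" "openin (topo G) U"
  shows "(\<lambda>g. U #>\<^bsub>G\<^esub> g) \<in> cont_hom G (G Mod U)"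
proof -
  interpret normal U G by fact
  show ?thesis
    by (rule cont_homI[OF assms(1) factorgroup_is_group r_coset_hom_Mod assms(3) subgroup.one_closed[OF subgroup_axioms]])
       (simp add: rcos_const FactGroup_def subgroup_axioms)
qed

text \<open>On \<open>U\<close> the second component is the identity of the quotient, so the shift
  in the wreath multiplication does not move the coset \<open>U\<close> and evaluation there is
  multiplicative.\<close>

lemma wreath_restrict:
  assumes G: "topological_group G" and U: "U \<lhd> G" and r: "r \<in> cont_hom G (wreath A (G Mod U))"
    and snd: "\<And>g. g \<in> carrier G \<Longrightarrow> snd (r g) = U #>\<^bsub>G\<^esub> g"
  shows "(\<lambda>u. fst (r u) U) \<in> cont_hom (top_subgroup G U) A"
proof -
  interpret U: normal U G by fact
  interpret Q: group "G Mod U" by (rule U.factorgroup_is_group)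
  have one: "\<one>\<^bsub>G Mod U\<^esub> = U" by (simp add: FactGroup_def)
  then have UQ: "U \<in> carrier (G Mod U)" using Q.one_closed by simp
  have sndU: "snd (r u) = U" if "u \<in> U" for u
    using snd[OF U.mem_carrier[OF that]] that by (simp add: U.rcos_const U.subgroup_axioms)
  have rc: "fst (r g) \<in> carrier (G Mod U) \<rightarrow>\<^sub>E carrier A" if "g \<in> carrier G" for g
  proof -
    have "r g \<in> carrier (wreath A (G Mod U))" using r that by (auto simp: cont_hom_def hom_def)
    then show ?thesis by (cases "r g") simp
  qed
  have "fst (r (u \<otimes>\<^bsub>G\<^esub> w)) U = fst (r u) U \<otimes>\<^bsub>A\<^esub> fst (r w) U" if uw: "u \<in> U" "w \<in> U" for u w
  proof -
    have "r (u \<otimes>\<^bsub>G\<^esub> w) = r u \<otimes>\<^bsub>wreath A (G Mod U)\<^esub> r w"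
      using r uw by (auto simp: cont_hom_def hom_def U.mem_carrier)
    also have "fst \<dots> U = fst (r u) U \<otimes>\<^bsub>A\<^esub> fst (r w) (U \<otimes>\<^bsub>G Mod U\<^esub> U)"
      using sndU[OF uw(1)] UQ by (cases "r u"; cases "r w") simp
    also have "U \<otimes>\<^bsub>G Mod U\<^esub> U = U" using Q.l_one[OF UQ] one by simp
    finally show ?thesis .
  qed
  moreover have "fst (r u) U \<in> carrier A" if "u \<in> U" for u
    using rc[OF U.mem_carrier[OF that]] UQ by auto
  moreover have "continuous_map (subtopology (topo G) U) (discrete_topology (carrier A)) (\<lambda>u. fst (r u) U)"
  proof (rule continuous_map_discrete_pair[where f = r and g = r])
    show "continuous_map (subtopology (topo G) U) (discrete_topology (carrier (wreath A (G Mod U)))) r"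
      using r by (simp add: cont_hom_def continuous_map_from_subtopology)
    then show "continuous_map (subtopology (topo G) U) (discrete_topology (carrier (wreath A (G Mod U)))) r" .
    show "fst (r u) U \<in> carrier A" if "u \<in> topspace (subtopology (topo G) U)" for u
      using rc[of u] that UQ by (auto simp: topological_groupD[OF G])
  qed
  ultimately show ?thesis by (auto simp: cont_hom_def hom_def)
qed

text \<open>The non-abelian Shapiro lemma in degree one.\<close>

lemma wreath_induce:
  assumes G: "topological_group G" and U: "U \<lhd> G" "openin (topo G) U"
    and fin: "finite (carrier (G Mod U))" and A: "group A"
    and b: "b \<in> cont_hom (top_subgroup G U) A"
  obtains r where "r \<in> cont_hom G (wreath A (G Mod U))"
    "\<And>g. g \<in> carrier G \<Longrightarrow> snd (r g) = U #>\<^bsub>G\<^esub> g"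
    "\<And>u. u \<in> U \<Longrightarrow> fst (r u) U = b u"
proof -
  interpret group G by (rule topological_groupD[OF G])
  interpret U: normal U G by fact
  interpret A: group A by fact
  let ?Q = "G Mod U"
  interpret Q: group ?Q by (rule U.factorgroup_is_group)
  have one: "\<one>\<^bsub>?Q\<^esub> = U" by (simp add: FactGroup_def)
  have UQ: "U \<in> carrier ?Q" using Q.one_closed one by simp
  have coset: "U #>\<^bsub>G\<^esub> g \<in> carrier ?Q" if "g \<in> carrier G" for g
    using that by (auto simp: FactGroup_def RCOSETS_def)
  have coset_mult: "(U #>\<^bsub>G\<^esub> g) \<otimes>\<^bsub>?Q\<^esub> (U #>\<^bsub>G\<^esub> h) = U #>\<^bsub>G\<^esub> (g \<otimes>\<^bsub>G\<^esub> h)" if "g \<in> carrier G" "h \<in> carrier G" for g h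
    using that by (simp add: FactGroup_def U.rcos_sum)
  \<comment> \<open>Coset representatives. Choosing the identity for \<open>U\<close> itself makes
    the coordinate at \<open>U\<close> equal to \<open>b\<close>, and not merely to \<open>b\<close>
    after a conjugation.\<close>
  define t where "t C = (if C = U then \<one>\<^bsub>G\<^esub> else SOME x. x \<in> carrier G \<and> U #>\<^bsub>G\<^esub> x = C)" for C
  have t: "t C \<in> carrier G" "U #>\<^bsub>G\<^esub> t C = C" if "C \<in> carrier ?Q" for C
  proof -
    have "\<exists>x. x \<in> carrier G \<and> U #>\<^bsub>G\<^esub> x = C" using that by (auto simp: FactGroup_def RCOSETS_def)
    from someI_ex[OF this] have "t C \<in> carrier G \<and> U #>\<^bsub>G\<^esub> t C = C"
      by (auto simp: t_def U.subset)
    then show "t C \<in> carrier G" "U #>\<^bsub>G\<^esub> t C = C" by auto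
  qed
  \<comment> \<open>The element of \<open>U\<close> by which \<open>t C\<close> times
    \<open>g\<close> differs from the chosen representative of its coset. Its rule
    \<open>k_mult\<close> is the multiplication of the wreath product.\<close>
  define k where "k C g = t C \<otimes>\<^bsub>G\<^esub> g \<otimes>\<^bsub>G\<^esub> inv\<^bsub>G\<^esub> (t (C \<otimes>\<^bsub>?Q\<^esub> (U #>\<^bsub>G\<^esub> g)))" for C g
  have k: "k C g \<in> U" if C: "C \<in> carrier ?Q" and g: "g \<in> carrier G" for C g
  proof -
    let ?D = "C \<otimes>\<^bsub>?Q\<^esub> (U #>\<^bsub>G\<^esub> g)"
    have D: "?D \<in> carrier ?Q" using C coset[OF g] by blast
    have "U #>\<^bsub>G\<^esub> (t C \<otimes>\<^bsub>G\<^esub> g) = U #>\<^bsub>G\<^esub> t ?D"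
      using coset_mult[OF t(1)[OF C] g] t(2)[OF C] t(2)[OF D] by simp
    then have "t C \<otimes>\<^bsub>G\<^esub> g \<in> U #>\<^bsub>G\<^esub> t ?D"
      using rcos_self[OF _ U.subgroup_axioms, of "t C \<otimes>\<^bsub>G\<^esub> g"] t(1)[OF C] g by simp
    then show ?thesis
      unfolding k_def using U.rcos_module_imp[OF is_group t(1)[OF D]] by simp
  qed
  have k_mult: "k C (g \<otimes>\<^bsub>G\<^esub> h) = k C g \<otimes>\<^bsub>G\<^esub> k (C \<otimes>\<^bsub>?Q\<^esub> (U #>\<^bsub>G\<^esub> g)) h"
    if C: "C \<in> carrier ?Q" and g: "g \<in> carrier G" and h: "h \<in> carrier G" for C g h
  proof -
    let ?D = "C \<otimes>\<^bsub>?Q\<^esub> (U #>\<^bsub>G\<^esub> g)" and ?E = "C \<otimes>\<^bsub>?Q\<^esub> (U #>\<^bsub>G\<^esub> (g \<otimes>\<^bsub>G\<^esub> h))"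
    have D: "?D \<in> carrier ?Q" and E: "?E \<in> carrier ?Q" using C g h coset by blast+
    have "?D \<otimes>\<^bsub>?Q\<^esub> (U #>\<^bsub>G\<^esub> h) = C \<otimes>\<^bsub>?Q\<^esub> ((U #>\<^bsub>G\<^esub> g) \<otimes>\<^bsub>?Q\<^esub> (U #>\<^bsub>G\<^esub> h))"
      by (intro Q.m_assoc C coset g h)
    also have "\<dots> = ?E" by (simp only: coset_mult[OF g h])
    finally have "?D \<otimes>\<^bsub>?Q\<^esub> (U #>\<^bsub>G\<^esub> h) = ?E" .
    moreover have "inv\<^bsub>G\<^esub> t ?D \<otimes>\<^bsub>G\<^esub> (t ?D \<otimes>\<^bsub>G\<^esub> (h \<otimes>\<^bsub>G\<^esub> inv\<^bsub>G\<^esub> t ?E)) = h \<otimes>\<^bsub>G\<^esub> inv\<^bsub>G\<^esub> t ?E"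
      using t(1)[OF D] t(1)[OF E] h by (simp flip: m_assoc)
    ultimately show ?thesis
      unfolding k_def using t(1)[OF C] t(1)[OF D] t(1)[OF E] g h by (simp add: m_assoc)
  qed
  define r where "r g = (\<lambda>C\<in>carrier ?Q. b (k C g), U #>\<^bsub>G\<^esub> g)" for g
  have b_hom: "b (x \<otimes>\<^bsub>G\<^esub> y) = b x \<otimes>\<^bsub>A\<^esub> b y" and b_closed: "b x \<in> carrier A" if "x \<in> U" "y \<in> U" for x y
    using b that by (auto simp: cont_hom_def hom_def)
  have "r \<in> hom G (wreath A ?Q)"
  proof (rule homI)
    fix g h assume g: "g \<in> carrier G" and h: "h \<in> carrier G"
    show "r g \<in> carrier (wreath A ?Q)" using g k b_closed coset by (auto simp: r_def)
    show "r (g \<otimes>\<^bsub>G\<^esub> h) = r g \<otimes>\<^bsub>wreath A ?Q\<^esub> r h"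
      using g h k k_mult b_hom coset coset_mult
      by (auto simp: r_def simp del: mult_FactGroup intro!: restrict_ext)
  qed
  moreover have "r \<in> cont_hom G (wreath A ?Q)"
  proof (rule cont_homI[OF G group_wreath[OF A U.factorgroup_is_group] \<open>r \<in> hom G (wreath A ?Q)\<close>])
    let ?W = "{x \<in> topspace (subtopology (topo G) U). b x \<in> {\<one>\<^bsub>A\<^esub>}}"
    have "openin (subtopology (topo G) U) ?W"
      by (rule openin_continuous_map_preimage[where Y = "discrete_topology (carrier A)"])
         (use b in \<open>auto simp: cont_hom_def\<close>)
    then have W: "openin (topo G) ?W" using U(2) openin_trans_full by blast
    have bone: "b \<one>\<^bsub>G\<^esub> = \<one>\<^bsub>A\<^esub>"
      using b hom_one[of b "top_subgroup G U" A] group_top_subgroup[OF is_group U.subgroup_axioms] A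
      by (simp add: cont_hom_def)
    \<comment> \<open>For \<open>x\<close> in \<open>U\<close> no coset is moved, so
      \<open>k C x\<close> is the conjugate of \<open>x\<close> by \<open>t C\<close>. Finitely many
      open conditions keep all these conjugates where \<open>b\<close> is trivial.\<close>
    let ?V = "U \<inter> (\<Inter>C\<in>carrier ?Q. {x \<in> topspace (topo G). t C \<otimes>\<^bsub>G\<^esub> x \<otimes>\<^bsub>G\<^esub> inv\<^bsub>G\<^esub> t C \<in> ?W})"
    have "openin (topo G) {x \<in> topspace (topo G). t C \<otimes>\<^bsub>G\<^esub> x \<otimes>\<^bsub>G\<^esub> inv\<^bsub>G\<^esub> t C \<in> ?W}" if "C \<in> carrier ?Q" for C
      using t(1)[OF that]
      by (intro openin_continuous_map_preimage[OF _ W] continuous_map_group_mult[OF G])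
         (auto simp: topological_groupD[OF G])
    then show "openin (topo G) ?V"
      using fin UQ by (intro openin_Int U(2) openin_INT2) auto
    show "\<one>\<^bsub>G\<^esub> \<in> ?V"
      using t(1) bone by (auto simp: topological_groupD[OF G])
    fix x assume x: "x \<in> ?V"
    then have xU: "U #>\<^bsub>G\<^esub> x = U" by (auto simp: U.rcos_const U.subgroup_axioms)
    have "k C x = t C \<otimes>\<^bsub>G\<^esub> x \<otimes>\<^bsub>G\<^esub> inv\<^bsub>G\<^esub> t C" if "C \<in> carrier ?Q" for C
      using Q.r_one[OF that] by (simp add: k_def xU one)
    then show "r x = \<one>\<^bsub>wreath A ?Q\<^esub>"
      using x by (auto simp: r_def xU one intro!: restrict_ext)
  qed
  moreover have "fst (r u) U = b u" if "u \<in> U" for u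
  proof -
    have "U #>\<^bsub>G\<^esub> u = U" using that by (simp add: U.rcos_const U.subgroup_axioms)
    then have "k U u = u" using Q.r_one[OF UQ] U.mem_carrier[OF that] by (simp add: k_def one t_def)
    then show ?thesis using UQ by (simp add: r_def)
  qed
  ultimately show ?thesis using that[of r] by (simp add: r_def)
qed

section \<open>Presentations\<close>

lemma normal_closed_normal_closure:
  assumes "group F" "S \<subseteq> carrier F" "topspace (topo F) = carrier F"
  shows "closed_normal_closure F S \<lhd> F"
proof -
  interpret group F by fact
  let ?C = "{N. N \<lhd> F \<and> closedin (topo F) N \<and> S \<subseteq> N}"
  have "carrier F \<in> ?C"
    using assms closedin_topspace[of "topo F"] by (simp add: normal_inv_iff subgroup_self)
  moreover have "subgroup (\<Inter>?C) F"
    by (rule subgroups_Inter) (use \<open>carrier F \<in> ?C\<close> normal_imp_subgroup in auto)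
  ultimately show ?thesis
    unfolding closed_normal_closure_def normal_inv_iff by (auto simp: normal_inv_iff)
qed

lemma closed_normal_closure_superset: "S \<subseteq> closed_normal_closure F S"
  by (auto simp: closed_normal_closure_def)

lemma top_quotient_simps [simp]:
  "carrier (top_quotient F N) = rcosets\<^bsub>F\<^esub> N"
  "monoid.mult (top_quotient F N) = set_mult F"
  "\<one>\<^bsub>top_quotient F N\<^esub> = N"
  by (simp_all add: top_quotient_def FactGroup_def)

lemma group_top_quotient:
  assumes "N \<lhd> F"
  shows "group (top_quotient F N)"
proof -
  interpret Q: group "F Mod N" using assms by (rule normal.factorgroup_is_group)
  show ?thesis
    using Q.group_axioms
    unfolding group_def monoid_def group_axioms_def Units_def by (simp add: FactGroup_def)
qed

text \<open>The preimage of a set of cosets is its union, whose openness is what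
  \<open>openin_top_quotient\<close> tests.\<close>

lemma quotient_map_top_quotient:
  assumes "topological_group F" "N \<lhd> F"
  shows "quotient_map (topo F) (topo (top_quotient F N)) (\<lambda>x. N #>\<^bsub>F\<^esub> x)"
proof -
  interpret F: group F by (rule topological_groupD[OF assms(1)])
  interpret N: normal N F by fact
  note [simp] = topological_groupD(2)[OF assms(1)]
  note op = openin_top_quotient[OF assms(1) N.subgroup_axioms]
  have "\<Union>(rcosets\<^bsub>F\<^esub> N) = carrier F" by (rule F.rcosets_part_G[OF N.subgroup_axioms])
  then have "openin (topo (top_quotient F N)) (rcosets\<^bsub>F\<^esub> N)"
    using openin_topspace[of "topo F"] by (simp add: op FactGroup_def)
  moreover have "W \<subseteq> rcosets\<^bsub>F\<^esub> N" if "openin (topo (top_quotient F N)) W" for W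
    using that by (simp add: op FactGroup_def)
  ultimately have top: "topspace (topo (top_quotient F N)) = rcosets\<^bsub>F\<^esub> N"
    by (metis openin_subset openin_topspace subset_antisym)
  have "{x \<in> carrier F. N #>\<^bsub>F\<^esub> x \<in> W} = \<Union>W" if W: "W \<subseteq> rcosets\<^bsub>F\<^esub> N" for W
  proof (intro equalityI subsetI)
    fix x assume "x \<in> {x \<in> carrier F. N #>\<^bsub>F\<^esub> x \<in> W}"
    then show "x \<in> \<Union>W" using F.rcos_self[OF _ N.subgroup_axioms] by blast
  next
    fix x assume "x \<in> \<Union>W"
    then obtain C where C: "C \<in> W" "x \<in> C" by blast
    then obtain y where y: "y \<in> carrier F" "C = N #>\<^bsub>F\<^esub> y" using W by (auto simp: RCOSETS_def)
    have "N #>\<^bsub>F\<^esub> x = C" using F.repr_independence[OF _ y(1) N.subgroup_axioms] C y by blast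
    moreover have "x \<in> carrier F" using C y N.subset F.r_coset_subset_G by blast
    ultimately show "x \<in> {x \<in> carrier F. N #>\<^bsub>F\<^esub> x \<in> W}" using C by simp
  qed
  then show ?thesis
    unfolding quotient_map_def
    by (auto simp: top op FactGroup_def RCOSETS_def)
qed

lemma hom_top_quotient:
  assumes "N \<lhd> F"
  shows "(\<lambda>x. N #>\<^bsub>F\<^esub> x) \<in> hom F (top_quotient F N)"
proof -
  interpret normal N F by fact
  show ?thesis by (rule homI) (auto simp: rcosetsI subset rcos_sum)
qed

text \<open>The isomorphism of \<open>G\<close> with the group of cosets is absorbed into \<pi>, so
  that later arguments deal with elements of \<open>G\<close> only.\<close>

definition presents :: "'f top_group \<Rightarrow> 'f set \<Rightarrow> ('f \<Rightarrow> 'a) \<Rightarrow> 'a top_group \<Rightarrow> bool" where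
  "presents F S \<pi> G \<longleftrightarrow> \<pi> \<in> hom F G \<and> quotient_map (topo F) (topo G) \<pi> \<and>
     kernel F G \<pi> = closed_normal_closure F S"

lemma presents_presented_group:
  assumes F: "topological_group F" and S: "S \<subseteq> carrier F"
  shows "presents F S (\<lambda>x. closed_normal_closure F S #>\<^bsub>F\<^esub> x) (presented_group F S)"
proof -
  interpret F: group F by (rule topological_groupD[OF F])
  let ?N = "closed_normal_closure F S"
  have N: "?N \<lhd> F" by (rule normal_closed_normal_closure[OF F.is_group S topological_groupD(2)[OF F]])
  interpret N: normal ?N F by fact
  have "kernel F (top_quotient F ?N) (\<lambda>x. ?N #>\<^bsub>F\<^esub> x) = ?N"
    using F.rcos_self[OF _ N.subgroup_axioms]
    by (auto simp: kernel_def N.rcos_const N.mem_carrier N.subgroup_axioms)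
  then show ?thesis
    using N quotient_map_top_quotient[OF F N] hom_top_quotient[OF N]
    by (simp add: presents_def presented_group_def)
qed

lemma presents_iso:
  assumes \<pi>: "presents F S \<pi> P" and G: "group G" and P: "group P"
    and \<theta>: "\<theta> \<in> top_group_iso G P"
    and top: "topspace (topo F) = carrier F" "topspace (topo G) = carrier G"
  shows "presents F S (\<lambda>x. inv_into (carrier G) \<theta> (\<pi> x)) G"
proof -
  let ?\<eta> = "inv_into (carrier G) \<theta>"
  have \<theta>i: "\<theta> \<in> iso G P" and \<theta>h: "homeomorphic_map (topo G) (topo P) \<theta>" using \<theta> by (auto simp: top_group_iso_def)
  then have bij: "bij_betw \<theta> (carrier G) (carrier P)" by (auto simp: iso_def)
  have \<eta>i: "?\<eta> \<in> iso P G" by (rule group.iso_set_sym[OF G \<theta>i])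
  have \<pi>h: "\<pi> \<in> hom F P" using \<pi> by (simp add: presents_def)
  have \<pi>c: "\<pi> x \<in> carrier P" if "x \<in> carrier F" for x using \<pi>h that by (auto simp: hom_def)
  obtain \<phi> where \<phi>: "homeomorphic_maps (topo G) (topo P) \<theta> \<phi>" using \<theta>h homeomorphic_map_maps by blast
  \<comment> \<open>The topological inverse \<phi> agrees with the set-theoretic one on the whole
    space, so the latter is a homeomorphism.\<close>
  have "?\<eta> y = \<phi> y" if "y \<in> topspace (topo P)" for y
  proof -
    have "\<phi> y \<in> carrier G" "\<theta> (\<phi> y) = y"
      using \<phi> that top(2) by (auto simp: homeomorphic_maps_def continuous_map_def)
    then show ?thesis using bij by (metis bij_betw_inv_into_left)
  qed
  then have "homeomorphic_map (topo P) (topo G) ?\<eta>"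
    using \<phi> homeomorphic_map_eq[of "topo P" "topo G" \<phi> ?\<eta>] homeomorphic_maps_sym homeomorphic_maps_map by metis
  then have "quotient_map (topo F) (topo G) (?\<eta> \<circ> \<pi>)"
    using \<pi> quotient_map_compose by (auto simp: presents_def homeomorphic_map_def)
  moreover have "?\<eta> \<circ> \<pi> \<in> hom F G"
    using \<pi>h \<eta>i by (intro hom_compose) (auto simp: iso_def)
  moreover have "?\<eta> (\<pi> x) = \<one>\<^bsub>G\<^esub> \<longleftrightarrow> \<pi> x = \<one>\<^bsub>P\<^esub>" if "x \<in> carrier F" for x
  proof -
    have "inj_on ?\<eta> (carrier P)" "?\<eta> \<one>\<^bsub>P\<^esub> = \<one>\<^bsub>G\<^esub>"
      using \<eta>i hom_one[OF _ P G] by (auto simp: iso_def bij_betw_def)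
    then show ?thesis using \<pi>c[OF that] P by (metis inj_onD group.is_monoid monoid.one_closed)
  qed
  then have "kernel F G (?\<eta> \<circ> \<pi>) = kernel F P \<pi>" by (auto simp: kernel_def)
  ultimately show ?thesis using \<pi> by (simp add: presents_def comp_def)
qed

lemma presents_relator:
  assumes "presents F S \<pi> G" "s \<in> S"
  shows "\<pi> s = \<one>\<^bsub>G\<^esub>"
proof -
  have "s \<in> kernel F G \<pi>" using assms closed_normal_closure_superset[of S F] by (auto simp: presents_def)
  then show ?thesis by (simp add: kernel_def)
qed

lemma presents_surj:
  assumes "presents F S \<pi> G" "topological_group F" "topological_group G"
  shows "\<pi> ` carrier F = carrier G"
  using assms quotient_imp_surjective_map[of "topo F" "topo G" \<pi>]
  by (simp add: presents_def topological_groupD)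

lemma presents_cont_hom_compose:
  assumes "presents F S \<pi> G" "r \<in> cont_hom G H"
  shows "(\<lambda>x. r (\<pi> x)) \<in> cont_hom F H"
proof -
  have "r \<circ> \<pi> \<in> hom F H" using assms by (intro hom_compose) (auto simp: presents_def cont_hom_def)
  moreover have "continuous_map (topo F) (discrete_topology (carrier H)) (r \<circ> \<pi>)"
    using assms by (intro continuous_map_compose) (auto simp: presents_def cont_hom_def quotient_imp_continuous_map)
  ultimately show ?thesis by (simp add: cont_hom_def comp_def)
qed

text \<open>As \<open>H\<close> is discrete, the kernel of \<open>h\<close> is a closed normal
  subgroup. It contains \<open>S\<close>, hence the closed normal closure, which is the kernel of
  \<pi>. Continuity of the factor comes from the quotient topology.\<close>

lemma presents_factor:
  assumes \<pi>: "presents F S \<pi> G" and F: "topological_group F" and G: "topological_group G"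
    and H: "group H" and h: "h \<in> cont_hom F H" and S: "\<And>s. s \<in> S \<Longrightarrow> h s = \<one>\<^bsub>H\<^esub>"
    and SF: "S \<subseteq> carrier F"
  obtains h' where "h' \<in> cont_hom G H" "\<And>x. x \<in> carrier F \<Longrightarrow> h' (\<pi> x) = h x"
proof -
  interpret F: group F by (rule topological_groupD[OF F])
  interpret G: group G by (rule topological_groupD[OF G])
  interpret H: group H by fact
  interpret h: group_hom F H h by unfold_locales (use h in \<open>simp add: cont_hom_def\<close>)
  interpret \<pi>: group_hom F G \<pi> by unfold_locales (use \<pi> in \<open>simp add: presents_def\<close>)
  have cont: "continuous_map (topo F) (discrete_topology (carrier H)) h" using h by (simp add: cont_hom_def)
  have "closedin (topo F) {x \<in> topspace (topo F). h x \<in> {\<one>\<^bsub>H\<^esub>}}"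
    by (rule closedin_continuous_map_preimage[OF cont]) simp
  then have "closedin (topo F) (kernel F H h)"
    by (simp add: kernel_def topological_groupD[OF F])
  moreover have "kernel F H h \<lhd> F" by (rule h.normal_kernel)
  moreover have "S \<subseteq> kernel F H h" using S SF by (auto simp: kernel_def)
  ultimately have ker: "kernel F G \<pi> \<subseteq> kernel F H h"
    using \<pi> by (auto simp: presents_def closed_normal_closure_def)
  have eq: "h x = h y" if "x \<in> carrier F" "y \<in> carrier F" "\<pi> x = \<pi> y" for x y
  proof -
    have "x \<otimes>\<^bsub>F\<^esub> inv\<^bsub>F\<^esub> y \<in> kernel F G \<pi>" using that by (simp add: kernel_def)
    then have "h (x \<otimes>\<^bsub>F\<^esub> inv\<^bsub>F\<^esub> y) = \<one>\<^bsub>H\<^esub>" using ker by (auto simp: kernel_def)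
    then have "h x \<otimes>\<^bsub>H\<^esub> inv\<^bsub>H\<^esub> h y = \<one>\<^bsub>H\<^esub>" using that by simp
    then show ?thesis using that H.inv_equality[of "h x" "inv\<^bsub>H\<^esub> h y"] by simp
  qed
  have surj: "\<pi> ` carrier F = carrier G" by (rule presents_surj[OF \<pi> F G])
  define h' where "h' g = h (inv_into (carrier F) \<pi> g)" for g
  have h': "h' (\<pi> x) = h x" if "x \<in> carrier F" for x
    unfolding h'_def by (rule eq) (use that in \<open>auto simp: inv_into_into f_inv_into_f\<close>)
  have "h' \<in> hom G H"
  proof (rule homI)
    fix g k assume "g \<in> carrier G" "k \<in> carrier G"
    then obtain x y where xy: "x \<in> carrier F" "g = \<pi> x" "y \<in> carrier F" "k = \<pi> y" using surj by blast
    then show "h' g \<in> carrier H" by (simp add: h')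
    have "h' (\<pi> (x \<otimes>\<^bsub>F\<^esub> y)) = h' (\<pi> x) \<otimes>\<^bsub>H\<^esub> h' (\<pi> y)" using xy by (simp only: h' F.m_closed h.hom_mult)
    then show "h' (g \<otimes>\<^bsub>G\<^esub> k) = h' g \<otimes>\<^bsub>H\<^esub> h' k" using xy by simp
  qed
  moreover have "continuous_map (topo G) (discrete_topology (carrier H)) h'"
  proof (rule continuous_compose_quotient_map)
    show "quotient_map (topo F) (topo G) \<pi>" using \<pi> by (simp add: presents_def)
    show "continuous_map (topo F) (discrete_topology (carrier H)) (h' \<circ> \<pi>)"
      by (rule continuous_map_eq[OF cont]) (simp add: topological_groupD[OF F] h')
  qed
  ultimately show ?thesis using that[of h'] h' by (auto simp: cont_hom_def)
qed

text \<open>The set where \<open>h\<close> and \<open>k\<close> agree is closed because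
  \<open>H\<close> is discrete, and it contains the subgroup generated by \<open>T\<close>.\<close>

lemma cont_hom_eq_closure:
  assumes F: "topological_group F" and H: "group H" and h: "h \<in> cont_hom F H" "k \<in> cont_hom F H"
    and T: "T \<subseteq> carrier F" "topo F closure_of generate F T = carrier F" "\<And>t. t \<in> T \<Longrightarrow> h t = k t"
    and x: "x \<in> carrier F"
  shows "h x = k x"
proof -
  interpret F: group F by (rule topological_groupD[OF F])
  interpret H: group H by fact
  interpret h: group_hom F H h using h by unfold_locales (auto simp: cont_hom_def)
  interpret k: group_hom F H k using h by unfold_locales (auto simp: cont_hom_def)
  have "continuous_map (topo F) (discrete_topology UNIV) (\<lambda>x. h x = k x)"
    by (rule continuous_map_discrete_pair[of _ "carrier H" h "carrier H" k "(=)"]) (use h in \<open>auto simp: cont_hom_def\<close>)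
  then have "closedin (topo F) {x \<in> topspace (topo F). (h x = k x) \<in> {True}}"
    by (rule closedin_continuous_map_preimage) simp
  moreover have "h x = k x" if "x \<in> generate F T" for x
    using that
  proof (induction rule: generate.induct)
    case (eng x y)
    then show ?case using F.generate_in_carrier[OF T(1)] by simp
  qed (use T in \<open>auto\<close>)
  then have "generate F T \<subseteq> {x \<in> topspace (topo F). (h x = k x) \<in> {True}}"
    using F.generate_in_carrier[OF T(1)] by (auto simp: topological_groupD[OF F])
  ultimately have "topo F closure_of generate F T \<subseteq> {x \<in> topspace (topo F). (h x = k x) \<in> {True}}"
    by (rule closure_of_minimal[rotated])
  then show ?thesis using x T(2) by blast
qed

text \<open>The universal property is stated for groups of natural numbers, so a finite
  \<open>H\<close> of another type is first copied there along an injection.\<close>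

lemma free_pro_p_group_hom:
  assumes F: "free_pro_p_group p V \<iota> F" and H: "group H" "finite (carrier H)" "order H = p ^ k"
    and \<phi>: "\<phi> \<in> V \<rightarrow> carrier H"
  obtains h where "h \<in> cont_hom F H" "\<And>v. v \<in> V \<Longrightarrow> h (\<iota> v) = \<phi> v"
proof -
  interpret H: group H by fact
  obtain e :: "'c \<Rightarrow> nat" where e: "inj_on e (carrier H)"
    using H(2) by (meson finite_imp_inj_to_nat_seg)
  let ?N = "image_group e H"
  have N: "group ?N" using e by (rule H.inj_imp_image_group_is_group)
  have iso: "e \<in> iso H ?N" using e by (rule inj_imp_image_group_iso)
  then have bij: "bij_betw e (carrier H) (carrier ?N)" by (auto simp: iso_def)
  have inv: "inv_into (carrier H) e \<in> iso ?N H" using iso by (rule H.iso_set_sym)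
  have "finite (carrier ?N)" "order ?N = p ^ k" "(\<lambda>v. e (\<phi> v)) \<in> V \<rightarrow> carrier ?N"
    using H(2,3) \<phi> bij bij_betw_same_card[OF bij] by (auto simp: image_group_carrier order_def)
  then obtain h where h: "h \<in> hom F ?N" "continuous_map (topo F) (discrete_topology (carrier ?N)) h"
    "\<And>v. v \<in> V \<Longrightarrow> h (\<iota> v) = e (\<phi> v)"
    using F N unfolding free_pro_p_group_def by metis
  have "(\<lambda>x. inv_into (carrier H) e (h x)) \<in> cont_hom F H"
    by (rule cont_hom_compose) (use h inv in \<open>auto simp: cont_hom_def iso_def\<close>)
  moreover have "inv_into (carrier H) e (h (\<iota> v)) = \<phi> v" if "v \<in> V" for v
    using \<phi> that e by (simp add: h(3) Pi_iff)
  ultimately show ?thesis using that by blast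
qed

section \<open>Cohomology in degree one\<close>

lemma prime_field_simps [simp]:
  "carrier (prime_field p) = {0..<int p}"
  "x \<oplus>\<^bsub>prime_field p\<^esub> y = (x + y) mod int p"
  "x \<otimes>\<^bsub>prime_field p\<^esub> y = (x * y) mod int p"
  "\<zero>\<^bsub>prime_field p\<^esub> = 0"
  by (auto simp: residue_ring_def)

lemma residues_prime_field: "prime p \<Longrightarrow> residues (int p)"
  using prime_gt_1_nat by unfold_locales auto

lemma prime_field_minus:
  assumes "prime p" "x \<in> {0..<int p}"
  shows "\<ominus>\<^bsub>prime_field p\<^esub> x = (- x) mod int p"
proof -
  interpret residues "int p" "prime_field p" using assms(1) by (simp_all add: residues_prime_field)
  show ?thesis by (rule res_neg_eq)
qed

lemma finsum_prime_field:
  assumes "prime p" "finite A" "\<And>i. i \<in> A \<Longrightarrow> f i \<in> {0..<int p}"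
  shows "finsum (prime_field p) f A = (\<Sum>i\<in>A. f i) mod int p"
proof -
  interpret residues "int p" "prime_field p" using assms(1) by (simp_all add: residues_prime_field)
  show ?thesis
    using assms(2,3)
  proof (induction A rule: finite_induct)
    case (insert i A)
    then have "finsum (prime_field p) f (insert i A) = f i \<oplus>\<^bsub>prime_field p\<^esub> finsum (prime_field p) f A"
      by (intro finsum_insert) auto
    then show ?case using insert by (simp add: mod_simps)
  qed simp
qed

text \<open>\<open>edge\<close> and \<open>triangle\<close> build the arguments of homogeneous
  cochains of degree 1 and 2; all tuples have this form by \<open>tuples_1\<close> and
  \<open>tuples_2\<close>.\<close>

definition edge :: "'a \<Rightarrow> 'a \<Rightarrow> nat \<Rightarrow> 'a" where
  "edge g h = (\<lambda>i\<in>{..1}. if i = 0 then g else h)"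

definition triangle :: "'a \<Rightarrow> 'a \<Rightarrow> 'a \<Rightarrow> nat \<Rightarrow> 'a" where
  "triangle g h k = (\<lambda>i\<in>{..2}. if i = 0 then g else if i = 1 then h else k)"

lemma edge_nth [simp]: "edge g h 0 = g" "edge g h 1 = h" "edge g h (Suc 0) = h"
  by (simp_all add: edge_def)

lemma triangle_nth [simp]: "triangle g h k 0 = g" "triangle g h k (Suc 0) = h" "triangle g h k 2 = k"
  by (simp_all add: triangle_def)

lemma edge_eq_iff [simp]: "edge g h = edge g' h' \<longleftrightarrow> g = g' \<and> h = h'"
  by (metis edge_nth)

lemma le_1_cases: "(i::nat) \<le> 1 \<longleftrightarrow> i = 0 \<or> i = 1"
  by auto

lemma le_Suc_0_cases: "(i::nat) \<le> Suc 0 \<longleftrightarrow> i = 0 \<or> i = Suc 0"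
  by auto

lemma tuples_1: "tuples K 1 = {edge g h | g h. g \<in> carrier K \<and> h \<in> carrier K}"
proof (intro equalityI subsetI)
  fix t assume t: "t \<in> tuples K 1"
  have "t = edge (t 0) (t 1)"
    using PiE_arb[OF t[unfolded tuples_def]] by (auto simp: edge_def fun_eq_iff le_Suc_0_cases)
  moreover have "t 0 \<in> carrier K" "t 1 \<in> carrier K" using t by (auto simp: tuples_def PiE_iff)
  ultimately show "t \<in> {edge g h | g h. g \<in> carrier K \<and> h \<in> carrier K}" by blast
qed (auto simp: tuples_def edge_def PiE_iff extensional_def)

lemma edge_in_tuples [simp]: "edge g h \<in> tuples K 1 \<longleftrightarrow> g \<in> carrier K \<and> h \<in> carrier K"
  using tuples_1[of K] by auto

lemma tuples_2: "tuples K 2 = {triangle g h k | g h k. g \<in> carrier K \<and> h \<in> carrier K \<and> k \<in> carrier K}"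
proof (intro equalityI subsetI)
  fix t assume t: "t \<in> tuples K 2"
  have "i \<le> 2 \<longleftrightarrow> i = 0 \<or> i = 1 \<or> i = 2" for i :: nat by auto
  then have "t = triangle (t 0) (t 1) (t 2)"
    using PiE_arb[OF t[unfolded tuples_def]] by (auto simp: triangle_def fun_eq_iff)
  moreover have "t 0 \<in> carrier K" "t 1 \<in> carrier K" "t 2 \<in> carrier K" using t by (auto simp: tuples_def PiE_iff)
  ultimately show "t \<in> {triangle g h k | g h k. g \<in> carrier K \<and> h \<in> carrier K \<and> k \<in> carrier K}" by blast
qed (auto simp: tuples_def triangle_def PiE_iff extensional_def)

lemma faces_of_triangle:
  "(\<lambda>j\<in>{..1}. if j < 0 then triangle g h k j else triangle g h k (Suc j)) = edge h k"
  "(\<lambda>j\<in>{..1}. if j < 1 then triangle g h k j else triangle g h k (Suc j)) = edge g k"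
  "(\<lambda>j\<in>{..1}. if j < 2 then triangle g h k j else triangle g h k (Suc j)) = edge g h"
  by (auto simp: edge_def fun_eq_iff le_Suc_0_cases numeral_2_eq_2 triangle_def)

text \<open>Keeps the degree \<open>1\<close> from turning into \<open>Suc 0\<close>, so that facts
  about degree one still match after simplification.\<close>

declare One_nat_def [simp del]

lemma differential_1:
  assumes p: "prime p" and x: "x \<in> tuples K 1 \<rightarrow> {0..<int p}"
    and g: "g \<in> carrier K" "h \<in> carrier K" "k \<in> carrier K"
  shows "differential K (prime_field p) 1 x (triangle g h k) =
    (x (edge h k) - x (edge g k) + x (edge g h)) mod int p"
proof -
  have c: "x (edge a b) \<in> {0..<int p}" if "a \<in> carrier K" "b \<in> carrier K" for a b
    using x that by auto
  let ?f = "\<lambda>i. let y = x (\<lambda>j\<in>{..1}. if j < i then triangle g h k j else triangle g h k (Suc j))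
         in if even i then y else \<ominus>\<^bsub>prime_field p\<^esub> y"
  have f: "?f 0 = x (edge h k)" "?f 1 = (- x (edge g k)) mod int p" "?f 2 = x (edge g h)"
    unfolding faces_of_triangle Let_def using c g by (simp_all add: prime_field_minus[OF p])
  have I: "{..Suc 1} = {0, 1, 2::nat}" by auto
  have p0: "int p > 0" using p prime_gt_0_nat by simp
  have "triangle g h k \<in> tuples K (Suc 1)" using tuples_2[of K] g by auto
  then have "differential K (prime_field p) 1 x (triangle g h k) = finsum (prime_field p) ?f {0, 1, 2}"
    unfolding differential_def I by (simp only: restrict_apply' if_True)
  also have "\<dots> = (\<Sum>i\<in>{0, 1, 2}. ?f i) mod int p"
    by (rule finsum_prime_field[OF p]) (use c g p0 in \<open>auto simp only: f insert_iff empty_iff pos_mod_bound pos_mod_sign atLeastLessThan_iff\<close>)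
  also have "(\<Sum>i\<in>{0, 1, 2}. ?f i) = ?f 0 + (?f 1 + ?f 2)" by (simp del: even_Suc)
  also have "\<dots> mod int p = (x (edge h k) + ((- x (edge g k)) mod int p + x (edge g h))) mod int p"
    unfolding f ..
  also have "\<dots> = (x (edge h k) - x (edge g k) + x (edge g h)) mod int p"
  proof -
    have "(x (edge h k) + ((- x (edge g k)) mod int p + x (edge g h))) mod int p =
        (x (edge h k) + (- x (edge g k) + x (edge g h))) mod int p"
      by (intro mod_add_cong) simp_all
    then show ?thesis by (simp add: algebra_simps)
  qed
  finally show ?thesis .
qed

lemma continuous_map_edge:
  assumes "topological_group K"
  shows "continuous_map (topo K) (product_topology (\<lambda>_. topo K) {..1}) (\<lambda>g. edge \<one>\<^bsub>K\<^esub> g)"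
proof -
  interpret group K by (rule topological_groupD[OF assms])
  show ?thesis
    using topological_groupD(2)[OF assms]
    by (auto simp: continuous_map_componentwise edge_def le_1_cases)
qed

lemma translate_edge: "(\<lambda>i\<in>{..1}. s \<otimes>\<^bsub>K\<^esub> edge g h i) = edge (s \<otimes>\<^bsub>K\<^esub> g) (s \<otimes>\<^bsub>K\<^esub> h)"
  by (auto simp: edge_def fun_eq_iff le_1_cases)

lemma inv_cochains_1_iff:
  "x \<in> inv_cochains K S (prime_field p) 1 \<longleftrightarrow> x \<in> tuples K 1 \<rightarrow>\<^sub>E {0..<int p} \<and>
    continuous_map (product_topology (\<lambda>_. topo K) {..1}) (discrete_topology {0..<int p}) x \<and>
    (\<forall>s\<in>S. \<forall>g\<in>carrier K. \<forall>h\<in>carrier K. x (edge (s \<otimes>\<^bsub>K\<^esub> g) (s \<otimes>\<^bsub>K\<^esub> h)) = x (edge g h))"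
proof -
  have "(\<forall>t\<in>tuples K 1. x (\<lambda>i\<in>{..1}. s \<otimes>\<^bsub>K\<^esub> t i) = x t) \<longleftrightarrow>
      (\<forall>g\<in>carrier K. \<forall>h\<in>carrier K. x (edge (s \<otimes>\<^bsub>K\<^esub> g) (s \<otimes>\<^bsub>K\<^esub> h)) = x (edge g h))" for s
  proof (intro iffI ballI)
    fix g h assume A: "\<forall>t\<in>tuples K 1. x (\<lambda>i\<in>{..1}. s \<otimes>\<^bsub>K\<^esub> t i) = x t" and "g \<in> carrier K" "h \<in> carrier K"
    then show "x (edge (s \<otimes>\<^bsub>K\<^esub> g) (s \<otimes>\<^bsub>K\<^esub> h)) = x (edge g h)"
      using A[THEN bspec, of "edge g h"] by (simp add: translate_edge)
  qed (auto simp: tuples_1 translate_edge)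
  then show ?thesis by (simp add: inv_cochains_def)
qed

lemma inv_cochains_1_mem:
  assumes "x \<in> inv_cochains K S (prime_field p) 1" "g \<in> carrier K" "h \<in> carrier K"
  shows "x (edge g h) \<in> {0..<int p}"
  using assms unfolding inv_cochains_1_iff by auto

lemma inv_cocycles_1_iff:
  assumes "prime p"
  shows "x \<in> inv_cocycles K S (prime_field p) 1 \<longleftrightarrow> x \<in> inv_cochains K S (prime_field p) 1 \<and>
    (\<forall>g\<in>carrier K. \<forall>h\<in>carrier K. \<forall>k\<in>carrier K. x (edge g k) = (x (edge g h) + x (edge h k)) mod int p)"
proof (cases "x \<in> inv_cochains K S (prime_field p) 1")
  case True
  then have x: "x \<in> tuples K 1 \<rightarrow> {0..<int p}" by (auto simp: inv_cochains_1_iff)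
  have "differential K (prime_field p) 1 x = zero_cochain K (prime_field p) 2 \<longleftrightarrow>
    (\<forall>t\<in>tuples K 2. differential K (prime_field p) 1 x t = 0)"
    by (auto simp: fun_eq_iff differential_def zero_cochain_def restrict_def split: if_splits)
  also have "\<dots> \<longleftrightarrow> (\<forall>g\<in>carrier K. \<forall>h\<in>carrier K. \<forall>k\<in>carrier K.
      (x (edge h k) - x (edge g k) + x (edge g h)) mod int p = 0)"
    unfolding tuples_2 using differential_1[OF assms x] by (auto 0 4)
  also have "\<dots> \<longleftrightarrow> (\<forall>g\<in>carrier K. \<forall>h\<in>carrier K. \<forall>k\<in>carrier K.
      x (edge g k) = (x (edge g h) + x (edge h k)) mod int p)"
  proof (intro ball_cong refl)
    fix g h k assume "g \<in> carrier K" "h \<in> carrier K" "k \<in> carrier K"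
    then have "x (edge g k) mod int p = x (edge g k)" using inv_cochains_1_mem[OF True] by simp
    moreover have "(x (edge h k) - x (edge g k) + x (edge g h)) mod int p = 0 \<longleftrightarrow>
        (x (edge g h) + x (edge h k)) mod int p = x (edge g k) mod int p"
      by (simp add: mod_eq_dvd_iff mod_eq_0_iff_dvd algebra_simps)
    ultimately show "(x (edge h k) - x (edge g k) + x (edge g h)) mod int p = 0 \<longleftrightarrow>
        x (edge g k) = (x (edge g h) + x (edge h k)) mod int p" by auto
  qed
  finally show ?thesis using True by (simp add: inv_cocycles_def)
qed (simp add: inv_cocycles_def)

lemma inv_cocycles_1_add:
  assumes "prime p" "x \<in> inv_cocycles K S (prime_field p) 1" "g \<in> carrier K" "h \<in> carrier K" "k \<in> carrier K"
  shows "x (edge g k) = (x (edge g h) + x (edge h k)) mod int p"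
  using assms(2-) unfolding inv_cocycles_1_iff[OF assms(1)] by blast

text \<open>An invariant cochain of degree 0 is constant because \<open>K\<close> acts transitively
  on itself, and the two terms of its differential cancel. Hence classes of degree one are
  singletons, and operations on them can be computed on the one representative.\<close>

lemma coboundaries_1:
  assumes p: "prime p" and K: "topological_group K"
  shows "coboundaries K (prime_field p) 1 = {zero_cochain K (prime_field p) 1}"
proof -
  interpret group K by (rule topological_groupD[OF K])
  let ?C = "inv_cochains K (carrier K) (prime_field p) 0"
  let ?c = "\<lambda>g. \<lambda>i\<in>{..0::nat}. g"
  have p0: "int p > 0" using p prime_gt_0_nat by simp
  have "differential K (prime_field p) 0 x = zero_cochain K (prime_field p) 1" if x: "x \<in> ?C" for x
  proof
    fix t
    show "differential K (prime_field p) 0 x t = zero_cochain K (prime_field p) 1 t"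
    proof (cases "t \<in> tuples K 1")
      case True
      then obtain g h where gh: "g \<in> carrier K" "h \<in> carrier K" "t = edge g h" by (auto simp: tuples_1)
      have c: "?c a \<in> tuples K 0" if "a \<in> carrier K" for a using that by (auto simp: tuples_def)
      have const: "x (?c a) = x (?c \<one>\<^bsub>K\<^esub>)" if a: "a \<in> carrier K" for a
      proof -
        have "x (\<lambda>i\<in>{..0}. a \<otimes>\<^bsub>K\<^esub> ?c \<one>\<^bsub>K\<^esub> i) = x (?c \<one>\<^bsub>K\<^esub>)"
          using x a c[of "\<one>\<^bsub>K\<^esub>"] unfolding inv_cochains_def by blast
        moreover have "(\<lambda>i\<in>{..0}. a \<otimes>\<^bsub>K\<^esub> ?c \<one>\<^bsub>K\<^esub> i) = ?c a" using a by (auto simp: fun_eq_iff)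
        ultimately show ?thesis by simp
      qed
      have xc: "x (?c \<one>\<^bsub>K\<^esub>) \<in> {0..<int p}" using x c[of "\<one>\<^bsub>K\<^esub>"] by (auto simp: inv_cochains_def)
      let ?f = "\<lambda>i. let y = x (\<lambda>j\<in>{..0}. if j < i then t j else t (Suc j))
         in if even i then y else \<ominus>\<^bsub>prime_field p\<^esub> y"
      have "(\<lambda>j\<in>{..0}. if j < 0 then t j else t (Suc j)) = ?c h"
        "(\<lambda>j\<in>{..0}. if j < 1 then t j else t (Suc j)) = ?c g"
        using gh by (auto simp: fun_eq_iff)
      then have f: "?f 0 = x (?c \<one>\<^bsub>K\<^esub>)" "?f 1 = (- x (?c \<one>\<^bsub>K\<^esub>)) mod int p"
        using const[OF gh(1)] const[OF gh(2)] xc by (simp_all add: prime_field_minus[OF p])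
      have I: "{..Suc 0} = {0, 1::nat}" by (auto simp: One_nat_def)
      have "differential K (prime_field p) 0 x t = finsum (prime_field p) ?f {0, 1}"
        using True unfolding differential_def I by (simp only: restrict_apply' if_True flip: One_nat_def)
      also have "\<dots> = (\<Sum>i\<in>{0, 1}. ?f i) mod int p"
        by (rule finsum_prime_field[OF p]) (use xc p0 in \<open>auto simp only: f insert_iff empty_iff pos_mod_bound pos_mod_sign atLeastLessThan_iff\<close>)
      also have "(\<Sum>i\<in>{0, 1}. ?f i) = ?f 0 + ?f 1" by (simp del: even_Suc)
      also have "\<dots> mod int p = 0" unfolding f by (simp add: mod_simps)
      finally show ?thesis using True by (simp add: zero_cochain_def)
    qed (simp add: differential_def zero_cochain_def flip: One_nat_def)
  qed
  moreover have "zero_cochain K (prime_field p) 0 \<in> ?C"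
  proof -
    have "continuous_map (product_topology (\<lambda>_. topo K) {..0}) (discrete_topology {0..<int p}) (zero_cochain K (prime_field p) 0)"
      by (rule continuous_map_eq[of _ _ "\<lambda>_. 0"])
         (use p0 in \<open>auto simp: zero_cochain_def tuples_def topological_groupD[OF K]\<close>)
    moreover have "(\<lambda>i\<in>{..0}. s \<otimes>\<^bsub>K\<^esub> t i) \<in> tuples K 0" if "s \<in> carrier K" "t \<in> tuples K 0" for s t
      using that by (auto simp: tuples_def)
    ultimately show ?thesis
      using p0 by (auto simp: inv_cochains_def zero_cochain_def)
  qed
  ultimately show ?thesis unfolding coboundaries_def by (auto simp: One_nat_def)
qed

lemma cohomology_class_1:
  assumes "prime p" "topological_group K" "x \<in> inv_cocycles K S (prime_field p) 1"
  shows "cohomology_class K (prime_field p) 1 x = {x}"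
proof -
  have x: "x \<in> tuples K 1 \<rightarrow>\<^sub>E {0..<int p}" using assms(1,3) by (simp add: inv_cocycles_1_iff inv_cochains_1_iff)
  have "(\<lambda>t\<in>tuples K 1. (0 + x t) mod int p) = x"
  proof
    fix t show "(\<lambda>t\<in>tuples K 1. (0 + x t) mod int p) t = x t"
      using PiE_mem[OF x] PiE_arb[OF x] by (cases "t \<in> tuples K 1") auto
  qed
  moreover have "(\<lambda>t\<in>tuples K 1. (zero_cochain K (prime_field p) 1 t + x t) mod int p) =
      (\<lambda>t\<in>tuples K 1. (0 + x t) mod int p)"
    by (rule restrict_ext) (simp add: zero_cochain_def)
  ultimately show ?thesis
    unfolding cohomology_class_def coboundaries_1[OF assms(1,2)]
    by (simp add: r_coset_def cocycle_group_def)
qed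

lemma carrier_cohomology_1:
  assumes "prime p" "topological_group K"
  shows "carrier (cohomology K (prime_field p) 1) = (\<lambda>x. {x}) ` inv_cocycles K (carrier K) (prime_field p) 1"
  using cohomology_class_1[OF assms, of _ "carrier K"]
  by (auto simp: cohomology_def carrier_FactGroup cohomology_class_def cocycle_group_def)

text \<open>The homogeneous cocycle of an inhomogeneous one. Conversely, \<alpha> is recovered from
  the values on edges that start at the identity.\<close>

definition cocycle_of :: "'a top_group \<Rightarrow> ('a \<Rightarrow> int) \<Rightarrow> (nat \<Rightarrow> 'a) \<Rightarrow> int" where
  "cocycle_of K \<alpha> = (\<lambda>t\<in>tuples K 1. \<alpha> (inv\<^bsub>K\<^esub> t 0 \<otimes>\<^bsub>K\<^esub> t 1))"

lemma cocycle_of_edge [simp]: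
  "g \<in> carrier K \<Longrightarrow> h \<in> carrier K \<Longrightarrow> cocycle_of K \<alpha> (edge g h) = \<alpha> (inv\<^bsub>K\<^esub> g \<otimes>\<^bsub>K\<^esub> h)"
  by (simp add: cocycle_of_def)

lemma continuous_map_quotient_edge:
  assumes "topological_group K"
  shows "continuous_map (product_topology (\<lambda>_. topo K) {..1::nat}) (topo K) (\<lambda>t. inv\<^bsub>K\<^esub> t 0 \<otimes>\<^bsub>K\<^esub> t 1)"
  by (intro continuous_map_group_mult[OF assms] continuous_map_group_inv[OF assms] continuous_map_product_projection) auto

lemma inv_cochain_of_function:
  assumes K: "topological_group K" and a: "continuous_map (topo K) (discrete_topology {0..<int p}) \<alpha>"
  shows "cocycle_of K \<alpha> \<in> inv_cochains K (carrier K) (prime_field p) 1"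
proof -
  interpret group K by (rule topological_groupD[OF K])
  have ac: "\<alpha> g \<in> {0..<int p}" if "g \<in> carrier K" for g
    using funcset_mem[OF continuous_map_funspace[OF a]] that by (simp add: topological_groupD[OF K])
  have "cocycle_of K \<alpha> \<in> tuples K 1 \<rightarrow>\<^sub>E {0..<int p}"
    using ac by (auto simp: cocycle_of_def tuples_def PiE_iff)
  moreover have "continuous_map (product_topology (\<lambda>_. topo K) {..1}) (discrete_topology {0..<int p}) (cocycle_of K \<alpha>)"
    by (rule continuous_map_eq[OF continuous_map_compose[OF continuous_map_quotient_edge[OF K] a]])
       (simp add: cocycle_of_def tuples_def topological_groupD[OF K])
  moreover have "inv\<^bsub>K\<^esub> (s \<otimes>\<^bsub>K\<^esub> g) \<otimes>\<^bsub>K\<^esub> (s \<otimes>\<^bsub>K\<^esub> h) = inv\<^bsub>K\<^esub> g \<otimes>\<^bsub>K\<^esub> h"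
    if "s \<in> carrier K" "g \<in> carrier K" "h \<in> carrier K" for s g h
    using inv_mult_telescope[of g "inv\<^bsub>K\<^esub> s" h] that by (simp add: inv_mult_group)
  ultimately show ?thesis
    unfolding inv_cochains_1_iff by simp
qed

lemma cont_hom_integer_mod:
  assumes "prime p"
  shows "\<alpha> \<in> cont_hom K (integer_mod_group p) \<longleftrightarrow>
    continuous_map (topo K) (discrete_topology {0..<int p}) \<alpha> \<and> \<alpha> \<in> carrier K \<rightarrow> {0..<int p} \<and>
    (\<forall>g\<in>carrier K. \<forall>h\<in>carrier K. \<alpha> (g \<otimes>\<^bsub>K\<^esub> h) = (\<alpha> g + \<alpha> h) mod int p)"
  using prime_gt_0_nat[OF assms] by (auto simp: cont_hom_def hom_def carrier_integer_mod_group)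

lemma cocycle_of_in_inv_cocycles:
  assumes p: "prime p" and K: "topological_group K" and a: "\<alpha> \<in> cont_hom K (integer_mod_group p)"
  shows "cocycle_of K \<alpha> \<in> inv_cocycles K (carrier K) (prime_field p) 1"
proof -
  interpret group K by (rule topological_groupD[OF K])
  note a' = a[unfolded cont_hom_integer_mod[OF p]]
  then have mult: "\<alpha> (g \<otimes>\<^bsub>K\<^esub> h) = (\<alpha> g + \<alpha> h) mod int p" if "g \<in> carrier K" "h \<in> carrier K" for g h
    using that by blast
  have "cocycle_of K \<alpha> (edge g k) = (cocycle_of K \<alpha> (edge g h) + cocycle_of K \<alpha> (edge h k)) mod int p"
    if "g \<in> carrier K" "h \<in> carrier K" "k \<in> carrier K" for g h k
  proof -
    have "\<alpha> ((inv\<^bsub>K\<^esub> g \<otimes>\<^bsub>K\<^esub> h) \<otimes>\<^bsub>K\<^esub> (inv\<^bsub>K\<^esub> h \<otimes>\<^bsub>K\<^esub> k)) = (\<alpha> (inv\<^bsub>K\<^esub> g \<otimes>\<^bsub>K\<^esub> h) + \<alpha> (inv\<^bsub>K\<^esub> h \<otimes>\<^bsub>K\<^esub> k)) mod int p"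
      by (rule mult) (use that in auto)
    then show ?thesis using that by (simp only: inv_mult_telescope[OF that] cocycle_of_edge)
  qed
  moreover have "cocycle_of K \<alpha> \<in> inv_cochains K (carrier K) (prime_field p) 1"
    by (rule inv_cochain_of_function[OF K conjunct1[OF a']])
  ultimately show ?thesis unfolding inv_cocycles_1_iff[OF p] by blast
qed

lemma inv_cochain_edge:
  assumes "topological_group K" "x \<in> inv_cochains K (carrier K) (prime_field p) 1" "g \<in> carrier K" "h \<in> carrier K"
  shows "x (edge g h) = x (edge \<one>\<^bsub>K\<^esub> (inv\<^bsub>K\<^esub> g \<otimes>\<^bsub>K\<^esub> h))"
proof -
  interpret group K by (rule topological_groupD[OF assms(1)])
  have "x (edge (inv\<^bsub>K\<^esub> g \<otimes>\<^bsub>K\<^esub> g) (inv\<^bsub>K\<^esub> g \<otimes>\<^bsub>K\<^esub> h)) = x (edge g h)"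
    using assms(2-) inv_closed[OF assms(3)] unfolding inv_cochains_1_iff by blast
  then show ?thesis using assms(3) by simp
qed

lemma continuous_map_cochain_edge:
  assumes "topological_group K" "x \<in> inv_cochains K S (prime_field p) 1"
  shows "continuous_map (topo K) (discrete_topology {0..<int p}) (\<lambda>g. x (edge \<one>\<^bsub>K\<^esub> g))"
  using continuous_map_compose[OF continuous_map_edge[OF assms(1)], of "discrete_topology {0..<int p}" x] assms(2)
  unfolding inv_cochains_1_iff by (simp add: comp_def)

lemma inv_cocycle_obtain:
  assumes p: "prime p" and K: "topological_group K" and x: "x \<in> inv_cocycles K (carrier K) (prime_field p) 1"
  obtains \<alpha> where "\<alpha> \<in> cont_hom K (integer_mod_group p)" "x = cocycle_of K \<alpha>"
proof -
  interpret group K by (rule topological_groupD[OF K])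
  have xc: "x \<in> inv_cochains K (carrier K) (prime_field p) 1" using x by (simp add: inv_cocycles_def)
  let ?\<alpha> = "\<lambda>g. x (edge \<one>\<^bsub>K\<^esub> g)"
  have "?\<alpha> (g \<otimes>\<^bsub>K\<^esub> h) = (?\<alpha> g + ?\<alpha> h) mod int p" if gh: "g \<in> carrier K" "h \<in> carrier K" for g h
  proof -
    have "x (edge g (g \<otimes>\<^bsub>K\<^esub> h)) = ?\<alpha> h"
      using inv_cochain_edge[OF K xc gh(1) m_closed[OF gh]] gh by (simp flip: m_assoc)
    then show ?thesis using inv_cocycles_1_add[OF p x one_closed gh(1) m_closed[OF gh]] by simp
  qed
  then have "?\<alpha> \<in> cont_hom K (integer_mod_group p)"
    using continuous_map_cochain_edge[OF K xc] inv_cochains_1_mem[OF xc] by (simp add: cont_hom_integer_mod[OF p])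
  moreover have "x = cocycle_of K ?\<alpha>"
  proof
    fix t
    have "x \<in> tuples K 1 \<rightarrow>\<^sub>E {0..<int p}" using xc by (simp add: inv_cochains_1_iff)
    show "x t = cocycle_of K ?\<alpha> t"
    proof (cases "t \<in> tuples K 1")
      case True
      then obtain g h where gh: "g \<in> carrier K" "h \<in> carrier K" "t = edge g h" by (auto simp: tuples_1)
      then show ?thesis using inv_cochain_edge[OF K xc gh(1,2)] by simp
    qed (simp add: cocycle_of_def PiE_arb[OF \<open>x \<in> tuples K 1 \<rightarrow>\<^sub>E {0..<int p}\<close>])
  qed
  ultimately show ?thesis using that by blast
qed

section \<open>Cup products of characters\<close>

text \<open>Applied with \<open>m = 1\<close> and \<open>m = - 1\<close>, so that coboundaries are
  seen to be closed under both sums and differences.\<close>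

lemma inv_cochains_1_lincomb:
  fixes m :: int
  assumes p: "prime p" and K: "topological_group K"
    and x: "x \<in> inv_cochains K (carrier K) (prime_field p) 1"
    and y: "y \<in> inv_cochains K (carrier K) (prime_field p) 1"
  shows "(\<lambda>t\<in>tuples K 1. (x t + m * y t) mod int p) \<in> inv_cochains K (carrier K) (prime_field p) 1"
    (is "?z \<in> _")
proof -
  interpret group K by (rule topological_groupD[OF K])
  have p0: "int p > 0" using p prime_gt_0_nat by simp
  have "continuous_map (product_topology (\<lambda>_. topo K) {..1}) (discrete_topology {0..<int p}) (\<lambda>t. (x t + m * y t) mod int p)"
    using x y p0 unfolding inv_cochains_1_iff by (intro continuous_map_discrete_pair[where k = "\<lambda>a b. (a + m * b) mod int p"]) auto
  then have "continuous_map (product_topology (\<lambda>_. topo K) {..1}) (discrete_topology {0..<int p}) ?z"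
    by (rule continuous_map_eq) (simp add: tuples_def topological_groupD[OF K])
  moreover have "?z (edge (s \<otimes>\<^bsub>K\<^esub> g) (s \<otimes>\<^bsub>K\<^esub> h)) = ?z (edge g h)"
    if "s \<in> carrier K" "g \<in> carrier K" "h \<in> carrier K" for s g h
  proof -
    have "x (edge (s \<otimes>\<^bsub>K\<^esub> g) (s \<otimes>\<^bsub>K\<^esub> h)) = x (edge g h)" "y (edge (s \<otimes>\<^bsub>K\<^esub> g) (s \<otimes>\<^bsub>K\<^esub> h)) = y (edge g h)"
      using x y that unfolding inv_cochains_1_iff by blast+
    then show ?thesis using that by simp
  qed
  ultimately show ?thesis
    using p0 unfolding inv_cochains_1_iff by auto
qed

lemma differential_1_lincomb:
  fixes m :: int
  assumes p: "prime p"
    and x: "x \<in> inv_cochains K (carrier K) (prime_field p) 1"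
    and y: "y \<in> inv_cochains K (carrier K) (prime_field p) 1"
  shows "differential K (prime_field p) 1 (\<lambda>t\<in>tuples K 1. (x t + m * y t) mod int p) =
    (\<lambda>t\<in>tuples K 2. (differential K (prime_field p) 1 x t + m * differential K (prime_field p) 1 y t) mod int p)"
    (is "differential K _ 1 ?z = _")
proof
  fix t
  have p0: "int p > 0" using p prime_gt_0_nat by simp
  show "differential K (prime_field p) 1 ?z t = (\<lambda>t\<in>tuples K 2. (differential K (prime_field p) 1 x t + m * differential K (prime_field p) 1 y t) mod int p) t"
  proof (cases "t \<in> tuples K 2")
    case True
    then obtain g h k where g: "g \<in> carrier K" "h \<in> carrier K" "k \<in> carrier K" and t: "t = triangle g h k"
      by (auto simp: tuples_2)
    have xy: "x \<in> tuples K 1 \<rightarrow> {0..<int p}" "y \<in> tuples K 1 \<rightarrow> {0..<int p}" "?z \<in> tuples K 1 \<rightarrow> {0..<int p}"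
      using x y p0 by (auto simp: inv_cochains_1_iff)
    let ?d = "\<lambda>x. x (edge h k) - x (edge g k) + x (edge g h)"
    have "?d ?z mod int p = (?d x + m * ?d y) mod int p"
    proof -
      have "?d ?z mod int p = (x (edge h k) + m * y (edge h k) - (x (edge g k) + m * y (edge g k)) + (x (edge g h) + m * y (edge g h))) mod int p"
        by (intro mod_add_cong mod_diff_cong) (use g in simp_all)
      then show ?thesis by (simp add: algebra_simps)
    qed
    also have "\<dots> = (?d x mod int p + m * (?d y mod int p)) mod int p"
      by (intro mod_add_cong mod_mult_cong) simp_all
    finally show ?thesis
      using True t by (simp add: differential_1[OF p xy(1) g] differential_1[OF p xy(2) g] differential_1[OF p xy(3) g])
  qed (simp add: differential_def)
qed

lemma coboundaries_2: "coboundaries K R 2 = differential K R 1 ` inv_cochains K (carrier K) R 1"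
  by (simp add: coboundaries_def numeral_2_eq_2 One_nat_def)

text \<open>The identity of the cohomology group is the set of coboundaries. If the coset of
  \<open>c\<close> is that set, it contains \<open>0 + c\<close>; conversely, coboundaries can be
  shifted by \<open>c\<close> in both directions.\<close>

lemma cohomology_class_2_trivial_iff:
  assumes p: "prime p" and K: "topological_group K" and c: "c \<in> tuples K 2 \<rightarrow>\<^sub>E {0..<int p}"
  shows "cohomology_class K (prime_field p) 2 c = coboundaries K (prime_field p) 2 \<longleftrightarrow>
    c \<in> coboundaries K (prime_field p) 2"
proof -
  interpret group K by (rule topological_groupD[OF K])
  have p0: "int p > 0" using p prime_gt_0_nat by simp
  let ?B = "coboundaries K (prime_field p) 2" and ?C = "inv_cochains K (carrier K) (prime_field p) 1"
  let ?d = "differential K (prime_field p) 1"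
  have cls: "cohomology_class K (prime_field p) 2 c = (\<lambda>b. \<lambda>t\<in>tuples K 2. (b t + c t) mod int p) ` ?B"
    by (auto simp: cohomology_class_def r_coset_def cocycle_group_def)
  have zero: "(\<lambda>_\<in>tuples K 1. 0) \<in> ?C"
    using inv_cochain_of_function[OF K, of p "\<lambda>_. 0"] p0 by (simp add: cocycle_of_def)
  have dzero: "?d (\<lambda>_\<in>tuples K 1. 0) t = 0" if "t \<in> tuples K 2" for t
  proof -
    obtain g h k where g: "g \<in> carrier K" "h \<in> carrier K" "k \<in> carrier K" and t: "t = triangle g h k"
      using \<open>t \<in> tuples K 2\<close> by (auto simp: tuples_2)
    show ?thesis using differential_1[OF p _ g, of "\<lambda>_\<in>tuples K 1. 0"] p0 g t by auto
  qed
  show ?thesis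
  proof
    assume eq: "cohomology_class K (prime_field p) 2 c = ?B"
    have "(\<lambda>t\<in>tuples K 2. (?d (\<lambda>_\<in>tuples K 1. 0) t + c t) mod int p) \<in> cohomology_class K (prime_field p) 2 c"
      unfolding cls coboundaries_2 using zero by blast
    moreover have "(\<lambda>t\<in>tuples K 2. (?d (\<lambda>_\<in>tuples K 1. 0) t + c t) mod int p) = c"
    proof
      fix t show "(\<lambda>t\<in>tuples K 2. (?d (\<lambda>_\<in>tuples K 1. 0) t + c t) mod int p) t = c t"
        using PiE_mem[OF c, of t] PiE_arb[OF c, of t] dzero[of t] by (cases "t \<in> tuples K 2") auto
    qed
    ultimately show "c \<in> ?B" using eq by simp
  next
    assume "c \<in> ?B"
    then obtain y where y: "y \<in> ?C" "c = ?d y" unfolding coboundaries_2 by blast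
    have comb: "(\<lambda>t\<in>tuples K 2. (?d x t + m * c t) mod int p) \<in> ?B" if "x \<in> ?C" for x m
      unfolding coboundaries_2 y(2) differential_1_lincomb[OF p that y(1), symmetric]
      using inv_cochains_1_lincomb[OF p K that y(1)] by blast
    have dc: "?d x t \<in> {0..<int p}" if "x \<in> ?C" "t \<in> tuples K 2" for x t
    proof -
      obtain g h k where g: "g \<in> carrier K" "h \<in> carrier K" "k \<in> carrier K" and t: "t = triangle g h k"
        using \<open>t \<in> tuples K 2\<close> by (auto simp: tuples_2)
      have "x \<in> tuples K 1 \<rightarrow> {0..<int p}" using that(1) by (auto simp: inv_cochains_1_iff)
      then show ?thesis using p0 by (simp add: t differential_1[OF p _ g])
    qed
    show "cohomology_class K (prime_field p) 2 c = ?B"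
      unfolding cls
    proof (intro equalityI subsetI)
      fix b assume "b \<in> (\<lambda>b. \<lambda>t\<in>tuples K 2. (b t + c t) mod int p) ` ?B"
      then obtain x where "x \<in> ?C" "b = (\<lambda>t\<in>tuples K 2. (?d x t + 1 * c t) mod int p)"
        by (auto simp: coboundaries_2)
      then show "b \<in> ?B" using comb by blast
    next
      fix b assume "b \<in> ?B"
      then obtain x where x: "x \<in> ?C" "b = ?d x" by (auto simp: coboundaries_2)
      let ?b = "\<lambda>t\<in>tuples K 2. (?d x t + (- 1) * c t) mod int p"
      have "b = (\<lambda>t\<in>tuples K 2. (?b t + c t) mod int p)"
      proof
        fix t show "b t = (\<lambda>t\<in>tuples K 2. (?b t + c t) mod int p) t"
        proof (cases "t \<in> tuples K 2")
          case True
          have "((?d x t - c t) mod int p + c t) mod int p = ?d x t mod int p" by (simp add: mod_simps)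
          then show ?thesis using True dc[OF x(1) True] x by simp
        qed (simp add: x differential_def)
      qed
      then show "b \<in> (\<lambda>b. \<lambda>t\<in>tuples K 2. (b t + c t) mod int p) ` ?B" using comb[OF x(1)] by blast
    qed
  qed
qed

lemma cup_cochain_1_1:
  assumes g: "g \<in> carrier K" "h \<in> carrier K" "k \<in> carrier K"
  shows "cup_cochain K (prime_field p) 1 1 x y (triangle g h k) = (x (edge g h) * y (edge h k)) mod int p"
proof -
  have "(\<lambda>i\<in>{..1}. triangle g h k i) = edge g h" "(\<lambda>i\<in>{..1}. triangle g h k (1 + i)) = edge h k"
    by (auto simp: triangle_def edge_def fun_eq_iff le_1_cases)
  moreover have "triangle g h k \<in> tuples K 2" using g by (auto simp: tuples_2)
  ultimately show ?thesis by (simp add: cup_cochain_def)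
qed

text \<open>The corner entry \<open>s\<close> of a lift satisfies
  \<open>s (g h) = s g + s h + \<alpha> g * \<beta> h\<close> modulo p. This says that
  \<open>- s\<close>, read as a homogeneous cochain, has the cup product as its differential, and
  conversely minus such a cochain is the corner of a lift.\<close>

lemma cup_product_trivial_iff:
  assumes p: "prime p" and K: "topological_group K"
    and a: "\<alpha> \<in> cont_hom K (integer_mod_group p)" and b: "\<beta> \<in> cont_hom K (integer_mod_group p)"
  shows "cup_product K (prime_field p) 1 1 {cocycle_of K \<alpha>} {cocycle_of K \<beta>} = \<one>\<^bsub>cohomology K (prime_field p) 2\<^esub> \<longleftrightarrow>
    (\<exists>r\<in>cont_hom K (heis p). \<forall>g\<in>carrier K. fst (r g) = \<alpha> g \<and> fst (snd (r g)) = \<beta> g)"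
proof -
  interpret group K by (rule topological_groupD[OF K])
  have p0: "int p > 0" using p prime_gt_0_nat by simp
  note a' = a[unfolded cont_hom_integer_mod[OF p]] and b' = b[unfolded cont_hom_integer_mod[OF p]]
  let ?c = "cup_cochain K (prime_field p) 1 1 (cocycle_of K \<alpha>) (cocycle_of K \<beta>)"
  let ?d = "differential K (prime_field p) 1"
  have c: "?c (triangle g h k) = (\<alpha> (inv\<^bsub>K\<^esub> g \<otimes>\<^bsub>K\<^esub> h) * \<beta> (inv\<^bsub>K\<^esub> h \<otimes>\<^bsub>K\<^esub> k)) mod int p"
    if "g \<in> carrier K" "h \<in> carrier K" "k \<in> carrier K" for g h k
    using that by (simp add: cup_cochain_1_1)
  then have cPi: "?c \<in> tuples K 2 \<rightarrow>\<^sub>E {0..<int p}"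
    using p0 by (intro PiE_I) (force simp: tuples_2, simp add: cup_cochain_def)
  have "cup_product K (prime_field p) 1 1 {cocycle_of K \<alpha>} {cocycle_of K \<beta>} = cohomology_class K (prime_field p) 2 ?c"
    by (simp add: cup_product_def)
  then have "cup_product K (prime_field p) 1 1 {cocycle_of K \<alpha>} {cocycle_of K \<beta>} = \<one>\<^bsub>cohomology K (prime_field p) 2\<^esub> \<longleftrightarrow>
      ?c \<in> ?d ` inv_cochains K (carrier K) (prime_field p) 1"
    using cohomology_class_2_trivial_iff[OF p K cPi] by (simp add: cohomology_def coboundaries_2)
  also have "\<dots> \<longleftrightarrow> (\<exists>r\<in>cont_hom K (heis p). \<forall>g\<in>carrier K. fst (r g) = \<alpha> g \<and> fst (snd (r g)) = \<beta> g)"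
  proof
    assume "?c \<in> ?d ` inv_cochains K (carrier K) (prime_field p) 1"
    then obtain y where y: "y \<in> inv_cochains K (carrier K) (prime_field p) 1" "?c = ?d y" by blast
    have yPi: "y \<in> tuples K 1 \<rightarrow> {0..<int p}" using y by (auto simp: inv_cochains_1_iff)
    let ?y = "\<lambda>g. y (edge \<one>\<^bsub>K\<^esub> g)"
    have ymul: "(- ?y (g \<otimes>\<^bsub>K\<^esub> h)) mod int p = (- ?y g + - ?y h + \<alpha> g * \<beta> h) mod int p"
      if gh: "g \<in> carrier K" "h \<in> carrier K" for g h
    proof -
      have ghc: "g \<otimes>\<^bsub>K\<^esub> h \<in> carrier K" using gh by simp
      have "inv\<^bsub>K\<^esub> g \<otimes>\<^bsub>K\<^esub> (g \<otimes>\<^bsub>K\<^esub> h) = h" using gh by (simp flip: m_assoc)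
      \<comment> \<open>The differential is evaluated on the triangle with vertices 1,
        \<open>g\<close> and \<open>g h\<close>; its edge from \<open>g\<close> to
        \<open>g h\<close> is a translate of the one from 1 to \<open>h\<close>.\<close>
      then have "(\<alpha> g * \<beta> h) mod int p = (?y h - ?y (g \<otimes>\<^bsub>K\<^esub> h) + ?y g) mod int p"
        using fun_cong[OF y(2), of "triangle \<one>\<^bsub>K\<^esub> g (g \<otimes>\<^bsub>K\<^esub> h)"] c[OF one_closed gh(1) ghc]
          differential_1[OF p yPi one_closed gh(1) ghc] inv_cochain_edge[OF K y(1) gh(1) ghc] gh by simp
      then have "(- ?y g + - ?y h + \<alpha> g * \<beta> h) mod int p = (- ?y g + - ?y h + (?y h - ?y (g \<otimes>\<^bsub>K\<^esub> h) + ?y g)) mod int p"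
        by (intro mod_add_cong) simp_all
      then show ?thesis by simp
    qed
    let ?r = "\<lambda>g. (\<alpha> g, \<beta> g, (- ?y g) mod int p)"
    have hc: "carrier (heis p) = {0..<int p} \<times> {0..<int p} \<times> {0..<int p}" by (simp add: heis_def)
    have cont: "continuous_map (topo K) (discrete_topology {0..<int p}) (\<lambda>g. (- ?y g) mod int p)"
      by (rule continuous_map_discrete_pair[where k = "\<lambda>a _. (- a) mod int p",
            OF continuous_map_cochain_edge[OF K y(1)] continuous_map_cochain_edge[OF K y(1)]])
         (use p0 in simp)
    have "continuous_map (topo K) (discrete_topology ({0..<int p} \<times> {0..<int p})) (\<lambda>g. (\<beta> g, (- ?y g) mod int p))"
      by (rule continuous_map_discrete_pair[OF conjunct1[OF b'] cont]) (use b' p0 in \<open>auto simp: topological_groupD[OF K]\<close>)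
    then have "continuous_map (topo K) (discrete_topology (carrier (heis p))) ?r"
      unfolding hc
      by (rule continuous_map_discrete_pair[OF conjunct1[OF a'], where k = Pair])
         (use a' b' p0 in \<open>auto simp: topological_groupD[OF K]\<close>)
    moreover have "?r \<in> hom K (heis p)"
    proof (rule homI)
      fix g h assume gh: "g \<in> carrier K" "h \<in> carrier K"
      have "((- ?y g) mod int p + (- ?y h) mod int p + \<alpha> g * \<beta> h) mod int p = (- ?y g + - ?y h + \<alpha> g * \<beta> h) mod int p"
        by (intro mod_add_cong) simp_all
      then show "?r (g \<otimes>\<^bsub>K\<^esub> h) = ?r g \<otimes>\<^bsub>heis p\<^esub> ?r h"
        using a' b' gh ymul[OF gh] by simp
    qed (use a' b' p0 in \<open>auto simp: hc\<close>)
    ultimately have "?r \<in> cont_hom K (heis p)" by (simp add: cont_hom_def)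
    then show "\<exists>r\<in>cont_hom K (heis p). \<forall>g\<in>carrier K. fst (r g) = \<alpha> g \<and> fst (snd (r g)) = \<beta> g"
      by (intro bexI[of _ ?r]) simp_all
  next
    assume "\<exists>r\<in>cont_hom K (heis p). \<forall>g\<in>carrier K. fst (r g) = \<alpha> g \<and> fst (snd (r g)) = \<beta> g"
    then obtain r where r: "r \<in> cont_hom K (heis p)"
      "\<And>g. g \<in> carrier K \<Longrightarrow> fst (r g) = \<alpha> g" "\<And>g. g \<in> carrier K \<Longrightarrow> fst (snd (r g)) = \<beta> g" by blast
    let ?s = "\<lambda>g. snd (snd (r g))"
    have rc: "r g \<in> carrier (heis p)" if "g \<in> carrier K" for g using r(1) that by (auto simp: cont_hom_def hom_def)
    have smul: "?s (g \<otimes>\<^bsub>K\<^esub> h) = (?s g + ?s h + \<alpha> g * \<beta> h) mod int p" if gh: "g \<in> carrier K" "h \<in> carrier K" for g h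
    proof -
      have "r (g \<otimes>\<^bsub>K\<^esub> h) = r g \<otimes>\<^bsub>heis p\<^esub> r h" using r(1) gh by (auto simp: cont_hom_def hom_def)
      also have "\<dots> = (\<alpha> g, \<beta> g, ?s g) \<otimes>\<^bsub>heis p\<^esub> (\<alpha> h, \<beta> h, ?s h)"
        using r(2,3) gh by (metis prod.collapse)
      finally show ?thesis by simp
    qed
    have rcont: "continuous_map (topo K) (discrete_topology (carrier (heis p))) r" using r(1) by (simp add: cont_hom_def)
    have "continuous_map (topo K) (discrete_topology {0..<int p}) (\<lambda>g. (- ?s g) mod int p)"
      by (rule continuous_map_discrete_pair[where k = "\<lambda>a _. (- snd (snd a)) mod int p", OF rcont rcont]) (use p0 in simp)
    then have y: "cocycle_of K (\<lambda>g. (- ?s g) mod int p) \<in> inv_cochains K (carrier K) (prime_field p) 1" (is "?y \<in> _")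
      by (rule inv_cochain_of_function[OF K])
    have yPi: "?y \<in> tuples K 1 \<rightarrow> {0..<int p}" using y by (auto simp: inv_cochains_1_iff)
    have "?c = ?d ?y"
    proof
      fix t show "?c t = ?d ?y t"
      proof (cases "t \<in> tuples K 2")
        case True
        then obtain g h k where g: "g \<in> carrier K" "h \<in> carrier K" "k \<in> carrier K" and t: "t = triangle g h k"
          by (auto simp: tuples_2)
        let ?a = "inv\<^bsub>K\<^esub> g \<otimes>\<^bsub>K\<^esub> h" and ?b = "inv\<^bsub>K\<^esub> h \<otimes>\<^bsub>K\<^esub> k"
        have ab: "?a \<in> carrier K" "?b \<in> carrier K" using g by auto
        have "?s (inv\<^bsub>K\<^esub> g \<otimes>\<^bsub>K\<^esub> k) = (?s ?a + ?s ?b + \<alpha> ?a * \<beta> ?b) mod int p"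
          using smul[OF ab] by (simp only: inv_mult_telescope[OF g])
        then have "?d ?y t = ((- ?s ?b) mod int p - (- ((?s ?a + ?s ?b + \<alpha> ?a * \<beta> ?b) mod int p)) mod int p + (- ?s ?a) mod int p) mod int p"
          using g by (simp add: t differential_1[OF p yPi g])
        also have "\<dots> = (- ?s ?b - (- (?s ?a + ?s ?b + \<alpha> ?a * \<beta> ?b)) + - ?s ?a) mod int p"
          by (intro mod_add_cong mod_diff_cong) (simp_all add: mod_simps)
        also have "\<dots> = ?c t" using c[OF g] t by simp
        finally show ?thesis by simp
      qed (simp add: differential_def cup_cochain_def)
    qed
    then show "?c \<in> ?d ` inv_cochains K (carrier K) (prime_field p) 1" using y by blast
  qed
  finally show ?thesis .
qed

text \<open>The cup radical in terms of characters, as \<open>cup_radical_eq\<close> shows; from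
  here on cochains enter only through corestriction.\<close>

definition radical_chars :: "nat \<Rightarrow> 'a top_group \<Rightarrow> ('a \<Rightarrow> int) set" where
  "radical_chars p K = {\<alpha> \<in> cont_hom K (integer_mod_group p). \<forall>\<beta>\<in>cont_hom K (integer_mod_group p).
     \<exists>r\<in>cont_hom K (heis p). \<forall>g\<in>carrier K. fst (r g) = \<alpha> g \<and> fst (snd (r g)) = \<beta> g}"

lemma cup_radical_eq:
  assumes p: "prime p" and K: "topological_group K"
  shows "cup_radical p K = (\<lambda>\<alpha>. {cocycle_of K \<alpha>}) ` radical_chars p K"
proof -
  have H1: "carrier (cohomology K (prime_field p) 1) = (\<lambda>\<alpha>. {cocycle_of K \<alpha>}) ` cont_hom K (integer_mod_group p)"
  proof -
    have "inv_cocycles K (carrier K) (prime_field p) 1 = cocycle_of K ` cont_hom K (integer_mod_group p)"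
      using cocycle_of_in_inv_cocycles[OF p K] inv_cocycle_obtain[OF p K] by blast
    then show ?thesis unfolding carrier_cohomology_1[OF p K] by (simp add: image_image)
  qed
  have "radical_chars p K = {\<alpha> \<in> cont_hom K (integer_mod_group p). \<forall>\<beta>\<in>cont_hom K (integer_mod_group p).
      cup_product K (prime_field p) 1 1 {cocycle_of K \<alpha>} {cocycle_of K \<beta>} = \<one>\<^bsub>cohomology K (prime_field p) 2\<^esub>}"
    unfolding radical_chars_def
    by (intro Collect_cong conj_cong ball_cong refl) (rule cup_product_trivial_iff[OF p K, symmetric])
  then show ?thesis
    unfolding cup_radical_def H1 by blast
qed

section \<open>Corestriction\<close>

lemma (in group) bij_betw_mult_right:
  assumes "c \<in> carrier G"
  shows "bij_betw (\<lambda>x. x \<otimes> c) (carrier G) (carrier G)"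
proof -
  have "x = x \<otimes> inv c \<otimes> c" if "x \<in> carrier G" for x using that assms by (simp add: m_assoc)
  then have "(\<lambda>x. x \<otimes> c) ` carrier G = carrier G" using assms by (auto intro!: image_eqI)
  then show ?thesis using inj_on_multc[OF assms] by (simp add: bij_betw_def)
qed

lemma (in group) some_rcoset_representative:
  assumes U: "subgroup U G" and C: "C \<in> rcosets U"
  shows "(SOME t. t \<in> C) \<in> carrier G" "U #> (SOME t. t \<in> C) = C"
proof -
  obtain a where a: "a \<in> carrier G" "C = U #> a" using C by (auto simp: RCOSETS_def)
  then have "a \<in> C" using rcos_self[OF _ U] by blast
  then have t: "(SOME t. t \<in> C) \<in> C" by (rule someI)
  then show "(SOME t. t \<in> C) \<in> carrier G" using C rcosets_part_G[OF U] by blast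
  show "U #> (SOME t. t \<in> C) = C" using repr_independence[of "SOME t. t \<in> C" U a] t a U by simp
qed

lemma norm_cochain_1_edge:
  assumes p: "prime p" and G: "group G" and U: "U \<lhd> G" and fin: "finite (carrier (G Mod U))"
    and x: "x \<in> inv_cochains G U (prime_field p) 1" and g: "g \<in> carrier G" "h \<in> carrier G"
  shows "norm_cochain G U (prime_field p) 1 x (edge g h) =
    (\<Sum>C\<in>carrier (G Mod U). x (edge ((SOME t. t \<in> C) \<otimes>\<^bsub>G\<^esub> g) ((SOME t. t \<in> C) \<otimes>\<^bsub>G\<^esub> h))) mod int p"
proof -
  interpret group G by fact
  interpret U: normal U G by fact
  have t: "(SOME t. t \<in> C) \<in> carrier G" if "C \<in> rcosets\<^bsub>G\<^esub> U" for C
    by (rule some_rcoset_representative[OF U.subgroup_axioms that])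
  have "norm_cochain G U (prime_field p) 1 x (edge g h) = finsum (prime_field p)
      (\<lambda>C. x (edge ((SOME t. t \<in> C) \<otimes>\<^bsub>G\<^esub> g) ((SOME t. t \<in> C) \<otimes>\<^bsub>G\<^esub> h))) (rcosets\<^bsub>G\<^esub> U)"
    using g by (simp add: norm_cochain_def translate_edge)
  also have "\<dots> = (\<Sum>C\<in>rcosets\<^bsub>G\<^esub> U. x (edge ((SOME t. t \<in> C) \<otimes>\<^bsub>G\<^esub> g) ((SOME t. t \<in> C) \<otimes>\<^bsub>G\<^esub> h))) mod int p"
    using fin t g by (intro finsum_prime_field[OF p] inv_cochains_1_mem[OF x]) (auto simp: FactGroup_def)
  finally show ?thesis by (simp add: FactGroup_def)
qed

text \<open>Two extensions of a cocycle on \<open>U\<close> differ by the coboundary of a function on \<open>U\<setminus>G\<close>, whose norm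
  is constant.\<close>

lemma norm_cochain_1_cong:
  assumes p: "prime p" and G: "topological_group G" and U: "U \<lhd> G" and fin: "finite (carrier (G Mod U))"
    and x: "x \<in> inv_cocycles G U (prime_field p) 1" and y: "y \<in> inv_cocycles G U (prime_field p) 1"
    and xy: "\<And>u w. u \<in> U \<Longrightarrow> w \<in> U \<Longrightarrow> x (edge u w) = y (edge u w)"
  shows "norm_cochain G U (prime_field p) 1 x = norm_cochain G U (prime_field p) 1 y"
proof
  interpret group G by (rule topological_groupD[OF G])
  interpret U: normal U G by fact
  interpret Q: group "G Mod U" by (rule U.factorgroup_is_group)
  let ?Q = "carrier (G Mod U)" and ?t = "\<lambda>C. SOME t. t \<in> C"
  have xc: "x \<in> inv_cochains G U (prime_field p) 1" and yc: "y \<in> inv_cochains G U (prime_field p) 1"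
    using x y by (auto simp: inv_cocycles_def)
  have t: "?t C \<in> carrier G" "U #>\<^bsub>G\<^esub> ?t C = C" if C: "C \<in> ?Q" for C
    using some_rcoset_representative[OF U.subgroup_axioms, of C] C by (simp_all add: FactGroup_def)
  \<comment> \<open>By the cocycle identity \<open>x\<close> and \<open>y\<close> are determined by
    their values on edges starting at 1. Modulo p the difference \<open>d\<close> of these values is
    constant on right cosets of \<open>U\<close>, by \<open>d_inv\<close>.\<close>
  define d where "d g = x (edge \<one>\<^bsub>G\<^esub> g) - y (edge \<one>\<^bsub>G\<^esub> g)" for g
  have d_inv: "[d (u \<otimes>\<^bsub>G\<^esub> g) = d g] (mod int p)" if u: "u \<in> U" and g: "g \<in> carrier G" for u g
  proof -
    have z: "z (edge \<one>\<^bsub>G\<^esub> (u \<otimes>\<^bsub>G\<^esub> g)) = (z (edge \<one>\<^bsub>G\<^esub> u) + z (edge \<one>\<^bsub>G\<^esub> g)) mod int p"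
      if z: "z \<in> inv_cocycles G U (prime_field p) 1" for z
    proof -
      have "z (edge (u \<otimes>\<^bsub>G\<^esub> \<one>\<^bsub>G\<^esub>) (u \<otimes>\<^bsub>G\<^esub> g)) = z (edge \<one>\<^bsub>G\<^esub> g)"
        using z u g one_closed unfolding inv_cocycles_1_iff[OF p] inv_cochains_1_iff by blast
      then show ?thesis
        using inv_cocycles_1_add[OF p z one_closed U.mem_carrier[OF u], of "u \<otimes>\<^bsub>G\<^esub> g"] u g
        by (simp add: U.mem_carrier)
    qed
    have "[d (u \<otimes>\<^bsub>G\<^esub> g) = (x (edge \<one>\<^bsub>G\<^esub> u) + x (edge \<one>\<^bsub>G\<^esub> g)) - (y (edge \<one>\<^bsub>G\<^esub> u) + y (edge \<one>\<^bsub>G\<^esub> g))] (mod int p)"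
      unfolding d_def z[OF x] z[OF y] by (intro cong_diff) (simp_all add: cong_def)
    then show ?thesis using xy[OF U.one_closed u] by (simp add: d_def)
  qed
  \<comment> \<open>Right multiplication by \<open>g\<close> permutes the right cosets, so modulo p
    translating all representatives only reorders the sum.\<close>
  have shift: "[(\<Sum>C\<in>?Q. d (?t C \<otimes>\<^bsub>G\<^esub> g)) = (\<Sum>C\<in>?Q. d (?t C))] (mod int p)" if g: "g \<in> carrier G" for g
  proof -
    let ?s = "\<lambda>C. C \<otimes>\<^bsub>G Mod U\<^esub> (U #>\<^bsub>G\<^esub> g)"
    have gQ: "U #>\<^bsub>G\<^esub> g \<in> ?Q" using g by (auto simp: FactGroup_def RCOSETS_def)
    have "[d (?t C \<otimes>\<^bsub>G\<^esub> g) = d (?t (?s C))] (mod int p)" if C: "C \<in> ?Q" for C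
    proof -
      have sC: "?s C \<in> ?Q" using C gQ by (rule Q.m_closed)
      have "U #>\<^bsub>G\<^esub> (?t C \<otimes>\<^bsub>G\<^esub> g) = ?s C"
        using U.rcos_sum[OF t(1)[OF C] g] t(2)[OF C] by (simp add: FactGroup_def)
      then have "?t C \<otimes>\<^bsub>G\<^esub> g \<in> U #>\<^bsub>G\<^esub> ?t (?s C)"
        using rcos_self[OF m_closed[OF t(1)[OF C] g] U.subgroup_axioms] t(2)[OF sC] by simp
      then obtain u where "u \<in> U" "?t C \<otimes>\<^bsub>G\<^esub> g = u \<otimes>\<^bsub>G\<^esub> ?t (?s C)" by (auto simp: r_coset_def)
      then show ?thesis using d_inv[OF _ t(1)[OF sC]] by simp
    qed
    then have "[(\<Sum>C\<in>?Q. d (?t C \<otimes>\<^bsub>G\<^esub> g)) = (\<Sum>C\<in>?Q. d (?t (?s C)))] (mod int p)"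
      by (rule cong_sum)
    also have "(\<Sum>C\<in>?Q. d (?t (?s C))) = (\<Sum>C\<in>?Q. d (?t C))"
      by (rule sum.reindex_bij_betw[where h = ?s, OF Q.bij_betw_mult_right]) (rule gQ)
    finally show ?thesis .
  qed
  fix e show "norm_cochain G U (prime_field p) 1 x e = norm_cochain G U (prime_field p) 1 y e"
  proof (cases "e \<in> tuples G 1")
    case True
    then obtain g h where g: "g \<in> carrier G" "h \<in> carrier G" and e: "e = edge g h" by (auto simp: tuples_1)
    have z: "[z (edge (?t C \<otimes>\<^bsub>G\<^esub> g) (?t C \<otimes>\<^bsub>G\<^esub> h)) = z (edge \<one>\<^bsub>G\<^esub> (?t C \<otimes>\<^bsub>G\<^esub> h)) - z (edge \<one>\<^bsub>G\<^esub> (?t C \<otimes>\<^bsub>G\<^esub> g))] (mod int p)"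
      if "z \<in> inv_cocycles G U (prime_field p) 1" "C \<in> ?Q" for z C
      using inv_cocycles_1_add[OF p that(1) one_closed m_closed[OF t(1)[OF that(2)] g(1)] m_closed[OF t(1)[OF that(2)] g(2)]]
      by (simp add: cong_def mod_simps)
    have "[(\<Sum>C\<in>?Q. x (edge (?t C \<otimes>\<^bsub>G\<^esub> g) (?t C \<otimes>\<^bsub>G\<^esub> h))) - (\<Sum>C\<in>?Q. y (edge (?t C \<otimes>\<^bsub>G\<^esub> g) (?t C \<otimes>\<^bsub>G\<^esub> h)))
        = (\<Sum>C\<in>?Q. x (edge \<one>\<^bsub>G\<^esub> (?t C \<otimes>\<^bsub>G\<^esub> h)) - x (edge \<one>\<^bsub>G\<^esub> (?t C \<otimes>\<^bsub>G\<^esub> g)))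
        - (\<Sum>C\<in>?Q. y (edge \<one>\<^bsub>G\<^esub> (?t C \<otimes>\<^bsub>G\<^esub> h)) - y (edge \<one>\<^bsub>G\<^esub> (?t C \<otimes>\<^bsub>G\<^esub> g)))] (mod int p)"
      by (intro cong_diff cong_sum z x y)
    also have "(\<Sum>C\<in>?Q. x (edge \<one>\<^bsub>G\<^esub> (?t C \<otimes>\<^bsub>G\<^esub> h)) - x (edge \<one>\<^bsub>G\<^esub> (?t C \<otimes>\<^bsub>G\<^esub> g)))
        - (\<Sum>C\<in>?Q. y (edge \<one>\<^bsub>G\<^esub> (?t C \<otimes>\<^bsub>G\<^esub> h)) - y (edge \<one>\<^bsub>G\<^esub> (?t C \<otimes>\<^bsub>G\<^esub> g)))
        = (\<Sum>C\<in>?Q. d (?t C \<otimes>\<^bsub>G\<^esub> h)) - (\<Sum>C\<in>?Q. d (?t C \<otimes>\<^bsub>G\<^esub> g))"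
      by (simp add: d_def sum_subtractf)
    also have "[\<dots> = (\<Sum>C\<in>?Q. d (?t C)) - (\<Sum>C\<in>?Q. d (?t C))] (mod int p)"
      by (intro cong_diff shift g)
    finally have "[(\<Sum>C\<in>?Q. x (edge (?t C \<otimes>\<^bsub>G\<^esub> g) (?t C \<otimes>\<^bsub>G\<^esub> h))) = (\<Sum>C\<in>?Q. y (edge (?t C \<otimes>\<^bsub>G\<^esub> g) (?t C \<otimes>\<^bsub>G\<^esub> h)))] (mod int p)"
      by (simp add: cong_diff_iff_cong_0)
    then show ?thesis
      unfolding e norm_cochain_1_edge[OF p is_group U fin xc g] norm_cochain_1_edge[OF p is_group U fin yc g] cong_def .
  qed (simp add: norm_cochain_def)
qed

text \<open>The shift in the wreath multiplication permutes the coordinates and disappears in their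
  sum. On the induced module this is the summation map to the trivial module.\<close>

lemma wreath_sum_cont_hom:
  assumes p: "prime p" and U: "U \<lhd> G" and fin: "finite (carrier (G Mod U))"
    and r: "r \<in> cont_hom G (wreath (integer_mod_group p) (G Mod U))"
    and snd: "\<And>g. g \<in> carrier G \<Longrightarrow> snd (r g) = U #>\<^bsub>G\<^esub> g"
  shows "(\<lambda>g. (\<Sum>C\<in>carrier (G Mod U). fst (r g) C) mod int p) \<in> cont_hom G (integer_mod_group p)"
proof -
  interpret U: normal U G by fact
  interpret Q: group "G Mod U" by (rule U.factorgroup_is_group)
  let ?Q = "carrier (G Mod U)"
  let ?A = "integer_mod_group p"
  have p0: "int p > 0" using p prime_gt_0_nat by simp
  have coset: "U #>\<^bsub>G\<^esub> g \<in> ?Q" if "g \<in> carrier G" for g using that by (auto simp: FactGroup_def RCOSETS_def)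
  have rc: "fst (r g) C \<in> {0..<int p}" if "g \<in> carrier G" "C \<in> ?Q" for g C
  proof -
    have "r g \<in> carrier (wreath ?A (G Mod U))" using r that by (auto simp: cont_hom_def hom_def)
    then show ?thesis using that p0 by (cases "r g") (auto simp: carrier_integer_mod_group)
  qed
  have rmul: "fst (r (g \<otimes>\<^bsub>G\<^esub> h)) C = (fst (r g) C + fst (r h) (C \<otimes>\<^bsub>G Mod U\<^esub> (U #>\<^bsub>G\<^esub> g))) mod int p"
    if "g \<in> carrier G" "h \<in> carrier G" "C \<in> ?Q" for g h C
  proof -
    have "r (g \<otimes>\<^bsub>G\<^esub> h) = r g \<otimes>\<^bsub>wreath ?A (G Mod U)\<^esub> r h" using r that by (auto simp: cont_hom_def hom_def)
    then show ?thesis using snd[OF that(1)] that(3) by (cases "r g"; cases "r h") simp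
  qed
  show ?thesis
    unfolding cont_hom_integer_mod[OF p]
  proof (intro conjI ballI)
    have "continuous_map (topo G) (discrete_topology (carrier (wreath ?A (G Mod U)))) r" using r by (simp add: cont_hom_def)
    from continuous_map_discrete_pair[OF this this, where k = "\<lambda>a _. (\<Sum>C\<in>?Q. fst a C) mod int p"]
    show "continuous_map (topo G) (discrete_topology {0..<int p}) (\<lambda>g. (\<Sum>C\<in>?Q. fst (r g) C) mod int p)" using p0 by simp
    fix g h assume g: "g \<in> carrier G" "h \<in> carrier G"
    have "[(\<Sum>C\<in>?Q. fst (r (g \<otimes>\<^bsub>G\<^esub> h)) C) = (\<Sum>C\<in>?Q. fst (r g) C + fst (r h) (C \<otimes>\<^bsub>G Mod U\<^esub> (U #>\<^bsub>G\<^esub> g)))] (mod int p)"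
      by (rule cong_sum) (simp add: rmul[OF g] cong_def)
    also have "(\<Sum>C\<in>?Q. fst (r g) C + fst (r h) (C \<otimes>\<^bsub>G Mod U\<^esub> (U #>\<^bsub>G\<^esub> g))) = (\<Sum>C\<in>?Q. fst (r g) C) + (\<Sum>C\<in>?Q. fst (r h) C)"
      unfolding sum.distrib by (simp only: sum.reindex_bij_betw[OF Q.bij_betw_mult_right[OF coset[OF g(1)]]])
    finally show "(\<Sum>C\<in>?Q. fst (r (g \<otimes>\<^bsub>G\<^esub> h)) C) mod int p = ((\<Sum>C\<in>?Q. fst (r g) C) mod int p + (\<Sum>C\<in>?Q. fst (r h) C) mod int p) mod int p"
      by (simp add: cong_def mod_simps)
  qed (use p0 in auto)
qed

text \<open>A homomorphism to the wreath product over \<open>G \<rightarrow> G/U\<close> is a cocycle of \<open>G\<close> in the induced module, and the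
  class on the left corresponds to it under Shapiro's isomorphism.\<close>

lemma corestriction_wreath:
  assumes p: "prime p" and G: "topological_group G" and U: "U \<lhd> G" and Uop: "openin (topo G) U"
    and fin: "finite (carrier (G Mod U))"
    and r: "r \<in> cont_hom G (wreath (integer_mod_group p) (G Mod U))"
    and snd: "\<And>g. g \<in> carrier G \<Longrightarrow> snd (r g) = U #>\<^bsub>G\<^esub> g"
  shows "corestriction G U (prime_field p) 1 {cocycle_of (top_subgroup G U) (\<lambda>u. fst (r u) U)} =
    {cocycle_of G (\<lambda>g. (\<Sum>C\<in>carrier (G Mod U). fst (r g) C) mod int p)}"
proof -
  interpret group G by (rule topological_groupD[OF G])
  interpret U: normal U G by fact
  interpret Q: group "G Mod U" by (rule U.factorgroup_is_group)
  let ?Q = "carrier (G Mod U)"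
  let ?A = "integer_mod_group p"
  have p0: "int p > 0" using p prime_gt_0_nat by simp
  have coset: "U #>\<^bsub>G\<^esub> g \<in> ?Q" if "g \<in> carrier G" for g using that by (auto simp: FactGroup_def RCOSETS_def)
  have rc: "fst (r g) C \<in> {0..<int p}" if "g \<in> carrier G" "C \<in> ?Q" for g C
  proof -
    have "r g \<in> carrier (wreath ?A (G Mod U))" using r that by (auto simp: cont_hom_def hom_def)
    then show ?thesis using that p0 by (cases "r g") (auto simp: carrier_integer_mod_group)
  qed
  have rmul: "fst (r (g \<otimes>\<^bsub>G\<^esub> h)) C = (fst (r g) C + fst (r h) (C \<otimes>\<^bsub>G Mod U\<^esub> (U #>\<^bsub>G\<^esub> g))) mod int p"
    if "g \<in> carrier G" "h \<in> carrier G" "C \<in> ?Q" for g h C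
  proof -
    have "r (g \<otimes>\<^bsub>G\<^esub> h) = r g \<otimes>\<^bsub>wreath ?A (G Mod U)\<^esub> r h" using r that by (auto simp: cont_hom_def hom_def)
    then show ?thesis using snd[OF that(1)] that(3) by (cases "r g"; cases "r h") simp
  qed
  \<comment> \<open>A \<open>U\<close>-invariant extension of the character of \<open>U\<close>: a
    pair is translated so as to start at 1, and the coset of its first entry tells which coordinate
    to read.\<close>
  define z where "z = (\<lambda>e\<in>tuples G 1. fst (r (inv\<^bsub>G\<^esub> e 0 \<otimes>\<^bsub>G\<^esub> e 1)) (U #>\<^bsub>G\<^esub> e 0))"
  have z_edge: "z (edge g h) = fst (r (inv\<^bsub>G\<^esub> g \<otimes>\<^bsub>G\<^esub> h)) (U #>\<^bsub>G\<^esub> g)" if "g \<in> carrier G" "h \<in> carrier G" for g h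
    using that by (simp add: z_def)
  have zc: "z \<in> inv_cochains G U (prime_field p) 1"
    unfolding inv_cochains_1_iff
  proof (intro conjI ballI)
    show "z \<in> tuples G 1 \<rightarrow>\<^sub>E {0..<int p}"
      using rc coset by (intro PiE_I) (force simp: tuples_1 z_edge, simp add: z_def)
    let ?P = "product_topology (\<lambda>_. topo G) {..1::nat}"
    have "continuous_map ?P (discrete_topology (carrier (wreath ?A (G Mod U)))) (\<lambda>e. r (inv\<^bsub>G\<^esub> e 0 \<otimes>\<^bsub>G\<^esub> e 1))"
      using continuous_map_compose[OF continuous_map_quotient_edge[OF G]] r by (fastforce simp: cont_hom_def comp_def)
    moreover have "continuous_map ?P (discrete_topology ?Q) (\<lambda>e. U #>\<^bsub>G\<^esub> e 0)"
      using continuous_map_compose[of ?P "topo G" "\<lambda>e. e 0"] quotient_cont_hom[OF G U Uop]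
      by (fastforce simp: cont_hom_def comp_def intro: continuous_map_product_projection)
    ultimately have "continuous_map ?P (discrete_topology {0..<int p}) (\<lambda>e. fst (r (inv\<^bsub>G\<^esub> e 0 \<otimes>\<^bsub>G\<^esub> e 1)) (U #>\<^bsub>G\<^esub> e 0))"
      by (rule continuous_map_discrete_pair[where k = "\<lambda>a C. fst a C"])
         (auto simp: topological_groupD[OF G] PiE_iff intro!: rc coset simp del: atLeastLessThan_iff)
    then show "continuous_map ?P (discrete_topology {0..<int p}) z"
      by (rule continuous_map_eq) (simp add: z_def tuples_def topological_groupD[OF G])
    fix s g h assume s: "s \<in> U" "g \<in> carrier G" "h \<in> carrier G"
    then have sG: "s \<in> carrier G" by (simp add: U.mem_carrier)
    have "inv\<^bsub>G\<^esub> (s \<otimes>\<^bsub>G\<^esub> g) \<otimes>\<^bsub>G\<^esub> (s \<otimes>\<^bsub>G\<^esub> h) = inv\<^bsub>G\<^esub> g \<otimes>\<^bsub>G\<^esub> h"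
      using inv_mult_telescope[of g "inv\<^bsub>G\<^esub> s" h] s sG by (simp add: inv_mult_group)
    moreover have "U #>\<^bsub>G\<^esub> (s \<otimes>\<^bsub>G\<^esub> g) = U #>\<^bsub>G\<^esub> g"
      using s sG U.subset by (simp flip: coset_mult_assoc) (simp add: U.rcos_const U.subgroup_axioms)
    ultimately show "z (edge (s \<otimes>\<^bsub>G\<^esub> g) (s \<otimes>\<^bsub>G\<^esub> h)) = z (edge g h)"
      using s sG by (simp add: z_edge)
  qed
  have z: "z \<in> inv_cocycles G U (prime_field p) 1"
    unfolding inv_cocycles_1_iff[OF p]
  proof (intro conjI ballI zc)
    fix g h k assume g: "g \<in> carrier G" "h \<in> carrier G" "k \<in> carrier G"
    \<comment> \<open>The coordinate for the pair \<open>(h, k)\<close> is read at the coset of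
      \<open>h\<close>, which is the coset of \<open>g\<close> shifted exactly as in the wreath
      multiplication.\<close>
    have "(U #>\<^bsub>G\<^esub> g) \<otimes>\<^bsub>G Mod U\<^esub> (U #>\<^bsub>G\<^esub> (inv\<^bsub>G\<^esub> g \<otimes>\<^bsub>G\<^esub> h)) = U #>\<^bsub>G\<^esub> (g \<otimes>\<^bsub>G\<^esub> (inv\<^bsub>G\<^esub> g \<otimes>\<^bsub>G\<^esub> h))"
      using g by (simp add: U.rcos_sum)
    also have "g \<otimes>\<^bsub>G\<^esub> (inv\<^bsub>G\<^esub> g \<otimes>\<^bsub>G\<^esub> h) = h" using g by (simp flip: m_assoc)
    finally show "z (edge g k) = (z (edge g h) + z (edge h k)) mod int p"
      using rmul[of "inv\<^bsub>G\<^esub> g \<otimes>\<^bsub>G\<^esub> h" "inv\<^bsub>G\<^esub> h \<otimes>\<^bsub>G\<^esub> k" "U #>\<^bsub>G\<^esub> g"] g coset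
      by (simp only: inv_mult_telescope z_edge m_closed inv_closed)
  qed
  have restr: "restrict z (tuples (top_subgroup G U) 1) = cocycle_of (top_subgroup G U) (\<lambda>u. fst (r u) U)"
  proof
    fix e show "restrict z (tuples (top_subgroup G U) 1) e = cocycle_of (top_subgroup G U) (\<lambda>u. fst (r u) U) e"
    proof (cases "e \<in> tuples (top_subgroup G U) 1")
      case True
      then obtain u w where uw: "u \<in> U" "w \<in> U" "e = edge u w" by (auto simp: tuples_1)
      then have "U #>\<^bsub>G\<^esub> u = U" by (simp add: U.rcos_const U.subgroup_axioms)
      then show ?thesis using uw True
        by (simp add: z_edge U.mem_carrier inv_top_subgroup[OF is_group U.subgroup_axioms])
    qed (simp add: cocycle_of_def)
  qed
  have norm: "norm_cochain G U (prime_field p) 1 z = cocycle_of G (\<lambda>g. (\<Sum>C\<in>?Q. fst (r g) C) mod int p)"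
  proof
    fix e show "norm_cochain G U (prime_field p) 1 z e = cocycle_of G (\<lambda>g. (\<Sum>C\<in>?Q. fst (r g) C) mod int p) e"
    proof (cases "e \<in> tuples G 1")
      case True
      then obtain g h where g: "g \<in> carrier G" "h \<in> carrier G" and e: "e = edge g h" by (auto simp: tuples_1)
      let ?t = "\<lambda>C. SOME t. t \<in> C"
      have "z (edge (?t C \<otimes>\<^bsub>G\<^esub> g) (?t C \<otimes>\<^bsub>G\<^esub> h)) = fst (r (inv\<^bsub>G\<^esub> g \<otimes>\<^bsub>G\<^esub> h)) (C \<otimes>\<^bsub>G Mod U\<^esub> (U #>\<^bsub>G\<^esub> g))"
        if C: "C \<in> ?Q" for C
      proof -
        have tG: "?t C \<in> carrier G" and "U #>\<^bsub>G\<^esub> ?t C = C"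
          using some_rcoset_representative[OF U.subgroup_axioms, of C] C by (simp_all add: FactGroup_def)
        note this(2)
        moreover have "U #>\<^bsub>G\<^esub> (?t C \<otimes>\<^bsub>G\<^esub> g) = (U #>\<^bsub>G\<^esub> ?t C) <#>\<^bsub>G\<^esub> (U #>\<^bsub>G\<^esub> g)"
          using tG g by (simp add: U.rcos_sum)
        moreover have "inv\<^bsub>G\<^esub> (?t C \<otimes>\<^bsub>G\<^esub> g) \<otimes>\<^bsub>G\<^esub> (?t C \<otimes>\<^bsub>G\<^esub> h) = inv\<^bsub>G\<^esub> g \<otimes>\<^bsub>G\<^esub> h"
          using inv_mult_telescope[of g "inv\<^bsub>G\<^esub> ?t C" h] g tG by (simp add: inv_mult_group)
        ultimately show ?thesis using g tG by (simp add: z_edge)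
      qed
      then have "norm_cochain G U (prime_field p) 1 z e = (\<Sum>C\<in>?Q. fst (r (inv\<^bsub>G\<^esub> g \<otimes>\<^bsub>G\<^esub> h)) (C \<otimes>\<^bsub>G Mod U\<^esub> (U #>\<^bsub>G\<^esub> g))) mod int p"
        unfolding e norm_cochain_1_edge[OF p is_group U fin zc g] by simp
      also have "(\<Sum>C\<in>?Q. fst (r (inv\<^bsub>G\<^esub> g \<otimes>\<^bsub>G\<^esub> h)) (C \<otimes>\<^bsub>G Mod U\<^esub> (U #>\<^bsub>G\<^esub> g))) = (\<Sum>C\<in>?Q. fst (r (inv\<^bsub>G\<^esub> g \<otimes>\<^bsub>G\<^esub> h)) C)"
        by (rule sum.reindex_bij_betw[OF Q.bij_betw_mult_right[OF coset[OF g(1)]]])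
      finally show ?thesis using g e by simp
    qed (simp add: norm_cochain_def cocycle_of_def)
  qed
  from cohomology_class_1[OF p G cocycle_of_in_inv_cocycles[OF p G wreath_sum_cont_hom[OF p U fin r snd]]]
  have cls: "cohomology_class G (prime_field p) 1 (norm_cochain G U (prime_field p) 1 z) =
    {cocycle_of G (\<lambda>g. (\<Sum>C\<in>?Q. fst (r g) C) mod int p)}" unfolding norm .
  \<comment> \<open>\<open>corestriction\<close> is a union over all \<open>U\<close>-invariant
    extensions. They share the norm of \<open>z\<close>, so the union is a single class.\<close>
  have uniq: "norm_cochain G U (prime_field p) 1 y = norm_cochain G U (prime_field p) 1 z"
    if y: "y \<in> inv_cocycles G U (prime_field p) 1" "restrict y (tuples (top_subgroup G U) 1) = restrict z (tuples (top_subgroup G U) 1)" for y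
  proof (rule norm_cochain_1_cong[OF p G U fin y(1) z])
    fix u w assume "u \<in> U" "w \<in> U"
    then have "edge u w \<in> tuples (top_subgroup G U) 1" by simp
    then show "y (edge u w) = z (edge u w)" using fun_cong[OF y(2), of "edge u w"] by simp
  qed
  let ?E = "{y \<in> inv_cocycles G U (prime_field p) 1.
    restrict y (tuples (top_subgroup G U) 1) \<in> {cocycle_of (top_subgroup G U) (\<lambda>u. fst (r u) U)}}"
  have "cohomology_class G (prime_field p) 1 (norm_cochain G U (prime_field p) 1 y) =
      {cocycle_of G (\<lambda>g. (\<Sum>C\<in>?Q. fst (r g) C) mod int p)}" if "y \<in> ?E" for y
  proof -
    have "norm_cochain G U (prime_field p) 1 y = norm_cochain G U (prime_field p) 1 z"
      by (rule uniq) (use that restr in simp_all)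
    then show ?thesis using cls by (simp only:)
  qed
  moreover have "z \<in> ?E" using z restr by simp
  ultimately show ?thesis unfolding corestriction_def by blast
qed

text \<open>Preimages under corestriction are supplied as homomorphisms to the wreath product,
  because these show both the character of \<open>U\<close>, as the coordinate at \<open>U\<close>,
  and its corestriction, as the sum of the coordinates.\<close>

lemma kijima_nishiI:
  assumes p: "prime p" and G: "topological_group G"
    and lift: "\<And>U \<alpha>. U \<lhd> G \<Longrightarrow> openin (topo G) U \<Longrightarrow> card (carrier (G Mod U)) = p \<Longrightarrow> \<alpha> \<in> radical_chars p G \<Longrightarrow>
      \<exists>r\<in>cont_hom G (wreath (integer_mod_group p) (G Mod U)).
        (\<forall>g\<in>carrier G. snd (r g) = U #>\<^bsub>G\<^esub> g \<and> (\<Sum>C\<in>carrier (G Mod U). fst (r g) C) mod int p = \<alpha> g) \<and>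
        (\<lambda>u. fst (r u) U) \<in> radical_chars p (top_subgroup G U)"
  shows "kijima_nishi p G"
  unfolding kijima_nishi_def
proof (intro allI impI subsetI)
  fix U A assume U: "U \<lhd> G" "openin (topo G) U" "card (rcosets\<^bsub>G\<^esub> U) = p" and A: "A \<in> cup_radical p G"
  interpret U: normal U G by (rule U(1))
  have card: "card (carrier (G Mod U)) = p" using U(3) by (simp add: FactGroup_def)
  then have fin: "finite (carrier (G Mod U))" using prime_gt_0_nat[OF p] card_ge_0_finite by blast
  obtain \<alpha> where \<alpha>: "\<alpha> \<in> radical_chars p G" "A = {cocycle_of G \<alpha>}"
    using A by (auto simp: cup_radical_eq[OF p G])
  obtain r where r: "r \<in> cont_hom G (wreath (integer_mod_group p) (G Mod U))"
    "\<And>g. g \<in> carrier G \<Longrightarrow> snd (r g) = U #>\<^bsub>G\<^esub> g"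
    "\<And>g. g \<in> carrier G \<Longrightarrow> (\<Sum>C\<in>carrier (G Mod U). fst (r g) C) mod int p = \<alpha> g"
    "(\<lambda>u. fst (r u) U) \<in> radical_chars p (top_subgroup G U)"
    using lift[OF U(1,2) card \<alpha>(1)] by blast
  have "cocycle_of G (\<lambda>g. (\<Sum>C\<in>carrier (G Mod U). fst (r g) C) mod int p) = cocycle_of G \<alpha>"
    unfolding cocycle_of_def by (rule restrict_ext) (auto simp: tuples_1 r(3))
  then have "A = corestriction G U (prime_field p) 1 {cocycle_of (top_subgroup G U) (\<lambda>u. fst (r u) U)}"
    using corestriction_wreath[OF p G U(1,2) fin r(1,2)] \<alpha>(2) by simp
  then show "A \<in> corestriction G U (prime_field p) 1 ` cup_radical p (top_subgroup G U)"
    using r(4) unfolding cup_radical_eq[OF p topological_group_top_subgroup[OF G U.subgroup_axioms]] by blast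
qed

section \<open>Generalized right-angled Artin groups\<close>

lemma group_pro_p: "pro_p_group p F \<Longrightarrow> group F"
  and topological_group_pro_p: "pro_p_group p F \<Longrightarrow> topological_group F"
  by (simp_all add: pro_p_group_def profinite_group_def topological_group_def)

definition raag_relator :: "'f top_group \<Rightarrow> 'f \<Rightarrow> 'f \<Rightarrow> (nat \<Rightarrow> int) \<times> (nat \<Rightarrow> int) \<Rightarrow> 'f" where
  "raag_relator F x y c = commutator F x y \<otimes>\<^bsub>F\<^esub> inv\<^bsub>F\<^esub> (padic_pow F x (fst c) \<otimes>\<^bsub>F\<^esub> padic_pow F y (snd c))"

lemma generalized_raag_relators_eq:
  "generalized_raag_relators F \<iota> E f = (\<lambda>(v, w). raag_relator F (\<iota> v) (\<iota> w) (f (v, w))) ` E"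
  by (auto simp: generalized_raag_relators_def raag_relator_def)

lemma raag_relator_closed:
  assumes "pro_p_group p F" "x \<in> carrier F" "y \<in> carrier F" "c \<in> padic_int p \<times> padic_int p"
  shows "raag_relator F x y c \<in> carrier F"
proof -
  interpret group F using assms(1) by (rule group_pro_p)
  have "padic_pow F x (fst c) \<in> carrier F" "padic_pow F y (snd c) \<in> carrier F"
    using assms by (auto intro: padic_pow_closed)
  then show ?thesis using assms by (simp add: raag_relator_def commutator_def)
qed

text \<open>The p-adic powers stay inside \<open>h\<close>. They are evaluated in one of two ways:
  by comparison, with \<open>cont_hom_padic_pow_eq\<close>, or by vanishing, with
  \<open>cont_hom_padic_pow_eq_one\<close>.\<close>

lemma cont_hom_raag_relator:
  assumes F: "pro_p_group p F" and h: "h \<in> cont_hom F H" and H: "group H"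
    and x: "x \<in> carrier F" and y: "y \<in> carrier F" and c: "c \<in> padic_int p \<times> padic_int p"
  shows "h (raag_relator F x y c) =
    commutator H (h x) (h y) \<otimes>\<^bsub>H\<^esub> inv\<^bsub>H\<^esub> (h (padic_pow F x (fst c)) \<otimes>\<^bsub>H\<^esub> h (padic_pow F y (snd c)))"
proof -
  interpret F: group F using F by (rule group_pro_p)
  interpret H: group H by fact
  interpret h: group_hom F H h by unfold_locales (use h in \<open>simp add: cont_hom_def\<close>)
  have "padic_pow F x (fst c) \<in> carrier F" "padic_pow F y (snd c) \<in> carrier F"
    using c by (auto intro: padic_pow_closed[OF F] x y)
  then show ?thesis using x y by (simp add: raag_relator_def commutator_def)
qed

lemma (in group) commutator_eq_one_iff:
  assumes "x \<in> carrier G" "y \<in> carrier G"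
  shows "commutator G x y = \<one> \<longleftrightarrow> x \<otimes> y = y \<otimes> x"
proof -
  have "commutator G x y = (x \<otimes> y) \<otimes> inv (y \<otimes> x)"
    using assms by (simp add: commutator_def inv_mult_group m_assoc)
  then show ?thesis
    using assms by (metis inv_closed inv_equality inv_inv m_closed r_inv)
qed

text \<open>The bound on the orders kills both p-adic powers, and only the commutator of the images
  is left.\<close>

lemma cont_hom_raag_relator_trivial_iff:
  assumes p: "prime p" and F: "pro_p_group p F" and h: "h \<in> cont_hom F H" and H: "group H"
    and x: "x \<in> carrier F" and y: "y \<in> carrier F" and c: "c \<in> padic_ideal p k \<times> padic_ideal p k"
    and hx: "h x [^]\<^bsub>H\<^esub> (p ^ k) = \<one>\<^bsub>H\<^esub>" and hy: "h y [^]\<^bsub>H\<^esub> (p ^ k) = \<one>\<^bsub>H\<^esub>"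
  shows "h (raag_relator F x y c) = \<one>\<^bsub>H\<^esub> \<longleftrightarrow> h x \<otimes>\<^bsub>H\<^esub> h y = h y \<otimes>\<^bsub>H\<^esub> h x"
proof -
  interpret H: group H by fact
  have hc: "h x \<in> carrier H" "h y \<in> carrier H" using h x y by (auto simp: cont_hom_def hom_def)
  have c': "c \<in> padic_int p \<times> padic_int p" using c padic_ideal_subset[OF p, of k] by auto
  have "h (padic_pow F x (fst c)) = \<one>\<^bsub>H\<^esub>" "h (padic_pow F y (snd c)) = \<one>\<^bsub>H\<^esub>"
    using c by (auto intro: cont_hom_padic_pow_eq_one[OF p F h H x _ hx] cont_hom_padic_pow_eq_one[OF p F h H y _ hy])
  then have "h (raag_relator F x y c) = commutator H (h x) (h y)"
    using hc by (simp add: cont_hom_raag_relator[OF F h H x y c'] commutator_def)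
  then show ?thesis using H.commutator_eq_one_iff[OF hc] by simp
qed

lemma trivial_cont_hom:
  assumes "topological_group K" "group H"
  shows "(\<lambda>_. \<one>\<^bsub>H\<^esub>) \<in> cont_hom K H"
proof -
  interpret H: group H by fact
  show ?thesis by (auto simp: cont_hom_def hom_def)
qed

lemma wreath_homs:
  assumes "group A" "group Q"
  shows "snd \<in> hom (wreath A Q) Q"
    and "(\<lambda>q. (\<lambda>x\<in>carrier Q. \<one>\<^bsub>A\<^esub>, q)) \<in> hom Q (wreath A Q)"
proof -
  interpret A: group A by fact
  interpret Q: group Q by fact
  show "snd \<in> hom (wreath A Q) Q" by (rule homI) auto
  show "(\<lambda>q. (\<lambda>x\<in>carrier Q. \<one>\<^bsub>A\<^esub>, q)) \<in> hom Q (wreath A Q)"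
    by (rule homI) (auto intro!: restrict_ext)
qed

locale raag_presentation =
  fixes p :: nat and V :: "'v set" and \<iota> :: "'v \<Rightarrow> 'f" and F :: "'f top_group"
    and E :: "('v \<times> 'v) set" and f :: "'v \<times> 'v \<Rightarrow> (nat \<Rightarrow> int) \<times> (nat \<Rightarrow> int)"
    and \<pi> :: "'f \<Rightarrow> 'a" and G :: "'a top_group"
  assumes p: "prime p" and free: "free_pro_p_group p V \<iota> F" and digraph: "combinatorial_digraph V E"
    and exponents: "f \<in> E \<rightarrow> padic_ideal p (if p = 2 then 2 else 1) \<times> padic_ideal p (if p = 2 then 2 else 1)"
    and pres: "presents F (generalized_raag_relators F \<iota> E f) \<pi> G" and G: "topological_group G"
begin

abbreviation "e v \<equiv> \<pi> (\<iota> v)"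
abbreviation "q \<equiv> p ^ (if p = 2 then 2 else 1)"

lemma p_pos: "int p > 0"
  using p prime_gt_0_nat by simp

lemma pro_p: "pro_p_group p F"
  using free by (simp add: free_pro_p_group_def)

lemma topological_group_F: "topological_group F"
  by (rule topological_group_pro_p[OF pro_p])

lemma edges: "(v, w) \<in> E \<Longrightarrow> v \<in> V \<and> w \<in> V \<and> v \<noteq> w"
  using digraph by (auto simp: combinatorial_digraph_def)

lemma generator_F: "v \<in> V \<Longrightarrow> \<iota> v \<in> carrier F"
  using free by (auto simp: free_pro_p_group_def)

lemma generator: "v \<in> V \<Longrightarrow> e v \<in> carrier G"
  using generator_F pres by (auto simp: presents_def hom_def)

lemma exponents_ideal:
  "(v, w) \<in> E \<Longrightarrow> f (v, w) \<in> padic_ideal p (if p = 2 then 2 else 1) \<times> padic_ideal p (if p = 2 then 2 else 1)"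
  by (rule funcset_mem[OF exponents])

lemma exponents_padic: "(v, w) \<in> E \<Longrightarrow> f (v, w) \<in> padic_int p \<times> padic_int p"
  by (rule subsetD[OF Sigma_mono[OF padic_ideal_subset[OF p] padic_ideal_subset[OF p]] exponents_ideal])

lemma relators_closed: "generalized_raag_relators F \<iota> E f \<subseteq> carrier F"
  unfolding generalized_raag_relators_eq
  using edges generator_F exponents_padic by (auto intro!: raag_relator_closed[OF pro_p])

lemma relator_trivial:
  assumes "r \<in> cont_hom G H" "group H" "(v, w) \<in> E"
  shows "r (\<pi> (raag_relator F (\<iota> v) (\<iota> w) (f (v, w)))) = \<one>\<^bsub>H\<^esub>"
proof -
  have "raag_relator F (\<iota> v) (\<iota> w) (f (v, w)) \<in> generalized_raag_relators F \<iota> E f"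
    using assms(3) by (force simp: generalized_raag_relators_eq)
  from presents_relator[OF pres this] show ?thesis
    using hom_one[of r G H] assms(1,2) topological_groupD(1)[OF G] by (simp add: cont_hom_def)
qed

lemma cont_hom_eqI:
  assumes H: "group H" and r: "r \<in> cont_hom G H" "r' \<in> cont_hom G H"
    and eq: "\<And>v. v \<in> V \<Longrightarrow> r (e v) = r' (e v)" and g: "g \<in> carrier G"
  shows "r g = r' g"
proof -
  obtain x where x: "x \<in> carrier F" "g = \<pi> x"
    using g presents_surj[OF pres topological_group_F G] by blast
  have "r (\<pi> x) = r' (\<pi> x)"
    by (rule cont_hom_eq_closure[OF topological_group_F H presents_cont_hom_compose[OF pres r(1)]
          presents_cont_hom_compose[OF pres r(2)] _ _ _ x(1), of "\<iota> ` V"])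
       (use free generator_F eq in \<open>auto simp: free_pro_p_group_def\<close>)
  then show ?thesis using x by simp
qed

lemma edge_commute:
  assumes H: "group H" and r: "r \<in> cont_hom G H" and vw: "(v, w) \<in> E"
    and exp: "r (e v) [^]\<^bsub>H\<^esub> q = \<one>\<^bsub>H\<^esub>" "r (e w) [^]\<^bsub>H\<^esub> q = \<one>\<^bsub>H\<^esub>"
  shows "r (e v) \<otimes>\<^bsub>H\<^esub> r (e w) = r (e w) \<otimes>\<^bsub>H\<^esub> r (e v)"
  using cont_hom_raag_relator_trivial_iff[OF p pro_p presents_cont_hom_compose[OF pres r] H _ _ exponents_ideal[OF vw] exp]
    relator_trivial[OF r H vw] edges[OF vw] generator_F by blast

text \<open>Each relator may be checked in one of two ways. Either the prescribed values at the two
  end points come from some homomorphism of \<open>G\<close>, which may vary with the edge; then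
  \<open>h\<close> agrees with it on the relator. Or the values commute and have order dividing
  \<open>q\<close>. The first way serves wreath products, the second the Heisenberg group.\<close>

lemma extend:
  assumes H: "group H" "finite (carrier H)" "order H = p ^ k" and \<phi>: "\<phi> \<in> V \<rightarrow> carrier H"
    and edge: "\<And>v w. (v, w) \<in> E \<Longrightarrow> (\<exists>r\<in>cont_hom G H. r (e v) = \<phi> v \<and> r (e w) = \<phi> w) \<or>
      (\<phi> v \<otimes>\<^bsub>H\<^esub> \<phi> w = \<phi> w \<otimes>\<^bsub>H\<^esub> \<phi> v \<and> \<phi> v [^]\<^bsub>H\<^esub> q = \<one>\<^bsub>H\<^esub> \<and> \<phi> w [^]\<^bsub>H\<^esub> q = \<one>\<^bsub>H\<^esub>)"
  obtains r where "r \<in> cont_hom G H" "\<And>v. v \<in> V \<Longrightarrow> r (e v) = \<phi> v"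
proof -
  obtain h where h: "h \<in> cont_hom F H" "\<And>v. v \<in> V \<Longrightarrow> h (\<iota> v) = \<phi> v"
    using free_pro_p_group_hom[OF free H \<phi>] by blast
  have "h s = \<one>\<^bsub>H\<^esub>" if sS: "s \<in> generalized_raag_relators F \<iota> E f" for s
  proof -
    obtain v w where vw: "(v, w) \<in> E" and s: "s = raag_relator F (\<iota> v) (\<iota> w) (f (v, w))"
      using sS by (auto simp: generalized_raag_relators_eq)
    have V: "v \<in> V" "w \<in> V" using edges[OF vw] by auto
    note \<iota> = generator_F[OF V(1)] generator_F[OF V(2)]
    note c = exponents_padic[OF vw]
    from edge[OF vw] show ?thesis
    proof
      assume "\<exists>r\<in>cont_hom G H. r (e v) = \<phi> v \<and> r (e w) = \<phi> w"
      then obtain r where r: "r \<in> cont_hom G H" "r (e v) = h (\<iota> v)" "r (e w) = h (\<iota> w)" using h(2) V by auto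
      let ?r = "\<lambda>x. r (\<pi> x)"
      have r': "?r \<in> cont_hom F H" by (rule presents_cont_hom_compose[OF pres r(1)])
      have "h (padic_pow F (\<iota> v) (fst (f (v, w)))) = ?r (padic_pow F (\<iota> v) (fst (f (v, w))))"
        "h (padic_pow F (\<iota> w) (snd (f (v, w)))) = ?r (padic_pow F (\<iota> w) (snd (f (v, w))))"
        using c r(2,3) by (auto intro!: cont_hom_padic_pow_eq[OF pro_p h(1) r' H(1)] \<iota>)
      then have "h s = ?r s"
        unfolding s cont_hom_raag_relator[OF pro_p h(1) H(1) \<iota> c] cont_hom_raag_relator[OF pro_p r' H(1) \<iota> c]
        by (simp only: r(2,3))
      then show ?thesis using relator_trivial[OF r(1) H(1) vw] by (simp add: s)
    next
      assume "\<phi> v \<otimes>\<^bsub>H\<^esub> \<phi> w = \<phi> w \<otimes>\<^bsub>H\<^esub> \<phi> v \<and> \<phi> v [^]\<^bsub>H\<^esub> q = \<one>\<^bsub>H\<^esub> \<and> \<phi> w [^]\<^bsub>H\<^esub> q = \<one>\<^bsub>H\<^esub>"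
      then show ?thesis
        unfolding s using cont_hom_raag_relator_trivial_iff[OF p pro_p h(1) H(1) \<iota> exponents_ideal[OF vw]]
        by (simp only: h(2) V)
    qed
  qed
  from presents_factor[OF pres topological_group_F G H(1) h(1) this relators_closed]
  obtain r where "r \<in> cont_hom G H" "\<And>x. x \<in> carrier F \<Longrightarrow> r (\<pi> x) = h x" by blast
  then show ?thesis using that[of r] h(2) generator_F by simp
qed

text \<open>The character is read off from a map to the Heisenberg group, where
  \<open>heis_exponent\<close> already bounds the orders; the elements \<open>(0, b, 0)\<close>
  commute.\<close>

lemma dual_character:
  assumes "u \<in> V"
  obtains \<beta> where "\<beta> \<in> cont_hom G (integer_mod_group p)" "\<And>v. v \<in> V \<Longrightarrow> \<beta> (e v) = (if v = u then 1 else 0)"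
proof -
  have p1: "int p > 1" using p prime_gt_1_nat by simp
  let ?\<phi> = "\<lambda>v. (0, if v = u then 1 else 0, 0) :: int \<times> int \<times> int"
  have \<phi>: "?\<phi> v \<in> carrier (heis p)" for v using p1 by simp
  have fin: "finite (carrier (heis p))" by (simp add: heis_def)
  obtain r where r: "r \<in> cont_hom G (heis p)" "\<And>v. v \<in> V \<Longrightarrow> r (e v) = ?\<phi> v"
  proof (rule extend[of "heis p" 3 ?\<phi>])
    fix v w
    show "(\<exists>r\<in>cont_hom G (heis p). r (e v) = ?\<phi> v \<and> r (e w) = ?\<phi> w) \<or>
      (?\<phi> v \<otimes>\<^bsub>heis p\<^esub> ?\<phi> w = ?\<phi> w \<otimes>\<^bsub>heis p\<^esub> ?\<phi> v \<and> ?\<phi> v [^]\<^bsub>heis p\<^esub> q = \<one>\<^bsub>heis p\<^esub> \<and> ?\<phi> w [^]\<^bsub>heis p\<^esub> q = \<one>\<^bsub>heis p\<^esub>)"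
      using heis_exponent[OF p \<phi>] by (intro disjI2 conjI) (simp_all only: heis_simps, simp)
  qed (use \<phi> fin group_heis[of p] p_pos order_heis in auto)
  have "(\<lambda>g. fst (snd (r g))) \<in> cont_hom G (integer_mod_group p)"
    using cont_hom_compose[OF r(1) heis_coord_homs(2)] p_pos by simp
  then show ?thesis using that r(2) by force
qed

text \<open>The images of the two end points in the Heisenberg group commute, and comparing corners
  gives \<open>\<alpha> (e v) * \<beta> (e w) = \<alpha> (e w) * \<beta> (e v)\<close> modulo p for
  every character \<beta>. The characters dual to \<open>w\<close> and to \<open>v\<close> single
  out the two values of \<alpha>.\<close>

lemma radical_char_edge:
  assumes \<alpha>: "\<alpha> \<in> radical_chars p G" and vw: "(v, w) \<in> E"
  shows "\<alpha> (e v) = 0" "\<alpha> (e w) = 0"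
proof -
  have V: "v \<in> V" "w \<in> V" "v \<noteq> w" using edges[OF vw] by auto
  have range: "\<alpha> (e u) \<in> {0..<int p}" if "u \<in> V" for u
    using \<alpha> generator[OF that] by (auto simp: radical_chars_def cont_hom_integer_mod[OF p])
  have "(\<alpha> (e v) * \<beta> (e w)) mod int p = (\<alpha> (e w) * \<beta> (e v)) mod int p"
    if "\<beta> \<in> cont_hom G (integer_mod_group p)" for \<beta>
  proof -
    obtain r where r: "r \<in> cont_hom G (heis p)" "\<And>g. g \<in> carrier G \<Longrightarrow> fst (r g) = \<alpha> g"
      "\<And>g. g \<in> carrier G \<Longrightarrow> fst (snd (r g)) = \<beta> g"
      using \<alpha> \<open>\<beta> \<in> _\<close> unfolding radical_chars_def by blast
    have rc: "r (e u) \<in> carrier (heis p)" if "u \<in> V" for u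
      using r(1) generator[OF that] by (auto simp: cont_hom_def hom_def)
    have "r (e v) \<otimes>\<^bsub>heis p\<^esub> r (e w) = r (e w) \<otimes>\<^bsub>heis p\<^esub> r (e v)"
      by (rule edge_commute[OF _ r(1) vw heis_exponent[OF p rc[OF V(1)]] heis_exponent[OF p rc[OF V(2)]]])
         (use p_pos group_heis in simp)
    moreover obtain c d where "r (e v) = (\<alpha> (e v), \<beta> (e v), c)" "r (e w) = (\<alpha> (e w), \<beta> (e w), d)"
      using r(2,3) generator V by (metis prod.collapse)
    ultimately have "(c + d + \<alpha> (e v) * \<beta> (e w)) mod int p = (d + c + \<alpha> (e w) * \<beta> (e v)) mod int p" by simp
    then show ?thesis by (simp add: mod_eq_dvd_iff algebra_simps)
  qed
  note comm = this
  obtain \<beta> where "\<beta> \<in> cont_hom G (integer_mod_group p)" "\<beta> (e v) = 0" "\<beta> (e w) = 1"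
    using dual_character[OF V(2)] V by metis
  with comm[of \<beta>] show "\<alpha> (e v) = 0" using range[OF V(1)] by simp
  obtain \<beta> where "\<beta> \<in> cont_hom G (integer_mod_group p)" "\<beta> (e v) = 1" "\<beta> (e w) = 0"
    using dual_character[OF V(1)] V by metis
  with comm[of \<beta>] show "\<alpha> (e w) = 0" using range[OF V(2)] by simp
qed

section \<open>Lifting a radical character along a normal subgroup of index p\<close>

context
  fixes U :: "'a set"
  assumes U: "U \<lhd> G" "openin (topo G) U" and card: "card (carrier (G Mod U)) = p"
begin

lemma quotient_props:
  shows fin: "finite (carrier (G Mod U))" and Q: "group (G Mod U)"
    and coset: "g \<in> carrier G \<Longrightarrow> U #>\<^bsub>G\<^esub> g \<in> carrier (G Mod U)" and UQ: "U \<in> carrier (G Mod U)"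
proof -
  interpret U: normal U G by (rule U(1))
  show "finite (carrier (G Mod U))" using card p_pos by (metis card_ge_0_finite of_nat_0_less_iff)
  show "group (G Mod U)" by (rule U.factorgroup_is_group)
  then show "U \<in> carrier (G Mod U)" using monoid.one_closed[OF group.is_monoid, of "G Mod U"] by simp
  show "U #>\<^bsub>G\<^esub> g \<in> carrier (G Mod U)" if "g \<in> carrier G" using that by (auto simp: FactGroup_def RCOSETS_def)
qed

text \<open>The order is \<open>(p ^ k) ^ p * p\<close>, a power of p because \<open>U\<close> has
  index p; so \<open>extend\<close> applies to these targets.\<close>

lemma wreath_p_group:
  assumes "group A" "finite (carrier A)" "order A = p ^ k"
  shows "group (wreath A (G Mod U))" "finite (carrier (wreath A (G Mod U)))"
    "order (wreath A (G Mod U)) = p ^ (k * p + 1)"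
  using group_wreath[OF assms(1) Q] finite_wreath[OF assms(2) fin] order_wreath[OF fin, of A] assms(3) card
  by (simp_all add: order_def power_mult power_add)

lemma snd_eq_coset:
  assumes A: "group A" and r: "r \<in> cont_hom G (wreath A (G Mod U))"
    and eq: "\<And>v. v \<in> V \<Longrightarrow> snd (r (e v)) = U #>\<^bsub>G\<^esub> e v" and g: "g \<in> carrier G"
  shows "snd (r g) = U #>\<^bsub>G\<^esub> g"
  by (rule cont_hom_eqI[OF Q cont_hom_compose[OF r wreath_homs(1)[OF A Q]] quotient_cont_hom[OF G U] eq g])

lemma radical_lift:
  assumes \<alpha>: "\<alpha> \<in> radical_chars p G"
  shows "\<exists>r\<in>cont_hom G (wreath (integer_mod_group p) (G Mod U)).
        (\<forall>g\<in>carrier G. snd (r g) = U #>\<^bsub>G\<^esub> g \<and> (\<Sum>C\<in>carrier (G Mod U). fst (r g) C) mod int p = \<alpha> g) \<and>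
        (\<lambda>u. fst (r u) U) \<in> radical_chars p (top_subgroup G U)"
proof -
  interpret U: normal U G by (rule U(1))
  let ?Q = "G Mod U" and ?Z = "integer_mod_group p"
  have Z: "group ?Z" "finite (carrier ?Z)" "order ?Z = p ^ 1"
    using p_pos by (simp_all add: carrier_integer_mod_group order_def)
  have Zc: "carrier ?Z = {0..<int p}" using p_pos by (simp add: carrier_integer_mod_group)
  have He: "group (heis p)" "finite (carrier (heis p))" "order (heis p) = p ^ 3"
    using group_heis p_pos order_heis by (auto simp: heis_def)
  note W = wreath_p_group[OF Z] and WH = wreath_p_group[OF He]
  have \<alpha>h: "\<alpha> \<in> cont_hom G ?Z" using \<alpha> by (simp add: radical_chars_def)
  have \<alpha>c: "\<alpha> g \<in> {0..<int p}" if "g \<in> carrier G" for g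
    using \<alpha>h that by (auto simp: cont_hom_integer_mod[OF p])

  \<comment> \<open>All of \<open>\<alpha> (e v)\<close> sits at the coset \<open>U\<close>, so that
    the coordinates add up to it.\<close>
  let ?\<phi> = "\<lambda>v. (\<lambda>C\<in>carrier ?Q. if C = U then \<alpha> (e v) else 0, U #>\<^bsub>G\<^esub> e v)"
  have trivial: "(\<lambda>g. (\<lambda>C\<in>carrier ?Q. 0, U #>\<^bsub>G\<^esub> g)) \<in> cont_hom G (wreath ?Z ?Q)"
    using cont_hom_compose[OF quotient_cont_hom[OF G U] wreath_homs(2)[OF Z(1) Q]] by simp
  obtain r where r: "r \<in> cont_hom G (wreath ?Z ?Q)" "\<And>v. v \<in> V \<Longrightarrow> r (e v) = ?\<phi> v"
  proof (rule extend[OF W, of ?\<phi>])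
    show "?\<phi> \<in> V \<rightarrow> carrier (wreath ?Z ?Q)"
      using \<alpha>c generator coset p_pos by (auto simp: Zc)
    fix v w assume "(v, w) \<in> E"
    then have "?\<phi> v = (\<lambda>C\<in>carrier ?Q. 0, U #>\<^bsub>G\<^esub> e v)" "?\<phi> w = (\<lambda>C\<in>carrier ?Q. 0, U #>\<^bsub>G\<^esub> e w)"
      using radical_char_edge[OF \<alpha>] by (auto intro!: restrict_ext)
    then show "(\<exists>r\<in>cont_hom G (wreath ?Z ?Q). r (e v) = ?\<phi> v \<and> r (e w) = ?\<phi> w) \<or>
      (?\<phi> v \<otimes>\<^bsub>wreath ?Z ?Q\<^esub> ?\<phi> w = ?\<phi> w \<otimes>\<^bsub>wreath ?Z ?Q\<^esub> ?\<phi> v \<and>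
       ?\<phi> v [^]\<^bsub>wreath ?Z ?Q\<^esub> q = \<one>\<^bsub>wreath ?Z ?Q\<^esub> \<and> ?\<phi> w [^]\<^bsub>wreath ?Z ?Q\<^esub> q = \<one>\<^bsub>wreath ?Z ?Q\<^esub>)"
      using trivial by (intro disjI1 bexI[OF _ trivial]) simp
  qed blast
  have snd: "snd (r g) = U #>\<^bsub>G\<^esub> g" if "g \<in> carrier G" for g
    by (rule snd_eq_coset[OF Z(1) r(1) _ that]) (simp add: r(2))
  have sum: "(\<Sum>C\<in>carrier ?Q. fst (r g) C) mod int p = \<alpha> g" if "g \<in> carrier G" for g
  proof (rule cont_hom_eqI[OF Z(1) wreath_sum_cont_hom[OF p U(1) fin r(1) snd] \<alpha>h _ that])
    fix v assume v: "v \<in> V"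
    have "(\<Sum>C\<in>carrier ?Q. fst (r (e v)) C) = (\<Sum>C\<in>carrier ?Q. if C = U then \<alpha> (e v) else 0)"
      by (rule sum.cong) (simp_all add: r(2)[OF v])
    then show "(\<Sum>C\<in>carrier ?Q. fst (r (e v)) C) mod int p = \<alpha> (e v)"
      using UQ fin \<alpha>c[OF generator[OF v]] by (simp add: sum.delta)
  qed
  have restr: "(\<lambda>u. fst (r u) U) \<in> cont_hom (top_subgroup G U) ?Z" by (rule wreath_restrict[OF G U(1) r(1) snd])
  have rW: "r g \<in> carrier (wreath ?Z ?Q)" if "g \<in> carrier G" for g using r(1) that by (auto simp: cont_hom_def hom_def)

  have "\<exists>s\<in>cont_hom (top_subgroup G U) (heis p). \<forall>u\<in>U. fst (s u) = fst (r u) U \<and> fst (snd (s u)) = \<beta> u"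
    if \<beta>: "\<beta> \<in> cont_hom (top_subgroup G U) ?Z" for \<beta>
  proof -
    \<comment> \<open>\<beta> lives on \<open>U\<close> only. Inducing it gives a homomorphism of
      \<open>G\<close>, which can be compared with others on the generators
      \<open>e v\<close>.\<close>
    obtain b where b: "b \<in> cont_hom G (wreath ?Z ?Q)" "\<And>g. g \<in> carrier G \<Longrightarrow> snd (b g) = U #>\<^bsub>G\<^esub> g"
      "\<And>u. u \<in> U \<Longrightarrow> fst (b u) U = \<beta> u"
      using wreath_induce[OF G U fin Z(1) \<beta>] by blast
    have bW: "b g \<in> carrier (wreath ?Z ?Q)" if "g \<in> carrier G" for g using b(1) that by (auto simp: cont_hom_def hom_def)
    have coord: "fst (r g) C \<in> {0..<int p}" "fst (b g) C \<in> {0..<int p}" if "g \<in> carrier G" "C \<in> carrier ?Q" for g C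
      using rW[OF that(1)] bW[OF that(1)] that(2) by (cases "r g"; cases "b g"; force simp: Zc)+
    \<comment> \<open>The lift of \<open>r\<close> and \<open>b\<close> at the generators,
      coordinate by coordinate. The corner 0 makes it coincide with \<open>?b\<close> at end points
      of edges.\<close>
    let ?\<psi> = "\<lambda>v. (\<lambda>C\<in>carrier ?Q. (fst (r (e v)) C, fst (b (e v)) C, 0 :: int), U #>\<^bsub>G\<^esub> e v)"
    let ?b = "\<lambda>g. wreath_map ?Q (\<lambda>b. (0, b, 0)) (b g)"
    have b': "?b \<in> cont_hom G (wreath (heis p) ?Q)"
      using cont_hom_compose[OF b(1) wreath_map_hom[OF heis_coord_homs(3) Q]] p_pos by simp
    obtain s where s: "s \<in> cont_hom G (wreath (heis p) ?Q)" "\<And>v. v \<in> V \<Longrightarrow> s (e v) = ?\<psi> v"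
    proof (rule extend[OF WH, of ?\<psi>])
      show "?\<psi> \<in> V \<rightarrow> carrier (wreath (heis p) ?Q)"
        using coord generator coset p_pos by auto
      fix v w assume vw: "(v, w) \<in> E"
      \<comment> \<open>Where \<alpha> vanishes all coordinates of \<open>r (e u)\<close> are 0, so
        the entries lie in the image of the section \<open>(0, b, 0)\<close>.\<close>
      have "?\<psi> u = ?b (e u)" if "u \<in> V" "\<alpha> (e u) = 0" for u
        using b(2)[OF generator[OF that(1)]] that
        by (cases "b (e u)") (auto simp: wreath_map_def r(2) intro!: restrict_ext)
      then have "?\<psi> v = ?b (e v)" "?\<psi> w = ?b (e w)" using radical_char_edge[OF \<alpha> vw] edges[OF vw] by blast+
      then show "(\<exists>s\<in>cont_hom G (wreath (heis p) ?Q). s (e v) = ?\<psi> v \<and> s (e w) = ?\<psi> w) \<or>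
        (?\<psi> v \<otimes>\<^bsub>wreath (heis p) ?Q\<^esub> ?\<psi> w = ?\<psi> w \<otimes>\<^bsub>wreath (heis p) ?Q\<^esub> ?\<psi> v \<and>
         ?\<psi> v [^]\<^bsub>wreath (heis p) ?Q\<^esub> q = \<one>\<^bsub>wreath (heis p) ?Q\<^esub> \<and> ?\<psi> w [^]\<^bsub>wreath (heis p) ?Q\<^esub> q = \<one>\<^bsub>wreath (heis p) ?Q\<^esub>)"
        by (intro disjI1 bexI[OF _ b']) simp
    qed blast
    have sW: "s g \<in> carrier (wreath (heis p) ?Q)" if "g \<in> carrier G" for g using s(1) that by (auto simp: cont_hom_def hom_def)
    have ssnd: "snd (s g) = U #>\<^bsub>G\<^esub> g" if "g \<in> carrier G" for g
      by (rule snd_eq_coset[OF He(1) s(1) _ that]) (simp add: s(2))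
    \<comment> \<open>\<open>s\<close> is prescribed on generators only. Each coordinate projection
      is a homomorphism, so its identification with \<open>r\<close> or \<open>b\<close> spreads to
      all of \<open>G\<close>.\<close>
    have proj: "wreath_map ?Q k (s g) = x g"
      if k: "k \<in> hom (heis p) ?Z" and x: "x \<in> cont_hom G (wreath ?Z ?Q)"
        and eq: "\<And>v C. v \<in> V \<Longrightarrow> C \<in> carrier ?Q \<Longrightarrow> k (fst (r (e v)) C, fst (b (e v)) C, 0) = fst (x (e v)) C"
        and xs: "\<And>g. g \<in> carrier G \<Longrightarrow> snd (x g) = U #>\<^bsub>G\<^esub> g" and g: "g \<in> carrier G" for k x g
    proof (rule cont_hom_eqI[OF W(1) cont_hom_compose[OF s(1) wreath_map_hom[OF k Q]] x _ g])
      fix v assume v: "v \<in> V"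
      have "x (e v) \<in> carrier (wreath ?Z ?Q)" using x generator[OF v] by (auto simp: cont_hom_def hom_def)
      then have fx: "fst (x (e v)) \<in> carrier ?Q \<rightarrow>\<^sub>E carrier ?Z" by (cases "x (e v)") simp
      have "(\<lambda>C\<in>carrier ?Q. k (fst (r (e v)) C, fst (b (e v)) C, 0)) = fst (x (e v))"
      proof
        fix C show "(\<lambda>C\<in>carrier ?Q. k (fst (r (e v)) C, fst (b (e v)) C, 0)) C = fst (x (e v)) C"
          using eq[OF v] PiE_arb[OF fx] by (cases "C \<in> carrier ?Q") simp_all
      qed
      moreover have "wreath_map ?Q k (?\<psi> v) = (\<lambda>C\<in>carrier ?Q. k (fst (r (e v)) C, fst (b (e v)) C, 0), U #>\<^bsub>G\<^esub> e v)"
        by (auto simp: wreath_map_def intro!: restrict_ext)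
      ultimately show "wreath_map ?Q k (s (e v)) = x (e v)"
        using xs[OF generator[OF v]] by (simp add: s(2)[OF v] prod_eq_iff)
    qed
    have coords: "fst (fst (s u) U) = fst (r u) U" "fst (snd (fst (s u) U)) = \<beta> u" if u: "u \<in> U" for u
    proof -
      have uG: "u \<in> carrier G" using u by (rule U.mem_carrier)
      have *: "fst (wreath_map ?Q k (s u)) U = k (fst (s u) U)" for k :: "int \<times> int \<times> int \<Rightarrow> int"
        using UQ by (cases "s u") (simp add: wreath_map_def)
      have "wreath_map ?Q fst (s u) = r u"
        by (rule proj[OF heis_coord_homs(1) r(1) _ snd uG]) (use p_pos in simp_all)
      then show "fst (fst (s u) U) = fst (r u) U" using *[of fst] by simp
      have "wreath_map ?Q (\<lambda>x. fst (snd x)) (s u) = b u"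
        by (rule proj[OF heis_coord_homs(2) b(1) _ b(2) uG]) (use p_pos in simp_all)
      then show "fst (snd (fst (s u) U)) = \<beta> u" using *[of "\<lambda>x. fst (snd x)"] b(3)[OF u] by simp
    qed
    show ?thesis
      by (rule bexI[OF _ wreath_restrict[OF G U(1) s(1) ssnd]]) (use coords in auto)
  qed
  then have "(\<lambda>u. fst (r u) U) \<in> radical_chars p (top_subgroup G U)"
    using restr by (simp add: radical_chars_def)
  then show ?thesis using r(1) snd sum by blast
qed

end

lemma kijima_nishi: "kijima_nishi p G"
  by (rule kijima_nishiI[OF p G radical_lift])

end

lemma generalized_raag_kijima_nishi:
  assumes p: "prime p" and G: "pro_p_group p G" and free: "free_pro_p_group p V \<iota> F"
    and raag: "generalized_raag p V \<iota> F G"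
  shows "kijima_nishi p G"
proof -
  let ?I = "padic_ideal p (if p = 2 then 2 else 1)"
  obtain E f where E: "combinatorial_digraph V E" and f: "f \<in> E \<rightarrow> ?I \<times> ?I"
    and iso: "top_isomorphic G (presented_group F (generalized_raag_relators F \<iota> E f))"
    using raag unfolding generalized_raag_def Let_def by blast
  let ?S = "generalized_raag_relators F \<iota> E f"
  obtain \<theta> where \<theta>: "\<theta> \<in> top_group_iso G (presented_group F ?S)" using iso by (auto simp: top_isomorphic_def)
  have F: "pro_p_group p F" using free by (simp add: free_pro_p_group_def)
  note tF = topological_group_pro_p[OF F] and tG = topological_group_pro_p[OF G]
  have S: "?S \<subseteq> carrier F"
  proof
    fix s assume sS: "s \<in> ?S"
    obtain v w where vw: "(v, w) \<in> E" and s: "s = raag_relator F (\<iota> v) (\<iota> w) (f (v, w))"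
      using sS by (auto simp: generalized_raag_relators_eq)
    have "f (v, w) \<in> padic_int p \<times> padic_int p"
      by (rule subsetD[OF Sigma_mono[OF padic_ideal_subset[OF p] padic_ideal_subset[OF p]] funcset_mem[OF f vw]])
    moreover have "\<iota> v \<in> carrier F" "\<iota> w \<in> carrier F"
      using E vw free by (auto simp: combinatorial_digraph_def free_pro_p_group_def)
    ultimately show "s \<in> carrier F" unfolding s by (intro raag_relator_closed[OF F])
  qed
  have P: "group (presented_group F ?S)"
    unfolding presented_group_def
    by (rule group_top_quotient[OF normal_closed_normal_closure[OF group_pro_p[OF F] S topological_groupD(2)[OF tF]]])
  have pres: "presents F ?S (\<lambda>x. inv_into (carrier G) \<theta> (closed_normal_closure F ?S #>\<^bsub>F\<^esub> x)) G"
    by (rule presents_iso[OF presents_presented_group[OF tF S] group_pro_p[OF G] P \<theta>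
          topological_groupD(2)[OF tF] topological_groupD(2)[OF tG]])
  interpret raag_presentation p V \<iota> F E f "\<lambda>x. inv_into (carrier G) \<theta> (closed_normal_closure F ?S #>\<^bsub>F\<^esub> x)" G
    by unfold_locales (rule p free E f pres tG)+
  show ?thesis by (rule kijima_nishi)
qed

section \<open>Delta-right-angled Artin groups\<close>

text \<open>The zero character of \<open>U\<close> corestricts to the zero character of
  \<open>G\<close>. It lies in the radical of \<open>U\<close> since every
  \<open>(0, \<beta>)\<close> lifts through the section of the Heisenberg group.\<close>

lemma kijima_nishi_if_radical_trivial:
  assumes p: "prime p" and G: "topological_group G"
    and triv: "\<And>\<alpha> g. \<alpha> \<in> radical_chars p G \<Longrightarrow> g \<in> carrier G \<Longrightarrow> \<alpha> g = 0"
  shows "kijima_nishi p G"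
proof (rule kijima_nishiI[OF p G])
  fix U \<alpha> assume U: "U \<lhd> G" "openin (topo G) U" and \<alpha>: "\<alpha> \<in> radical_chars p G"
  interpret U: normal U G by fact
  let ?Q = "G Mod U" and ?Z = "integer_mod_group p"
  have Q: "group ?Q" by (rule U.factorgroup_is_group)
  have UQ: "U \<in> carrier ?Q" using monoid.one_closed[OF group.is_monoid[OF Q]] by simp
  have p0: "p > 0" using p prime_gt_0_nat by blast
  have tU: "topological_group (top_subgroup G U)" by (rule topological_group_top_subgroup[OF G U.subgroup_axioms])
  have "(\<lambda>g. (\<lambda>C\<in>carrier ?Q. 0, U #>\<^bsub>G\<^esub> g)) \<in> cont_hom G (wreath ?Z ?Q)"
    using cont_hom_compose[OF quotient_cont_hom[OF G U] wreath_homs(2)[of ?Z ?Q]] Q by simp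
  moreover have "(\<lambda>_. 0) \<in> radical_chars p (top_subgroup G U)"
    unfolding radical_chars_def
  proof (intro CollectI conjI ballI)
    show "(\<lambda>_. 0) \<in> cont_hom (top_subgroup G U) ?Z" using trivial_cont_hom[OF tU, of ?Z] by simp
    fix \<beta> assume "\<beta> \<in> cont_hom (top_subgroup G U) ?Z"
    from cont_hom_compose[OF this heis_coord_homs(3)[OF p0]]
    show "\<exists>r\<in>cont_hom (top_subgroup G U) (heis p). \<forall>g\<in>carrier (top_subgroup G U). fst (r g) = 0 \<and> fst (snd (r g)) = \<beta> g"
      by (rule bexI[rotated]) simp
  qed
  ultimately show "\<exists>r\<in>cont_hom G (wreath ?Z ?Q).
      (\<forall>g\<in>carrier G. snd (r g) = U #>\<^bsub>G\<^esub> g \<and> (\<Sum>C\<in>carrier ?Q. fst (r g) C) mod int p = \<alpha> g) \<and>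
      (\<lambda>u. fst (r u) U) \<in> radical_chars p (top_subgroup G U)"
    using triv[OF \<alpha>] UQ by (intro bexI[of _ "\<lambda>g. (\<lambda>C\<in>carrier ?Q. 0, U #>\<^bsub>G\<^esub> g)"]) simp_all
qed

lemma delta_raag_radical_trivial:
  assumes F: "topological_group F" and V: "\<iota> \<in> V \<rightarrow> carrier F" "topo F closure_of generate F (\<iota> ` V) = carrier F"
    and G: "topological_group G" and raag: "delta_raag V \<iota> F G"
    and \<alpha>: "\<alpha> \<in> radical_chars 2 G" and g: "g \<in> carrier G"
  shows "\<alpha> g = 0"
proof -
  interpret F: group F by (rule topological_groupD[OF F])
  interpret G: group G by (rule topological_groupD[OF G])
  obtain E z a where graph: "simple_graph V E"
    and z: "z \<in> V \<rightarrow> carrier (presented_group F (raag_relators F \<iota> E))"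
    and a: "a \<in> top_group_iso (presented_group F (raag_relators F \<iota> E)) (presented_group F (raag_relators F \<iota> E))"
    and agen: "\<forall>v\<in>V. a (presented_generator F (raag_relators F \<iota> E) \<iota> v) =
      z v \<otimes>\<^bsub>presented_group F (raag_relators F \<iota> E)\<^esub>
      inv\<^bsub>presented_group F (raag_relators F \<iota> E)\<^esub> presented_generator F (raag_relators F \<iota> E) \<iota> v
      \<otimes>\<^bsub>presented_group F (raag_relators F \<iota> E)\<^esub> inv\<^bsub>presented_group F (raag_relators F \<iota> E)\<^esub> z v"
    and iso: "top_isomorphic G (top_semidirect (presented_group F (raag_relators F \<iota> E)) order_two_group
      (\<lambda>d. if d = 1 then a else (\<lambda>x. x)))"
    using raag unfolding delta_raag_def Let_def by (elim exE conjE) (rule that)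
  define S where "S = raag_relators F \<iota> E"
  define A where "A = presented_group F S"
  define B where "B = top_semidirect A order_two_group (\<lambda>d. if d = 1 then a else (\<lambda>x. x))"
  let ?\<pi> = "\<lambda>x. closed_normal_closure F S #>\<^bsub>F\<^esub> x"
  note z = z[folded S_def A_def] and a = a[folded S_def A_def]
  have agen: "a (?\<pi> (\<iota> v)) = z v \<otimes>\<^bsub>A\<^esub> inv\<^bsub>A\<^esub> ?\<pi> (\<iota> v) \<otimes>\<^bsub>A\<^esub> inv\<^bsub>A\<^esub> z v" if "v \<in> V" for v
    using agen that by (simp add: S_def A_def presented_generator_def)
  obtain \<theta> where \<theta>: "\<theta> \<in> top_group_iso G B"
    using iso by (auto simp: top_isomorphic_def B_def A_def S_def)
  have S: "S \<subseteq> carrier F"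
    using graph V(1) by (auto simp: S_def raag_relators_def simple_graph_def commutator_def Pi_iff)
  have pres: "presents F S ?\<pi> A" unfolding A_def by (rule presents_presented_group[OF F S])
  interpret A: group A
    unfolding A_def presented_group_def
    by (rule group_top_quotient[OF normal_closed_normal_closure[OF F.is_group S topological_groupD(2)[OF F]]])
  have \<pi>c: "?\<pi> x \<in> carrier A" if "x \<in> carrier F" for x using pres that by (auto simp: presents_def hom_def)
  have ahom: "a \<in> hom A A" using a by (auto simp: top_group_iso_def iso_def)
  then have ac: "a y \<in> carrier A" if "y \<in> carrier A" for y using that by (auto simp: hom_def)
  have a1: "a \<one>\<^bsub>A\<^esub> = \<one>\<^bsub>A\<^esub>" using hom_one[OF ahom A.is_group A.is_group] .
  have two: "carrier order_two_group = {0, 1}" "topo order_two_group = discrete_topology {0, 1}"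
    "\<And>c d. c \<otimes>\<^bsub>order_two_group\<^esub> d = (c + d) mod 2" "\<one>\<^bsub>order_two_group\<^esub> = 0"
  proof -
    have "{0..<2::int} = {0, 1}" by auto
    then show "carrier order_two_group = {0, 1}" "topo order_two_group = discrete_topology {0, 1}"
      by (simp_all add: order_two_group_def carrier_integer_mod_group)
  qed (simp_all add: order_two_group_def)
  have Bc: "carrier B = carrier A \<times> {0, 1}" by (simp add: B_def top_semidirect_def two)
  have Bmult: "(x, c) \<otimes>\<^bsub>B\<^esub> (y, d) = (x \<otimes>\<^bsub>A\<^esub> (if c = 1 then a y else y), (c + d) mod 2)" for x y c d
    by (simp add: B_def top_semidirect_def two)
  have Btopo: "topo B = prod_topology (topo A) (discrete_topology {0, 1})" by (simp add: B_def top_semidirect_def two)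
  have \<theta>bij: "bij_betw \<theta> (carrier G) (carrier B)" and \<theta>h: "\<And>x y. x \<in> carrier G \<Longrightarrow> y \<in> carrier G \<Longrightarrow> \<theta> (x \<otimes>\<^bsub>G\<^esub> y) = \<theta> x \<otimes>\<^bsub>B\<^esub> \<theta> y"
    and \<theta>top: "homeomorphic_map (topo G) (topo B) \<theta>"
    using \<theta> by (auto simp: top_group_iso_def iso_def hom_def)
  have \<theta>c: "\<theta> x \<in> carrier A \<times> {0, 1}" if "x \<in> carrier G" for x using bij_betwE[OF \<theta>bij] that Bc by blast
  have inj: "x = y" if "x \<in> carrier G" "y \<in> carrier G" "\<theta> x = \<theta> y" for x y
    using \<theta>bij that by (auto simp: bij_betw_def inj_on_def)
  define \<eta> where "\<eta> b = inv_into (carrier G) \<theta> b" for b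
  have \<eta>: "\<eta> b \<in> carrier G" "\<theta> (\<eta> b) = b" if "b \<in> carrier A \<times> {0, 1}" for b
    using that \<theta>bij Bc by (auto simp: \<eta>_def bij_betw_def inv_into_into f_inv_into_f)
  \<comment> \<open>\<open>i\<close> embeds the Artin group into \<open>G\<close>, and
    \<open>x\<close> below is the element \<open>x\<^sub>0\<close>, both pulled back along
    \<theta>.\<close>
  define i where "i y = \<eta> (y, 0)" for y
  define x where "x = \<eta> (\<one>\<^bsub>A\<^esub>, 1)"
  have ic: "i y \<in> carrier G" "\<theta> (i y) = (y, 0)" if "y \<in> carrier A" for y using \<eta> that by (auto simp: i_def)
  have xc: "x \<in> carrier G" "\<theta> x = (\<one>\<^bsub>A\<^esub>, 1)" using \<eta> by (auto simp: x_def)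
  have i_mult: "i (y \<otimes>\<^bsub>A\<^esub> y') = i y \<otimes>\<^bsub>G\<^esub> i y'" if "y \<in> carrier A" "y' \<in> carrier A" for y y'
    by (rule inj) (use that in \<open>simp_all add: ic \<theta>h Bmult\<close>)
  have \<theta>1: "\<theta> \<one>\<^bsub>G\<^esub> = (\<one>\<^bsub>A\<^esub>, 0)"
  proof -
    have "i \<one>\<^bsub>A\<^esub> \<otimes>\<^bsub>G\<^esub> i \<one>\<^bsub>A\<^esub> = i \<one>\<^bsub>A\<^esub>" using i_mult[of "\<one>\<^bsub>A\<^esub>" "\<one>\<^bsub>A\<^esub>"] by simp
    then have "i \<one>\<^bsub>A\<^esub> = \<one>\<^bsub>G\<^esub>" using ic(1)[of "\<one>\<^bsub>A\<^esub>"] by (simp add: G.l_cancel_one)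
    then show ?thesis using ic(2)[of "\<one>\<^bsub>A\<^esub>"] by simp
  qed
  have x_square: "x \<otimes>\<^bsub>G\<^esub> x = \<one>\<^bsub>G\<^esub>"
    by (rule inj) (simp_all add: xc \<theta>h Bmult a1 \<theta>1)
  \<comment> \<open>In the semidirect product, conjugation by \<open>x\<^sub>0\<close> is the
    automorphism \<open>a\<close>.\<close>
  have x_conj: "x \<otimes>\<^bsub>G\<^esub> i y = i (a y) \<otimes>\<^bsub>G\<^esub> x" if "y \<in> carrier A" for y
    by (rule inj) (use that ac in \<open>simp_all add: xc ic \<theta>h Bmult\<close>)
  have decomp: "h = i (fst (\<theta> h)) \<or> h = i (fst (\<theta> h)) \<otimes>\<^bsub>G\<^esub> x" if h: "h \<in> carrier G" for h
  proof -
    obtain y d where yd: "\<theta> h = (y, d)" "y \<in> carrier A" "d = 0 \<or> d = 1" using \<theta>c[OF h] by auto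
    then show ?thesis
      using inj[OF h ic(1)[OF yd(2)]] inj[OF h G.m_closed[OF ic(1)[OF yd(2)] xc(1)]] xc ic[OF yd(2)]
      by (auto simp: \<theta>h Bmult)
  qed

  let ?\<epsilon> = "\<lambda>g. snd (\<theta> g)"
  have \<epsilon>: "?\<epsilon> \<in> cont_hom G (integer_mod_group 2)"
    unfolding cont_hom_integer_mod[OF two_is_prime_nat]
  proof (intro conjI ballI)
    have "continuous_map (topo G) (discrete_topology {0, 1}) ?\<epsilon>"
      using continuous_map_compose[OF homeomorphic_imp_continuous_map[OF \<theta>top, unfolded Btopo] continuous_map_snd]
      by (simp add: comp_def)
    moreover have "{0..<int 2} = {0, 1}" by auto
    ultimately show "continuous_map (topo G) (discrete_topology {0..<int 2}) ?\<epsilon>" by simp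
    show "?\<epsilon> \<in> carrier G \<rightarrow> {0..<int 2}" using \<theta>c by fastforce
    fix g h assume gh: "g \<in> carrier G" "h \<in> carrier G"
    show "?\<epsilon> (g \<otimes>\<^bsub>G\<^esub> h) = (?\<epsilon> g + ?\<epsilon> h) mod int 2"
      by (cases "\<theta> g"; cases "\<theta> h") (simp add: \<theta>h[OF gh] Bmult)
  qed
  obtain r where r: "r \<in> cont_hom G (heis 2)" "\<And>g. g \<in> carrier G \<Longrightarrow> fst (r g) = \<alpha> g"
    "\<And>g. g \<in> carrier G \<Longrightarrow> fst (snd (r g)) = snd (\<theta> g)"
    using conjunct2[OF \<alpha>[unfolded radical_chars_def mem_Collect_eq], THEN bspec, OF \<epsilon>] by blast
  interpret H: group "heis 2" by (rule group_heis) simp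
  interpret r: group_hom G "heis 2" r by unfold_locales (use r(1) in \<open>simp add: cont_hom_def\<close>)
  have \<alpha>h: "\<alpha> \<in> cont_hom G (integer_mod_group 2)" using \<alpha> by (simp add: radical_chars_def)
  note \<alpha>h' = \<alpha>h[unfolded cont_hom_integer_mod[OF two_is_prime_nat]]
  have \<alpha>c: "\<alpha> h = 0 \<or> \<alpha> h = 1" if "h \<in> carrier G" for h using \<alpha>h' that by force
  \<comment> \<open>The projection to the group of order two vanishes on the Artin group, so the
    middle entry is 0.\<close>
  have ri: "\<exists>c. r (i y) = (\<alpha> (i y), 0, c)" if "y \<in> carrier A" for y
    using r(2,3)[OF ic(1)[OF that]] ic(2)[OF that] by (metis prod.collapse snd_conv)
  obtain c where rx: "r x = (\<alpha> x, 1, c)" using r(2,3)[OF xc(1)] xc(2) by (metis prod.collapse snd_conv)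
  have "\<alpha> x = 0"
  proof -
    \<comment> \<open>The corner of the square of \<open>(\<alpha> x, 1, c)\<close> is
      \<open>2 c + \<alpha> x\<close>.\<close>
    have "r x \<otimes>\<^bsub>heis 2\<^esub> r x = \<one>\<^bsub>heis 2\<^esub>" using x_square r.hom_mult[OF xc(1) xc(1)] by simp
    then have "(c + c + \<alpha> x) mod 2 = 0" by (simp add: rx)
    then have "even (c + c + \<alpha> x)" by presburger
    then show ?thesis using \<alpha>c[OF xc(1)] by auto
  qed
  \<comment> \<open>Triples with middle entry 0 multiply by adding entries, so modulo 2 they form an
    elementary abelian group.\<close>
  have ri_square: "r (i y) \<otimes>\<^bsub>heis 2\<^esub> r (i y) = \<one>\<^bsub>heis 2\<^esub>" if "y \<in> carrier A" for y
    using ri[OF that] by (auto simp flip: mult_2)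
  have ri_comm: "r (i y) \<otimes>\<^bsub>heis 2\<^esub> r (i y') = r (i y') \<otimes>\<^bsub>heis 2\<^esub> r (i y)" if "y \<in> carrier A" "y' \<in> carrier A" for y y'
    using ri[OF that(1)] ri[OF that(2)] by (auto simp: add.commute)
  have ri_hom: "(\<lambda>y. r (i y)) \<in> hom A (heis 2)"
    by (rule homI) (simp_all add: ic i_mult)
  interpret ri: group_hom A "heis 2" "\<lambda>y. r (i y)" by unfold_locales (rule ri_hom)
  have gen: "\<alpha> (i (?\<pi> (\<iota> v))) = 0" if v: "v \<in> V" for v
  proof -
    let ?y = "?\<pi> (\<iota> v)"
    have y: "?y \<in> carrier A" using V(1) v by (intro \<pi>c) auto
    have zc: "z v \<in> carrier A" using z v by auto
    \<comment> \<open>In an elementary abelian 2-group inverting and conjugating change nothing, so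
      \<open>r\<close> does not distinguish the generator from its image under
      \<open>a\<close>.\<close>
    have "r (i (a ?y)) = r (i (z v)) \<otimes>\<^bsub>heis 2\<^esub> inv\<^bsub>heis 2\<^esub> r (i ?y) \<otimes>\<^bsub>heis 2\<^esub> inv\<^bsub>heis 2\<^esub> r (i (z v))"
      unfolding agen[OF v] using y zc by simp
    also have "inv\<^bsub>heis 2\<^esub> r (i ?y) = r (i ?y)"
      by (rule H.inv_equality[OF ri_square[OF y]]) (use y in simp_all)
    also have "r (i (z v)) \<otimes>\<^bsub>heis 2\<^esub> r (i ?y) \<otimes>\<^bsub>heis 2\<^esub> inv\<^bsub>heis 2\<^esub> r (i (z v)) = r (i ?y)"
      unfolding ri_comm[OF zc y] using y zc by (simp add: H.m_assoc)
    finally have "r (i (a ?y)) = r (i ?y)" .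
    then have "r x \<otimes>\<^bsub>heis 2\<^esub> r (i ?y) = r (i ?y) \<otimes>\<^bsub>heis 2\<^esub> r x"
      using x_conj[OF y] r.hom_mult xc(1) ic(1) y ac by metis
    \<comment> \<open>The corners of \<open>(0, 1, c) (\<alpha>, 0, d)\<close> and of the product in
      the other order differ by \<alpha>.\<close>
    then obtain d where "(c + d) mod 2 = (d + c + \<alpha> (i ?y)) mod 2"
      using ri[OF y] by (auto simp: rx \<open>\<alpha> x = 0\<close>)
    then have "even (\<alpha> (i ?y))" by presburger
    then show ?thesis using \<alpha>c[OF ic(1)[OF y]] by auto
  qed

  have A_image: "carrier A = ?\<pi> ` carrier F" by (auto simp: A_def presented_group_def RCOSETS_def)
  have "quotient_map (topo F) (topo A) ?\<pi>" using pres by (simp add: presents_def)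
  from quotient_imp_surjective_map[OF this] have topA: "topspace (topo A) = carrier A"
    by (simp only: topological_groupD(2)[OF F] A_image)
  have "continuous_map (topo A) (topo G) i"
  proof -
    \<comment> \<open>\<open>i\<close> is defined by choosing preimages; its continuity is read off
      from the topological inverse of \<theta>, with which it agrees.\<close>
    obtain \<eta>' where \<eta>': "homeomorphic_maps (topo G) (topo B) \<theta> \<eta>'" using \<theta>top homeomorphic_map_maps by blast
    have "continuous_map (topo A) (topo B) (\<lambda>y. (y, 0))" unfolding Btopo by (intro continuous_map_pairedI) auto
    from continuous_map_compose[OF this, of "topo G" \<eta>'] have "continuous_map (topo A) (topo G) (\<lambda>y. \<eta>' (y, 0))"
      using \<eta>' by (simp add: homeomorphic_maps_def comp_def)
    moreover have "\<eta>' (y, 0) = i y" if "y \<in> topspace (topo A)" for y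
    proof (rule inj)
      have "(y, 0) \<in> topspace (topo B)" using that by (simp add: Btopo)
      then show "\<eta>' (y, 0) \<in> carrier G" "\<theta> (\<eta>' (y, 0)) = \<theta> (i y)"
        using \<eta>' that topA ic topological_groupD(2)[OF G] by (auto simp: homeomorphic_maps_def continuous_map_def)
    qed (use that topA ic in simp)
    ultimately show ?thesis by (rule continuous_map_eq)
  qed
  then have "(\<lambda>y. \<alpha> (i y)) \<in> cont_hom A (integer_mod_group 2)"
    using continuous_map_compose[of "topo A" "topo G" i _ \<alpha>] \<alpha>h' ic i_mult
    unfolding cont_hom_integer_mod[OF two_is_prime_nat] by (auto simp: comp_def)
  from presents_cont_hom_compose[OF pres this]
  have hom: "(\<lambda>x. \<alpha> (i (?\<pi> x))) \<in> cont_hom F (integer_mod_group 2)" .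
  have zero: "(\<lambda>_. 0) \<in> cont_hom F (integer_mod_group 2)" using trivial_cont_hom[OF F, of "integer_mod_group 2"] by simp
  have "\<alpha> (i (?\<pi> t)) = 0" if "t \<in> carrier F" for t
    by (rule cont_hom_eq_closure[OF F _ hom zero _ V(2) _ that]) (use V(1) gen in auto)
  then have \<alpha>i: "\<alpha> (i y) = 0" if "y \<in> carrier A" for y using that unfolding A_image by blast
  have y: "fst (\<theta> g) \<in> carrier A" using \<theta>c[OF g] by auto
  from decomp[OF g] show "\<alpha> g = 0"
  proof
    assume "g = i (fst (\<theta> g)) \<otimes>\<^bsub>G\<^esub> x"
    then have "\<alpha> g = \<alpha> (i (fst (\<theta> g)) \<otimes>\<^bsub>G\<^esub> x)" by (rule arg_cong)
    also have "\<dots> = (\<alpha> (i (fst (\<theta> g))) + \<alpha> x) mod int 2" using \<alpha>h' ic(1)[OF y] xc(1) by blast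
    finally show ?thesis using \<alpha>i[OF y] \<open>\<alpha> x = 0\<close> by simp
  qed (use \<alpha>i[OF y] in simp)
qed

theorem theorem4:
  fixes p :: nat and G :: "'a top_group"
    and V :: "'v set" and \<iota> :: "'v \<Rightarrow> 'f" and F :: "'f top_group"
  assumes "prime p"
    and "pro_p_group p G"
    and "free_pro_p_group p V \<iota> F"
    and "generalized_raag p V \<iota> F G \<or> (p = 2 \<and> delta_raag V \<iota> F G)"
  shows "kijima_nishi p G"
  using assms(4)
proof
  assume "generalized_raag p V \<iota> F G"
  then show ?thesis by (rule generalized_raag_kijima_nishi[OF assms(1-3)])
next
  assume delta: "p = 2 \<and> delta_raag V \<iota> F G"
  have F: "topological_group F" "\<iota> \<in> V \<rightarrow> carrier F" "topo F closure_of generate F (\<iota> ` V) = carrier F"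
    using assms(3) topological_group_pro_p by (auto simp: free_pro_p_group_def)
  note G = topological_group_pro_p[OF assms(2)]
  show ?thesis
  proof (rule kijima_nishi_if_radical_trivial[OF assms(1) G])
    fix \<alpha> g assume "\<alpha> \<in> radical_chars p G" "g \<in> carrier G"
    then show "\<alpha> g = 0"
      using delta_raag_radical_trivial[OF F G conjunct2[OF delta]] conjunct1[OF delta] by simp
  qed
qed

end
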